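(* The process $(A_{L_t},\Gamma_t)$, $t\ge0$, is a Hunt process whose transition probabilities $p_t^\Gamma((x,r);dy,dw)$ satisfy $$p_t^\Gamma((x,0);dy,dw)=\mathbb{P}^{(x,0)}(A_{L_t}\in dy,\ \Gamma_t\in dw),$$ $$p_t^\Gamma((x,r);dy,dw)=\mathbf{1}_{[r>t]}\,\delta_x(dy)\,\delta_{r-t}(dw)+\mathbf{1}_{[r\le t]}\,p_{t-r}^\Gamma((x,0);dy,dw),$$ for all $x\in\mathbb{R}$ and $r>0$.
   Context: Let $\phi(\lambda)=b\lambda+\int_{(0,+\infty)}(1-e^{-\lambda s})\,\nu(ds)$, where $b\ge 0$ and $\nu$ is a measure on $(0,+\infty)$ with $\int_{(0,+\infty)}(1\wedge s)\,\nu(ds)<+\infty$. Assume $b>0$ or $\nu(0,+\infty)=+\infty$. Let $\mu_t$ be the one-dimensional law of the subordinator with Laplace exponent $\phi$, i.e. $\int e^{-\lambda w}\mu_t(dw)=e^{-t\phi(\lambda)}$. The assumption makes the subordinator strictly increasing. Consider the convolution (Feller) semigroup $T_tu(x,v)=\int_{\mathbb{R}^2}u(x+y,v+w)\,\delta_t(dy)\,\mu_t(dw)$ on $C_0(\mathbb{R}^2)$, and let $(A_t,\sigma_t)_{t\ge0}$ be the associated canonical càdlàg process on $(\Omega,\mathcal{F}_\infty,(\mathcal{F}_t)_{t\ge0},\mathbb{P}^{(x,v)})$, with $(\mathcal{F}_t)$ the natural filtration and $\mathbb{P}^{(x,v)}(A_0=x,\sigma_0=v)=1$, $(x,v)\in\mathbb{R}^2$.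 Thus $A_t=x+t$ is a pure drift, and $\sigma$ is an independent strictly increasing subordinator started from $v$. Define $L_t=\inf\{s>0:\sigma_s>t\}$, $D_t=\sigma_{L_t}$ (overshooting) and $\Gamma_t=D_t-t$ (remaining lifetime process, right-continuous). Under $\mathbb{P}^{(x,0)}$ one has $L_0=0$, $\Gamma_0=0$ and $A_{L_t}=x+L_t$. A state $(x,r)$ with $r>0$ corresponds to conditioning on $A_{L_0}=x$, $\Gamma_0=r$. A Hunt process is a strong Markov càdlàg process which is quasi-left-continuous. $\delta_z$ denotes the Dirac mass at $z$. *)

theory Defs
  imports "HOL-Probability.Probability"
begin

text \<open>Processes are indexed by nonnegative reals and are functions on \<^typ>\<open>real\<close> whose values at
  negative times are irrelevant; filtrations and stopping times are indexed by \<^typ>\<open>ennreal\<close>, so that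
  a stopping time may be infinite.\<close>

section \<open>Cadlag paths and filtrations\<close>

definition cadlag :: "'a::topological_space set \<Rightarrow> (real \<Rightarrow> 'a) \<Rightarrow> bool" where
  "cadlag E f \<longleftrightarrow>
     (\<forall>t\<ge>0. f t \<in> E \<and> (f \<longlongrightarrow> f t) (at_right t)) \<and>
     (\<forall>t>0. \<exists>l\<in>E. (f \<longlongrightarrow> l) (at_left t))"

definition natural_filtration ::
    "'w measure \<Rightarrow> 'a measure \<Rightarrow> (real \<Rightarrow> 'w \<Rightarrow> 'a) \<Rightarrow> ennreal \<Rightarrow> 'w measure" where
  "natural_filtration M S X t =
     vimage_algebra (space M)
       (\<lambda>\<omega>. \<lambda>s\<in>{s. 0 \<le> s \<and> ennreal s \<le> t}. X s \<omega>)
       (\<Pi>\<^sub>M s\<in>{s. 0 \<le> s \<and> ennreal s \<le> t}. S)"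

text \<open>The right limits of a filtration. The index \<^term>\<open>\<top>\<close> is always part of the intersection, which
  changes nothing for finite times and gives the terminal sigma-algebra at time \<^term>\<open>\<top>\<close>.\<close>

definition right_cont_filtration ::
    "'w set \<Rightarrow> (ennreal \<Rightarrow> 'w measure) \<Rightarrow> ennreal \<Rightarrow> 'w measure" where
  "right_cont_filtration \<Omega> F t = sigma \<Omega> (\<Inter>s\<in>{s. t < s} \<union> {\<top>}. sets (F s))"

section \<open>Hunt processes\<close>

text \<open>Honest (conservative) transition functions on a Borel state space \<^term>\<open>E\<close>.\<close>

definition transition_function ::
    "'a::topological_space set \<Rightarrow> (real \<Rightarrow> 'a \<Rightarrow> 'a measure) \<Rightarrow> bool" where
  "transition_function E p \<longleftrightarrow>
     (\<forall>t\<ge>0. p t \<in> measurable (restrict_space borel E) (prob_algebra (restrict_space borel E))) \<and>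
     (\<forall>z\<in>E. p 0 z = return (restrict_space borel E) z) \<and>
     (\<forall>s\<ge>0. \<forall>t\<ge>0. \<forall>z\<in>E. p (s + t) z = p s z \<bind> p t)"

definition strong_markov ::
    "'a::topological_space set \<Rightarrow> 'w measure \<Rightarrow> (ennreal \<Rightarrow> 'w measure) \<Rightarrow> ('a \<Rightarrow> 'w measure) \<Rightarrow>
     (real \<Rightarrow> 'w \<Rightarrow> 'a) \<Rightarrow> (real \<Rightarrow> 'a \<Rightarrow> 'a measure) \<Rightarrow> bool" where
  "strong_markov E M G P X p \<longleftrightarrow>
     (\<forall>z\<in>E. \<forall>T. stopping_time G T \<longrightarrow>
       (\<forall>t\<ge>0. \<forall>B\<in>sets (restrict_space borel E).
         AE \<omega> in P z. T \<omega> < \<top> \<longrightarrow>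
           real_cond_exp (P z) (filtration.pre_sigma (space M) G T)
             (indicator {\<omega> \<in> space M. T \<omega> < \<top> \<and> X (enn2real (T \<omega>) + t) \<omega> \<in> B}) \<omega>
           = measure (p t (X (enn2real (T \<omega>)) \<omega>)) B))"

definition quasi_left_continuous ::
    "'a::topological_space set \<Rightarrow> 'w measure \<Rightarrow> (ennreal \<Rightarrow> 'w measure) \<Rightarrow> ('a \<Rightarrow> 'w measure) \<Rightarrow>
     (real \<Rightarrow> 'w \<Rightarrow> 'a) \<Rightarrow> bool" where
  "quasi_left_continuous E M G P X \<longleftrightarrow>
     (\<forall>z\<in>E. \<forall>T :: nat \<Rightarrow> 'w \<Rightarrow> ennreal.
       (\<forall>n. stopping_time G (T n)) \<and> (\<forall>\<omega>\<in>space M. incseq (\<lambda>n. T n \<omega>)) \<longrightarrow>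
       (AE \<omega> in P z. (SUP n. T n \<omega>) < \<top> \<longrightarrow>
         (\<lambda>n. X (enn2real (T n \<omega>)) \<omega>) \<longlonglongrightarrow> X (enn2real (SUP n. T n \<omega>)) \<omega>))"

text \<open>The reference filtration is the right-continuous version of the natural filtration of
  \<^term>\<open>X\<close>. The measure \<^term>\<open>M\<close> only carries the measurable space underlying all the laws
  \<^term>\<open>P z\<close>.\<close>

definition hunt_process ::
    "'a::topological_space set \<Rightarrow> 'w measure \<Rightarrow> ('a \<Rightarrow> 'w measure) \<Rightarrow>
     (real \<Rightarrow> 'w \<Rightarrow> 'a) \<Rightarrow> (real \<Rightarrow> 'a \<Rightarrow> 'a measure) \<Rightarrow> bool" where
  "hunt_process E M P X p \<longleftrightarrow>
     (let S = restrict_space borel E;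
          G = right_cont_filtration (space M) (natural_filtration M S X)
      in transition_function E p \<and>
         (\<forall>z\<in>E. sets (P z) = sets M \<and> prob_space (P z)) \<and>
         (\<forall>t\<ge>0. X t \<in> measurable M S) \<and>
         (\<forall>z\<in>E. AE \<omega> in P z. X 0 \<omega> = z) \<and>
         (\<forall>z\<in>E. \<forall>t\<ge>0. distr (P z) S (X t) = p t z) \<and>
         (\<forall>z\<in>E. AE \<omega> in P z. cadlag E (\<lambda>t. X t \<omega>)) \<and>
         strong_markov E M G P X p \<and>
         quasi_left_continuous E M G P X)"

section \<open>The subordinator and the canonical process of drift and subordinator\<close>

definition levy_measure :: "real measure \<Rightarrow> bool" where
  "levy_measure \<nu> \<longleftrightarrow>
     sets \<nu> = sets (restrict_space borel {0<..}) \<and> (\<integral>\<^sup>+ s. ennreal (min 1 s) \<partial>\<nu>) < \<infinity>"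

definition laplace_exponent :: "real \<Rightarrow> real measure \<Rightarrow> real \<Rightarrow> real" where
  "laplace_exponent b \<nu> l = b * l + (\<integral>s. (1 - exp (- l * s)) \<partial>\<nu>)"

definition subordinator_laws :: "(real \<Rightarrow> real) \<Rightarrow> (real \<Rightarrow> real measure) \<Rightarrow> bool" where
  "subordinator_laws \<phi> \<mu> \<longleftrightarrow>
     (\<forall>t\<ge>0. sets (\<mu> t) = sets borel \<and> prob_space (\<mu> t) \<and> (AE w in \<mu> t. 0 \<le> w) \<and>
       (\<forall>l\<ge>0. (\<integral>w. exp (- l * w) \<partial>\<mu> t) = exp (- t * \<phi> l)))"

definition C_0 :: "('a::real_normed_vector \<Rightarrow> real) set" where
  "C_0 = {u. continuous_on UNIV u \<and> (u \<longlongrightarrow> 0) at_infinity}"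

definition drift_subordinator_semigroup ::
    "(real \<Rightarrow> real measure) \<Rightarrow> real \<Rightarrow> (real \<times> real \<Rightarrow> real) \<Rightarrow> real \<times> real \<Rightarrow> real" where
  "drift_subordinator_semigroup \<mu> t u =
     (\<lambda>(x, v). \<integral>(y, w). u (x + y, v + w) \<partial>(return borel t \<Otimes>\<^sub>M \<mu> t))"

text \<open>Skorokhod space of the plane: the canonical process is \<open>\<omega> t = (A\<^sub>t, \<sigma>\<^sub>t)\<close>. Paths are
  extensional on the time set, so that each of them is represented once.\<close>

definition path_space :: "(real \<Rightarrow> real \<times> real) measure" where
  "path_space = restrict_space (\<Pi>\<^sub>M t\<in>{0..}. borel) {\<omega>. cadlag UNIV \<omega>}"

definition canonical_process_laws ::
    "(real \<Rightarrow> (real \<times> real \<Rightarrow> real) \<Rightarrow> real \<times> real \<Rightarrow> real) \<Rightarrow>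
     (real \<times> real \<Rightarrow> (real \<Rightarrow> real \<times> real) measure) \<Rightarrow> bool" where
  "canonical_process_laws Tsg P \<longleftrightarrow>
     (\<forall>z. sets (P z) = sets path_space \<and> prob_space (P z) \<and> (AE \<omega> in P z. \<omega> 0 = z) \<and>
       (\<forall>s\<ge>0. \<forall>t\<ge>0. \<forall>u\<in>C_0. AE \<omega> in P z.
         real_cond_exp (P z) (natural_filtration path_space borel (\<lambda>r \<omega>. \<omega> r) (ennreal s))
           (\<lambda>\<omega>. u (\<omega> (s + t))) \<omega> = Tsg t u (\<omega> s)))"

section \<open>The time-changed process\<close>

definition drift_part :: "real \<Rightarrow> (real \<Rightarrow> real \<times> real) \<Rightarrow> real" where
  "drift_part t \<omega> = fst (\<omega> t)"

definition subordinator :: "real \<Rightarrow> (real \<Rightarrow> real \<times> real) \<Rightarrow> real" where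
  "subordinator t \<omega> = snd (\<omega> t)"

definition first_passage :: "real \<Rightarrow> (real \<Rightarrow> real \<times> real) \<Rightarrow> ereal" where
  "first_passage t \<omega> = Inf (ereal ` {s. 0 < s \<and> t < subordinator s \<omega>})"

definition overshooting :: "real \<Rightarrow> (real \<Rightarrow> real \<times> real) \<Rightarrow> real" where
  "overshooting t \<omega> = subordinator (real_of_ereal (first_passage t \<omega>)) \<omega>"

definition remaining_lifetime :: "real \<Rightarrow> (real \<Rightarrow> real \<times> real) \<Rightarrow> real" where
  "remaining_lifetime t \<omega> = overshooting t \<omega> - t"

text \<open>The process \<open>(A\<^bsub>L\<^sub>t\<^esub>, \<Gamma>\<^sub>t)\<close>, where \<open>A\<close>, \<open>\<sigma>\<close>, \<open>L\<close>, \<open>D\<close>, \<open>\<Gamma>\<close> are the five functions above. The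
  Skorokhod space also contains paths with \<open>L\<^sub>t = \<infinity>\<close>; they form a null set under the laws considered,
  and the value there is an arbitrary point of the state space.\<close>

definition time_changed_process :: "real \<Rightarrow> (real \<Rightarrow> real \<times> real) \<Rightarrow> real \<times> real" where
  "time_changed_process t \<omega> =
     (if first_passage t \<omega> = \<infinity> then (0, 0)
      else (drift_part (real_of_ereal (first_passage t \<omega>)) \<omega>, remaining_lifetime t \<omega>))"

end

theory Submission
  imports Defs
begin

text \<open>Write \<open>X\<close> for the process \<open>(A\<^bsub>L\<^sub>t\<^esub>, \<Gamma>\<^sub>t)\<close>. Restarting a path at \<open>L\<^sub>s\<close> and lowering its second coordinate by \<open>s\<close>
  gives a path starting at \<open>X\<^sub>s\<close> whose own process \<open>X\<close> at time \<open>t\<close> is \<open>X\<^bsub>s+t\<^esub>\<close>. The increments after \<open>L\<^sub>s\<close> are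
  independent of the past of \<open>X\<close> up to \<open>s\<close> and distributed as under \<open>P\<^sup>0\<close>, which is the Markov property.

  From \<open>(x, r)\<close> the process first descends deterministically to \<open>(x, 0)\<close>, and from there its displacement
  does not depend on \<open>x\<close> and is right-continuous at time 0. Hence the mean of \<open>min 1 (dist z X\<^sub>h)\<close> under \<open>P\<^sup>z\<close>
  tends to 0 with \<open>h\<close>, uniformly in the starting point \<open>z\<close>. With the Markov property this makes the
  semigroup continuous in \<open>r\<close>: no potential theory is needed to exclude fixed jump times.

  A Feller process with this uniformity is a Hunt process. Approximating stopping times from above by
  dyadic ones gives the strong Markov property, and also a bound on the mean of \<open>min 1 (dist X\<^sub>T X\<^bsub>T+h\<^esub>)\<close>
  that is uniform over stopping times \<open>T\<close>. Applied to \<open>T\<^sub>n\<close> increasing to \<open>T\<close>, Fatou's lemma shows that \<open>X\<close>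
  does not jump at \<open>T\<close>. Strict monotonicity of \<open>\<sigma>\<close> enters only through \<open>\<phi>(\<lambda>) \<longlonglongrightarrow> \<infinity>\<close>.\<close>

text \<open>The obstacle is that L_s is a stopping time only for the right limits of the path
  filtration: the event L_s < q is decided by the path before q, the event L_s \<le> q is not.
  Random times are therefore accessed through the strict events \<open>T < q\<close> and rounded to
  dyadic times strictly above them; right-continuity then carries an identity from fixed times to
  random times. This mechanism serves twice: for the increments of drift and subordinator after L_s,
  and for X at stopping times of its own filtration. The second use needs right-continuity of the
  semigroup along paths, so the Feller property has to be available before the strong Markov
  property.

  The hypothesis on \<open>P\<close> consists of single conditional expectations of
  \<open>C_0\<close> functions and says nothing about measurability in the starting point. It is
  first converted into independence and stationarity of the increments. These determine the law of a
  path, so that \<open>P z\<close> is the image of \<open>P 0\<close> under translation by z;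
  measurability in z, the Markov property and the dependence on the starting point are all read off
  from this one law.\<close>

section \<open>Discretisation of random times\<close>

text \<open>Bump functions are Lipschitz and also lie in \<^const>\<open>C_0\<close>, where the semigroup is assumed to act.\<close>

definition bump :: "('a::euclidean_space \<Rightarrow> real) set" where
  "bump = {f. range f \<subseteq> {0..1} \<and> (\<exists>K. K-lipschitz_on UNIV f) \<and> (f \<longlongrightarrow> 0) at_infinity}"

lemma bump_bounds: "f \<in> bump \<Longrightarrow> 0 \<le> f x" "f \<in> bump \<Longrightarrow> f x \<le> 1"
  by (force simp: bump_def)+

lemma bump_continuous: "f \<in> bump \<Longrightarrow> continuous_on UNIV f"
  by (auto simp: bump_def intro: lipschitz_on_continuous_on)

lemma bump_measurable: "f \<in> bump \<Longrightarrow> f \<in> borel_measurable borel"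
  by (intro borel_measurable_continuous_onI bump_continuous)

lemma bump_C_0: "bump \<subseteq> C_0"
  by (auto simp: C_0_def bump_continuous) (auto simp: bump_def)

text \<open>Truncated multiples of the distance to a closed set are Lipschitz, and since a box is
  bounded they vanish near infinity. They increase to the indicator of the box, which makes them
  test functions for measures.\<close>

lemma infdist_box_bump:
  fixes a b :: "'a::euclidean_space"
  shows "(\<lambda>x. min 1 (real n * infdist x (- box a b))) \<in> bump"
proof -
  let ?f = "\<lambda>x. min 1 (real n * infdist x (- box a b))"
  have lip: "\<bar>?f x - ?f y\<bar> \<le> real n * dist x y" for x y
  proof -
    have "\<bar>?f x - ?f y\<bar> \<le> \<bar>real n * infdist x (- box a b) - real n * infdist y (- box a b)\<bar>"
      by linarith
    also have "\<dots> = real n * \<bar>infdist x (- box a b) - infdist y (- box a b)\<bar>"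
      by (simp add: abs_mult flip: right_diff_distrib)
    also have "\<dots> \<le> real n * dist x y"
      using infdist_triangle_abs by (intro mult_left_mono) auto
    finally show ?thesis .
  qed
  have "\<forall>\<^sub>F x in at_infinity. x \<notin> box a b"
    using bounded_box[of a b] unfolding bounded_iff eventually_at_infinity
    by (meson not_le gt_ex order_less_le_trans)
  then have "\<forall>\<^sub>F x in at_infinity. ?f x = 0"
    by eventually_elim simp
  then have "(?f \<longlongrightarrow> 0) at_infinity"
    by (rule tendsto_eventually)
  moreover have "(real n)-lipschitz_on UNIV ?f"
    using lip by (intro lipschitz_onI) (auto simp: dist_real_def)
  ultimately show ?thesis
    by (auto simp: bump_def infdist_nonneg)
qed

lemma indicator_box_SUP:
  fixes a b x :: "'a::euclidean_space"
  shows "indicator (box a b) x = (SUP n. ennreal (min 1 (real n * infdist x (- box a b))))"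
proof (cases "x \<in> box a b")
  case True
  \<comment> \<open>\<open>infdist\<close> to the empty set is 0 by convention, so positivity needs
    a nonempty complement; boundedness of the box supplies it.\<close>
  have "- box a b \<noteq> {}"
  proof
    assume "- box a b = {}"
    then have "box a b = UNIV"
      by blast
    then show False
      using bounded_box[of a b] not_bounded_UNIV by simp
  qed
  then have "0 < infdist x (- box a b)"
    using True by (intro infdist_pos_not_in_closed) (auto simp: closed_Compl open_box)
  then obtain n where "1 < real n * infdist x (- box a b)"
    using reals_Archimedean3 by blast
  then have "ennreal 1 = ennreal (min 1 (real n * infdist x (- box a b)))"
    by simp
  then have "1 \<le> (SUP n. ennreal (min 1 (real n * infdist x (- box a b))))"
    by (intro SUP_upper2[of n]) auto
  moreover have "(SUP n. ennreal (min 1 (real n * infdist x (- box a b)))) \<le> 1"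
    by (intro SUP_least) (simp add: ennreal_le_1)
  ultimately have "(SUP n. ennreal (min 1 (real n * infdist x (- box a b)))) = 1"
    by (intro antisym)
  then show ?thesis
    using True by (simp only: indicator_simps)
next
  case False
  then show ?thesis
    by simp
qed

text \<open>Boxes are an intersection-stable generator of the Borel sets, and monotone convergence
  recovers the measure of a box from integrals of bumps.\<close>

lemma measure_eqI_bump:
  fixes M N :: "'a::euclidean_space measure"
  assumes M: "finite_measure M" "sets M = sets borel" and N: "sets N = sets borel"
    and eq: "\<And>f. f \<in> bump \<Longrightarrow> (\<integral>\<^sup>+x. f x \<partial>M) = (\<integral>\<^sup>+x. f x \<partial>N)"
  shows "M = N"
proof (rule measure_eqI_generator_eq[where A="\<lambda>n. box (- (real n *\<^sub>R One)) (real n *\<^sub>R One)"])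
  let ?E = "range (\<lambda>(a, b). box a b :: 'a set)"
  show "Int_stable ?E"
    unfolding Int_stable_def
  proof (intro ballI)
    fix X Y assume "X \<in> ?E" "Y \<in> ?E"
    then obtain a b c d where "X = box a b" "Y = box c d"
      by auto
    then have "\<exists>e f. X \<inter> Y = box e f"
      by (simp only: box_Int_box) (intro exI, rule refl)
    then obtain e f where "X \<inter> Y = box e f"
      by blast
    then show "X \<inter> Y \<in> ?E"
      using rangeI[of "\<lambda>(a, b). box a b :: 'a set" "(e, f)"] by simp
  qed
  show "sets M = sigma_sets UNIV ?E" "sets N = sigma_sets UNIV ?E"
    using M(2) N by (simp_all add: borel_eq_box)
  show "(\<Union>n. box (- (real n *\<^sub>R One)) (real n *\<^sub>R One)) = (UNIV :: 'a set)"
    by (rule UN_box_eq_UNIV)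
  show "emeasure M (box (- (real n *\<^sub>R One)) (real n *\<^sub>R One)) \<noteq> \<infinity>" for n
    using finite_measure.emeasure_finite[OF M(1)] by simp
  fix X assume "X \<in> ?E"
  then obtain a b where X: "X = box a b"
    by auto
  have box: "emeasure L (box a b) =
      (SUP n. \<integral>\<^sup>+x. ennreal (min 1 (real n * infdist x (- box a b))) \<partial>L)"
    if L: "sets L = sets borel" for L :: "'a measure"
  proof -
    have "emeasure L (box a b) = (\<integral>\<^sup>+x. indicator (box a b) x \<partial>L)"
      using L by simp
    also have "\<dots> = (SUP n. \<integral>\<^sup>+x. ennreal (min 1 (real n * infdist x (- box a b))) \<partial>L)"
      unfolding indicator_box_SUP
    proof (rule nn_integral_monotone_convergence_SUP)
      show "incseq (\<lambda>n x. ennreal (min 1 (real n * infdist x (- box a b))))"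
        by (intro incseq_SucI le_funI ennreal_leI min.mono mult_right_mono) (auto simp: infdist_nonneg)
      have "(\<lambda>x. min 1 (real n * infdist x (- box a b))) \<in> borel_measurable L" for n
        using bump_measurable[OF infdist_box_bump[of n a b]] L
        by (simp cong: measurable_cong_sets)
      then show "(\<lambda>x. ennreal (min 1 (real n * infdist x (- box a b)))) \<in> borel_measurable L" for n
        by (rule measurable_compose) simp
    qed
    finally show ?thesis .
  qed
  show "emeasure M X = emeasure N X"
    unfolding X box[OF M(2)] box[OF N] using eq[OF infdist_box_bump] by simp
qed auto

section \<open>Approximation of random times from above\<close>

definition dyadic_index :: "nat \<Rightarrow> real \<Rightarrow> nat" where
  "dyadic_index n t = nat \<lfloor>2 ^ n * t\<rfloor>"

text \<open>The successor index makes the rounded time lie strictly above t, even for dyadic t, so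
  that only limits along \<open>at_right\<close> are involved.\<close>

definition dyadic_above :: "nat \<Rightarrow> real \<Rightarrow> real" where
  "dyadic_above n t = real (Suc (dyadic_index n t)) / 2 ^ n"

lemma dyadic_index_eq_iff:
  "0 \<le> t \<Longrightarrow> dyadic_index n t = k \<longleftrightarrow> real k / 2 ^ n \<le> t \<and> t < real (Suc k) / 2 ^ n"
  unfolding dyadic_index_def
  by (subst nat_eq_iff) (auto simp: floor_eq_iff field_simps)

lemma dyadic_above_bounds:
  assumes "0 \<le> t"
  shows "t < dyadic_above n t" "dyadic_above n t \<le> t + 1 / 2 ^ n"
  using dyadic_index_eq_iff[OF assms, of n "dyadic_index n t"]
  by (auto simp: dyadic_above_def field_simps)

lemma dyadic_above_at_right:
  assumes "0 \<le> t"
  shows "filterlim (\<lambda>n. dyadic_above n t) (at_right t) sequentially"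
proof -
  have "(\<lambda>n. dyadic_above n t) \<longlonglongrightarrow> t"
  proof (rule tendsto_sandwich[of "\<lambda>_. t" _ _ "\<lambda>n. t + 1 / 2 ^ n"])
    show "(\<lambda>n. t + 1 / 2 ^ n) \<longlonglongrightarrow> t"
      using tendsto_add[OF tendsto_const[of t] LIMSEQ_divide_realpow_zero[of 2 1]] by simp
    show "\<forall>\<^sub>F n in sequentially. t \<le> dyadic_above n t"
      "\<forall>\<^sub>F n in sequentially. dyadic_above n t \<le> t + 1 / 2 ^ n"
      using dyadic_above_bounds[OF assms] by (auto intro!: always_eventually less_imp_le)
  qed simp
  moreover have "dyadic_above n t \<in> {t<..} \<and> dyadic_above n t \<noteq> t" for n
    using dyadic_above_bounds(1)[OF assms, of n] by simp
  ultimately show ?thesis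
    by (simp add: filterlim_at)
qed

lemma measurable_dyadic_index:
  assumes "\<tau> \<in> borel_measurable M"
  shows "(\<lambda>w. dyadic_index n (\<tau> w)) \<in> measurable M (count_space UNIV)"
  unfolding dyadic_index_def using assms by measurable

lemma sets_finite_time:
  fixes T :: "'w \<Rightarrow> ennreal"
  assumes "T \<in> borel_measurable M" "A \<in> sets M"
  shows "{w\<in>A. T w < \<top>} \<in> sets M"
proof -
  have "{w\<in>A. T w < \<top>} = A \<inter> (T -` {..<\<top>} \<inter> space M)"
    using sets.sets_into_space[OF assms(2)] by auto
  then show ?thesis
    using assms(2) measurable_sets[OF assms(1), of "{..<\<top>}"] by auto
qed

text \<open>On each level set of the dyadic index the process is evaluated at one fixed time;
  right-continuity passes to the limit.\<close>

lemma measurable_random_time: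
  fixes Y :: "real \<Rightarrow> 'w \<Rightarrow> 'a::metric_space"
  assumes Y: "\<And>t. 0 \<le> t \<Longrightarrow> Y t \<in> borel_measurable M"
    and rc: "\<And>w t. w \<in> space M \<Longrightarrow> 0 \<le> t \<Longrightarrow> ((\<lambda>u. Y u w) \<longlongrightarrow> Y t w) (at_right t)"
    and \<tau>: "\<tau> \<in> borel_measurable M" "\<And>w. w \<in> space M \<Longrightarrow> 0 \<le> \<tau> w"
  shows "(\<lambda>w. Y (\<tau> w) w) \<in> borel_measurable M"
proof (rule borel_measurable_LIMSEQ_metric)
  show "(\<lambda>w. Y (dyadic_above n (\<tau> w)) w) \<in> borel_measurable M" for n
    unfolding dyadic_above_def
    by (rule measurable_compose_countable[OF _ measurable_dyadic_index[OF \<tau>(1)]]) (auto intro!: Y)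
  show "(\<lambda>n. Y (dyadic_above n (\<tau> w)) w) \<longlonglongrightarrow> Y (\<tau> w) w" if "w \<in> space M" for w
    using filterlim_compose[OF rc dyadic_above_at_right] \<tau>(2) that by blast
qed

text \<open>\<open>B n k\<close> is the part of \<open>A\<close> on which \<open>T\<close> lies in
  the k-th dyadic interval of length 1/2^n, written with strict events only. On it \<open>T\<close>
  is replaced by the right endpoint, and the bound by 1 allows dominated convergence.\<close>

lemma nn_integral_random_time_limit:
  fixes G :: "real \<Rightarrow> 'w \<Rightarrow> ennreal" and T :: "'w \<Rightarrow> ennreal"
  assumes N: "finite_measure N"
    and A: "A \<subseteq> space N" "\<And>q. 0 < q \<Longrightarrow> {w\<in>A. T w < ennreal q} \<in> sets N"
    and G: "\<And>q. 0 \<le> q \<Longrightarrow> G q \<in> borel_measurable N"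
      "\<And>q w. 0 \<le> q \<Longrightarrow> w \<in> space N \<Longrightarrow> G q w \<le> 1"
      "\<And>q w. 0 \<le> q \<Longrightarrow> w \<in> space N \<Longrightarrow> ((\<lambda>u. G u w) \<longlongrightarrow> G q w) (at_right q)"
  defines "B \<equiv> \<lambda>n k. {w\<in>A. T w < ennreal (real (Suc k) / 2 ^ n)} - {w\<in>A. T w < ennreal (real k / 2 ^ n)}"
  shows "(\<lambda>n. \<Sum>k. \<integral>\<^sup>+w\<in>B n k. G (real (Suc k) / 2 ^ n) w \<partial>N)
    \<longlonglongrightarrow> (\<integral>\<^sup>+w\<in>{w\<in>A. T w < \<top>}. G (enn2real (T w)) w \<partial>N)"
proof -
  define S where "S = {w\<in>A. T w < \<top>}"
  define u where "u n w = (\<Sum>k. G (real (Suc k) / 2 ^ n) w * indicator (B n k) w)" for n w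
  \<comment> \<open>For k = 0 the subtracted event is \<open>T w < 0\<close>, which is empty; the
    hypothesis on \<open>A\<close> speaks of positive q only.\<close>
  have B: "B n k \<in> sets N" for n k
    using A(2)[of "real k / 2 ^ n"] A(2)[of "real (Suc k) / 2 ^ n"]
    by (cases "k = 0") (auto simp: B_def)
  have mem: "w \<in> B n k \<longleftrightarrow> w \<in> S \<and> dyadic_index n (enn2real (T w)) = k" for n k w
  proof (cases "T w")
    case (real t)
    then show ?thesis
      by (auto simp: B_def S_def dyadic_index_eq_iff ennreal_less_iff)
  qed (auto simp: B_def S_def)
  have u_eq: "u n w = G (dyadic_above n (enn2real (T w))) w * indicator S w" for n w
  proof (cases "w \<in> S")
    case True
    have "disjoint_family (B n)"
      by (auto simp: disjoint_family_on_def mem)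
    moreover have "w \<in> B n (dyadic_index n (enn2real (T w)))"
      using True by (simp add: mem)
    ultimately show ?thesis
      using True suminf_cmult_indicator[of "B n" w _ "\<lambda>k. G (real (Suc k) / 2 ^ n) w"]
      by (simp add: u_def dyadic_above_def)
  next
    case False
    then show ?thesis
      by (simp add: u_def mem)
  qed
  have u_meas: "u n \<in> borel_measurable N" for n
    unfolding u_def using B G(1) by (auto intro!: borel_measurable_suminf_order)
  have lim: "(\<lambda>n. u n w) \<longlonglongrightarrow> G (enn2real (T w)) w * indicator S w" if "w \<in> space N" for w
  proof (cases "w \<in> S")
    case True
    then show ?thesis
      using filterlim_compose[OF G(3) dyadic_above_at_right] that by (simp add: u_eq)
  qed (simp add: u_eq)
  have "(\<lambda>n. \<integral>\<^sup>+w. u n w \<partial>N) \<longlonglongrightarrow> (\<integral>\<^sup>+w. G (enn2real (T w)) w * indicator S w \<partial>N)"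
  proof (rule nn_integral_dominated_convergence[where w="\<lambda>_. 1"])
    show "(\<lambda>w. G (enn2real (T w)) w * indicator S w) \<in> borel_measurable N"
      by (rule borel_measurable_LIMSEQ_order[OF lim u_meas])
    show "AE w in N. u n w \<le> 1" for n
      using G(2) by (auto simp: u_eq dyadic_above_def split: split_indicator)
    show "(\<integral>\<^sup>+w. 1 \<partial>N) < \<infinity>"
      using finite_measure.emeasure_finite[OF N] by (simp add: top.not_eq_extremum)
  qed (use u_meas lim in auto)
  moreover have "(\<integral>\<^sup>+w. u n w \<partial>N) = (\<Sum>k. \<integral>\<^sup>+w\<in>B n k. G (real (Suc k) / 2 ^ n) w \<partial>N)" for n
    unfolding u_def using B G(1) by (intro nn_integral_suminf) auto
  ultimately show ?thesis
    by (simp add: S_def)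
qed

text \<open>An inequality rather than an equation, so that \<open>H\<close> may be a constant bound.\<close>

lemma nn_integral_random_time_mono:
  fixes G H :: "real \<Rightarrow> 'w \<Rightarrow> ennreal" and T :: "'w \<Rightarrow> ennreal" and F :: "real \<Rightarrow> 'w set set"
  assumes N: "finite_measure N"
    and F: "\<And>q. 0 < q \<Longrightarrow> sigma_algebra (space N) (F q)" "\<And>q. 0 < q \<Longrightarrow> F q \<subseteq> sets N"
      "\<And>q r. 0 < q \<Longrightarrow> q \<le> r \<Longrightarrow> F q \<subseteq> F r"
    and A: "A \<subseteq> space N" "\<And>q. 0 < q \<Longrightarrow> {w\<in>A. T w < ennreal q} \<in> F q"
    and G: "\<And>q. 0 \<le> q \<Longrightarrow> G q \<in> borel_measurable N"
      "\<And>q w. 0 \<le> q \<Longrightarrow> w \<in> space N \<Longrightarrow> G q w \<le> 1"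
      "\<And>q w. 0 \<le> q \<Longrightarrow> w \<in> space N \<Longrightarrow> ((\<lambda>u. G u w) \<longlongrightarrow> G q w) (at_right q)"
    and H: "\<And>q. 0 \<le> q \<Longrightarrow> H q \<in> borel_measurable N"
      "\<And>q w. 0 \<le> q \<Longrightarrow> w \<in> space N \<Longrightarrow> H q w \<le> 1"
      "\<And>q w. 0 \<le> q \<Longrightarrow> w \<in> space N \<Longrightarrow> ((\<lambda>u. H u w) \<longlongrightarrow> H q w) (at_right q)"
    and le: "\<And>q B. 0 < q \<Longrightarrow> B \<in> F q \<Longrightarrow> (\<integral>\<^sup>+w\<in>B. G q w \<partial>N) \<le> (\<integral>\<^sup>+w\<in>B. H q w \<partial>N)"
  shows "(\<integral>\<^sup>+w\<in>{w\<in>A. T w < \<top>}. G (enn2real (T w)) w \<partial>N) \<le>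
    (\<integral>\<^sup>+w\<in>{w\<in>A. T w < \<top>}. H (enn2real (T w)) w \<partial>N)"
proof -
  have A': "{w\<in>A. T w < ennreal q} \<in> sets N" if "0 < q" for q
    using A(2) F(2) that by blast
  let ?B = "\<lambda>n k. {w\<in>A. T w < ennreal (real (Suc k) / 2 ^ n)} - {w\<in>A. T w < ennreal (real k / 2 ^ n)}"
  \<comment> \<open>Each piece belongs to the past of its right endpoint, the very time at which G
    and H are evaluated on it.\<close>
  have B: "?B n k \<in> F (real (Suc k) / 2 ^ n)" for n k
  proof -
    interpret sigma_algebra "space N" "F (real (Suc k) / 2 ^ n)"
      by (rule F) simp
    have "{w\<in>A. T w < ennreal (real k / 2 ^ n)} \<in> F (real (Suc k) / 2 ^ n)"
    proof (cases "k = 0")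
      case False
      then show ?thesis
        using A(2)[of "real k / 2 ^ n"] F(3)[of "real k / 2 ^ n" "real (Suc k) / 2 ^ n"]
        by (auto simp: field_simps)
    qed (use empty_sets in simp)
    then show ?thesis
      using A(2) by (intro Diff) auto
  qed
  have "(\<Sum>k. \<integral>\<^sup>+w\<in>?B n k. G (real (Suc k) / 2 ^ n) w \<partial>N)
      \<le> (\<Sum>k. \<integral>\<^sup>+w\<in>?B n k. H (real (Suc k) / 2 ^ n) w \<partial>N)" for n
    by (intro suminf_le le B) auto
  then show ?thesis
    using LIMSEQ_le[OF nn_integral_random_time_limit[OF N A(1) A' G] nn_integral_random_time_limit[OF N A(1) A' H]]
    by blast
qed

lemma set_nn_integral_eq_density:
  assumes "A \<in> sets N" "f \<in> borel_measurable N"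
  shows "(\<integral>\<^sup>+x. f x \<partial>density N (indicator A)) = (\<integral>\<^sup>+x\<in>A. f x \<partial>N)"
  using assms by (subst nn_integral_density) (auto simp: mult.commute)

lemma finite_measure_density_indicator:
  assumes "finite_measure N" "A \<in> sets N"
  shows "finite_measure (density N (indicator A))"
proof (rule finite_measureI)
  interpret finite_measure N by fact
  show "emeasure (density N (indicator A)) (space (density N (indicator A))) \<noteq> \<infinity>"
    using assms(2) by (simp add: emeasure_restricted)
qed

section \<open>Feller processes that are Hunt processes\<close>

lemma cadlag_incseq_convergent:
  assumes f: "cadlag E f" and a: "incseq a" "\<And>n. 0 \<le> a n" "a \<longlonglongrightarrow> L"
  obtains z where "(\<lambda>n. f (a n)) \<longlonglongrightarrow> z"
proof (cases "\<exists>N. a N = L")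
  case True
  then obtain N where N: "a N = L" ..
  have "a n = L" if "N \<le> n" for n
    using incseqD[OF a(1) that] incseq_le[OF a(1,3), of n] N by simp
  then have "\<forall>\<^sub>F n in sequentially. f (a n) = f L"
    unfolding eventually_sequentially by (intro exI[of _ N]) simp
  then have "(\<lambda>n. f (a n)) \<longlonglongrightarrow> f L"
    by (rule tendsto_eventually)
  then show ?thesis
    by (rule that)
next
  case False
  then have lt: "a n < L" for n
    using incseq_le[OF a(1,3), of n] by (simp add: less_le)
  then have "filterlim a (at_left L) sequentially"
    using a(3) by (auto simp: filterlim_at less_imp_neq)
  moreover have "0 < L"
    using lt[of 0] a(2)[of 0] by simp
  then obtain z where "(f \<longlongrightarrow> z) (at_left L)"
    using f unfolding cadlag_def by blast
  ultimately have "(\<lambda>n. f (a n)) \<longlonglongrightarrow> z"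
    using filterlim_compose by blast
  then show ?thesis
    by (rule that)
qed

text \<open>Letting n grow before j places \<open>a n + h j\<close> just to the right of L while
  \<open>a n\<close> approaches L from below. A jump at L would then keep the iterated limit
  inferior away from 0.\<close>

lemma cadlag_no_jump:
  fixes f :: "real \<Rightarrow> 'a::metric_space"
  assumes f: "cadlag E f" and a: "incseq a" "\<And>n. 0 \<le> a n" "a \<longlonglongrightarrow> L"
    and h: "\<And>j. 0 < h j" "h \<longlonglongrightarrow> 0"
    and zero: "liminf (\<lambda>j. liminf (\<lambda>n. ennreal (min 1 (dist (f (a n)) (f (a n + h j)))))) = 0"
  shows "(\<lambda>n. f (a n)) \<longlonglongrightarrow> f L"
proof -
  obtain z where z: "(\<lambda>n. f (a n)) \<longlonglongrightarrow> z"
    using cadlag_incseq_convergent[OF f a] .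
  have aL: "a n \<le> L" for n
    using incseq_le[OF a(1,3)] .
  have "0 \<le> L"
    using a(2)[of 0] aL[of 0] by simp
  have "z = f L"
  proof (rule ccontr)
    \<comment> \<open>Two of the three legs from z to \<open>f L\<close> will be shorter than e/4,
      so the middle one exceeds e/2; the cap at 1 lets this bound survive the truncation of the
      distance.\<close>
    define e where "e = min 1 (dist z (f L))"
    assume "z \<noteq> f L"
    then have e: "0 < e" "e \<le> 1" "e \<le> dist z (f L)"
      by (auto simp: e_def)
    have "(f \<longlongrightarrow> f L) (at_right L)"
      using f \<open>0 \<le> L\<close> by (auto simp: cadlag_def)
    then have "\<forall>\<^sub>F u in at_right L. dist (f u) (f L) < e / 4"
      using e by (intro tendstoD) auto
    then obtain b where b: "L < b" "\<And>u. L < u \<Longrightarrow> u < b \<Longrightarrow> dist (f u) (f L) < e / 4"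
      unfolding eventually_at_right_field by auto
    have "\<forall>\<^sub>F j in sequentially. h j < b - L"
      using h(2) b(1) by (intro order_tendstoD) auto
    then have "\<forall>\<^sub>F j in sequentially.
        ennreal (e / 2) \<le> liminf (\<lambda>n. ennreal (min 1 (dist (f (a n)) (f (a n + h j)))))"
    proof eventually_elim
      case (elim j)
      have "\<forall>\<^sub>F n in sequentially. L - h j < a n"
        using a(3) h(1)[of j] by (intro order_tendstoD) auto
      moreover have "\<forall>\<^sub>F n in sequentially. dist (f (a n)) z < e / 4"
        using z e by (intro tendstoD) auto
      ultimately have "\<forall>\<^sub>F n in sequentially.
          ennreal (e / 2) \<le> ennreal (min 1 (dist (f (a n)) (f (a n + h j))))"
      proof eventually_elim
        fix n assume n: "L - h j < a n" "dist (f (a n)) z < e / 4"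
        then have "dist (f (a n + h j)) (f L) < e / 4"
          using aL[of n] elim by (intro b(2)) auto
        moreover have "dist z (f L) \<le> dist (f (a n)) z + dist (f (a n)) (f (a n + h j)) + dist (f (a n + h j)) (f L)"
          using dist_triangle[of z "f L" "f (a n)"] dist_triangle[of "f (a n)" "f L" "f (a n + h j)"]
          by (simp add: dist_commute)
        ultimately show "ennreal (e / 2) \<le> ennreal (min 1 (dist (f (a n)) (f (a n + h j))))"
          using n e by (intro ennreal_leI) auto
      qed
      then show ?case
        by (rule Liminf_bounded)
    qed
    then have "ennreal (e / 2) \<le> 0"
      unfolding zero[symmetric] by (rule Liminf_bounded)
    then show False
      using e by simp
  qed
  then show ?thesis
    using z by simp
qed

section \<open>Natural filtrations and their right limits\<close>

lemma space_natural_filtration [simp]: "space (natural_filtration M S X t) = space M"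
  by (simp add: natural_filtration_def)

lemma measurable_natural_filtration:
  assumes X: "\<And>s. 0 \<le> s \<Longrightarrow> ennreal s \<le> t \<Longrightarrow> X s \<in> measurable M S" and s: "0 \<le> s" "ennreal s \<le> t"
  shows "X s \<in> measurable (natural_filtration M S X t) S"
proof -
  let ?I = "{s. 0 \<le> s \<and> ennreal s \<le> t}"
  have "(\<lambda>w. \<lambda>s\<in>?I. X s w) \<in> measurable (natural_filtration M S X t) (\<Pi>\<^sub>M s\<in>?I. S)"
    unfolding natural_filtration_def
    using measurable_space[OF X] by (intro measurable_vimage_algebra1) (auto simp: space_PiM)
  then have "(\<lambda>w. (\<lambda>s\<in>?I. X s w) s) \<in> measurable (natural_filtration M S X t) S"
    by (rule measurable_compose[OF _ measurable_component_singleton]) (use s in simp)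
  then show ?thesis
    using s by simp
qed

lemma sets_natural_filtration_subset:
  assumes X: "\<And>s. 0 \<le> s \<Longrightarrow> ennreal s \<le> t \<Longrightarrow> X s \<in> measurable N S" and N: "space N = space M"
  shows "sets (natural_filtration M S X t) \<subseteq> sets N"
  unfolding natural_filtration_def
  by (intro sets_image_in_sets N measurable_restrict X) auto

lemma natural_filtration_mono:
  assumes X: "\<And>s. 0 \<le> s \<Longrightarrow> X s \<in> measurable M S" and "t \<le> t'"
  shows "sets (natural_filtration M S X t) \<subseteq> sets (natural_filtration M S X t')"
  using assms by (intro sets_natural_filtration_subset measurable_natural_filtration) auto

text \<open>An intersection of sigma-algebras is already one, so \<open>sigma\<close> generates
  nothing new; the index \<top> keeps the intersection nonempty.\<close>

lemma sets_right_cont_filtration: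
  assumes "\<And>s. space (F s) = \<Omega>"
  shows "sets (right_cont_filtration \<Omega> F t) = (\<Inter>s\<in>{s. t < s} \<union> {\<top>}. sets (F s))"
proof -
  have "sigma_algebra \<Omega> (\<Inter>s\<in>{s. t < s} \<union> {\<top>}. sets (F s))"
    unfolding sigma_algebra_iff2
  proof (intro conjI ballI allI impI)
    show "(\<Inter>s\<in>{s. t < s} \<union> {\<top>}. sets (F s)) \<subseteq> Pow \<Omega>"
      using sets.space_closed[of "F \<top>"] assms by auto
    show "\<Omega> - A \<in> (\<Inter>s\<in>{s. t < s} \<union> {\<top>}. sets (F s))"
      if "A \<in> (\<Inter>s\<in>{s. t < s} \<union> {\<top>}. sets (F s))" for A
      using that sets.compl_sets[of A "F _"] unfolding assms by blast
    show "(\<Union>i. A i) \<in> (\<Inter>s\<in>{s. t < s} \<union> {\<top>}. sets (F s))"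
      if "range A \<subseteq> (\<Inter>s\<in>{s. t < s} \<union> {\<top>}. sets (F s))" for A :: "nat \<Rightarrow> _"
      using that by (intro INT_I sets.countable_UN) blast
  qed auto
  then show ?thesis
    unfolding right_cont_filtration_def by (rule sigma_algebra.sets_measure_of_eq)
qed

text \<open>Right-continuity and membership in \<open>E\<close> are required of every path and not
  just almost every one: the filtrations are not completed, so measurability arguments cannot
  discard null sets.\<close>

locale right_process =
  fixes E :: "'a::euclidean_space set" and M :: "'w measure" and P :: "'a \<Rightarrow> 'w measure"
    and X :: "real \<Rightarrow> 'w \<Rightarrow> 'a"
  assumes E_borel [measurable]: "E \<in> sets borel"
    and prob_space_P: "z \<in> E \<Longrightarrow> prob_space (P z)"
    and sets_P: "z \<in> E \<Longrightarrow> sets (P z) = sets M"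
    and measurable_X [measurable]: "0 \<le> t \<Longrightarrow> X t \<in> borel_measurable M"
    and X_in_E: "0 \<le> t \<Longrightarrow> w \<in> space M \<Longrightarrow> X t w \<in> E"
    and X_right_cont: "0 \<le> t \<Longrightarrow> w \<in> space M \<Longrightarrow> ((\<lambda>u. X u w) \<longlongrightarrow> X t w) (at_right t)"
begin

abbreviation S :: "'a measure" where "S \<equiv> restrict_space borel E"

abbreviation F :: "ennreal \<Rightarrow> 'w measure" where "F \<equiv> natural_filtration M S X"

abbreviation G :: "ennreal \<Rightarrow> 'w measure" where "G \<equiv> right_cont_filtration (space M) F"

definition kernel :: "real \<Rightarrow> 'a \<Rightarrow> 'a measure" where
  "kernel t z = distr (P z) S (X t)"

lemma space_P: "z \<in> E \<Longrightarrow> space (P z) = space M"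
  by (rule sets_eq_imp_space_eq[OF sets_P])

lemma finite_measure_P: "z \<in> E \<Longrightarrow> finite_measure (P z)"
  using prob_space_P by (rule prob_space.axioms)

lemma measurable_P: "z \<in> E \<Longrightarrow> measurable (P z) N = measurable M N"
  by (intro measurable_cong_sets sets_P refl)

lemma measurable_X_S [measurable]: "0 \<le> t \<Longrightarrow> X t \<in> measurable M S"
  by (intro measurable_restrict_space2 measurable_X) (auto simp: X_in_E)

lemma measurable_X_F: "0 \<le> s \<Longrightarrow> ennreal s \<le> t \<Longrightarrow> X s \<in> measurable (F t) S"
  by (intro measurable_natural_filtration measurable_X_S)

lemma measurable_X_F_borel: "0 \<le> s \<Longrightarrow> ennreal s \<le> t \<Longrightarrow> X s \<in> borel_measurable (F t)"
  using measurable_X_F measurable_restrict_space2_iff by blast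

lemma sets_F_subset: "sets (F t) \<subseteq> sets M"
  by (intro sets_natural_filtration_subset measurable_X_S) auto

lemma sets_F_mono: "t \<le> t' \<Longrightarrow> sets (F t) \<subseteq> sets (F t')"
  by (intro natural_filtration_mono measurable_X_S)

lemma sets_G: "sets (G t) = (\<Inter>s\<in>{s. t < s} \<union> {\<top>}. sets (F s))"
  by (rule sets_right_cont_filtration) simp

lemma space_G [simp]: "space (G t) = space M"
  by (simp add: right_cont_filtration_def space_measure_of_conv)

sublocale filtration "space M" G
  by unfold_locales (auto simp: sets_G)

lemma sets_G_subset: "sets (G t) \<subseteq> sets M"
  using sets_F_subset[of \<top>] by (auto simp: sets_G)

lemma sets_pre_sigma_subset:
  assumes "stopping_time G T"
  shows "sets (pre_sigma T) \<subseteq> sets M"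
  using sets_pre_sigmaD[OF assms, of _ \<top>] sets_G_subset by auto

lemma subalgebra_pre_sigma:
  assumes "stopping_time G T" "z \<in> E"
  shows "subalgebra (P z) (pre_sigma T)"
  using sets_pre_sigma_subset[OF assms(1)] assms(2)
  by (simp add: subalgebra_def space_pre_sigma space_P sets_P)

lemma measurable_stopping_time_M:
  assumes "stopping_time G T"
  shows "T \<in> borel_measurable M"
  using assms sets_G_subset by (rule measurable_stopping_time) simp

text \<open>Each event \<open>T w \<le> r\<close> with r < q lies in \<open>G r\<close>, hence in
  \<open>F q\<close>, and the strict event is a countable union of such events. Stopping times of
  the right-continuous filtration are thus accessible through the plain natural filtration.\<close>

lemma sets_before_stopping_time:
  assumes T: "stopping_time G T" and A: "A \<in> sets (pre_sigma T)" and q: "0 < q"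
  shows "{w\<in>A. T w < ennreal q} \<in> sets (F (ennreal q))"
proof -
  \<comment> \<open>Nonnegative levels strictly below q that increase to q.\<close>
  define r where "r n = ennreal (q - q / (real n + 2))" for n
  have lt: "r n < ennreal q" for n
    using q by (auto simp: r_def intro!: ennreal_lessI)
  have ex: "\<exists>n. x \<le> r n" if "x < ennreal q" for x
  proof -
    obtain y where y: "x = ennreal y" "0 \<le> y" "y < q"
      using \<open>x < ennreal q\<close> by (cases x) (auto simp: ennreal_less_iff)
    obtain n where "q < (q - y) * real n"
      using reals_Archimedean3[of "q - y"] y by (auto simp: mult.commute)
    then have "q < (q - y) * (real n + 2)"
      using y by (auto simp: field_simps)
    then have "y \<le> q - q / (real n + 2)"
      by (simp add: field_simps)
    then show ?thesis
      unfolding r_def y(1) by (intro exI[of _ n] ennreal_leI)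
  qed
  have "{w\<in>A. T w < ennreal q} = (\<Union>n. {w\<in>A. T w \<le> r n})"
    using lt ex by (auto intro: le_less_trans)
  moreover have "{w\<in>A. T w \<le> r n} \<in> sets (F (ennreal q))" for n
    using sets_pre_sigmaD[OF T A, of "r n"] lt[of n] by (auto simp: sets_G)
  ultimately show ?thesis
    by auto
qed

abbreviation at_time :: "('w \<Rightarrow> ennreal) \<Rightarrow> 'w \<Rightarrow> 'a" where
  "at_time T w \<equiv> X (enn2real (T w)) w"

lemma X_shift_right_cont:
  assumes "0 \<le> q" "0 \<le> t" "w \<in> space M"
  shows "((\<lambda>u. X (u + t) w) \<longlongrightarrow> X (q + t) w) (at_right q)"
  using X_right_cont[of "q + t" w] assms
  unfolding filterlim_at_right_to_0[of _ _ "q + t"] filterlim_at_right_to_0[of _ _ q]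
  by (simp add: add.assoc)

lemma measurable_at_time_plus:
  assumes T: "T \<in> borel_measurable M" and t: "0 \<le> t"
  shows "(\<lambda>w. X (enn2real (T w) + t) w) \<in> borel_measurable M"
proof (rule measurable_random_time[where Y="\<lambda>u. X (u + t)" and \<tau>="\<lambda>w. enn2real (T w)"])
  show "((\<lambda>u. X (u + t) w) \<longlongrightarrow> X (q + t) w) (at_right q)" if "w \<in> space M" "0 \<le> q" for w q
    using that t by (intro X_shift_right_cont)
qed (use T t in auto)

text \<open>Membership in \<open>G t\<close> means membership in \<open>F s\<close> for each
  admissible s. For fixed s the time is capped at t and \<open>measurable_random_time\<close> is
  applied inside \<open>F s\<close>; its dyadic approximations overshoot, which is harmless once the
  process is frozen at s.\<close>

lemma measurable_at_time_pre_sigma: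
  assumes T: "stopping_time G T" and B: "B \<in> sets borel"
  shows "{w\<in>space M. T w < \<top> \<and> at_time T w \<in> B} \<in> sets (pre_sigma T)"
proof (rule sets_pre_sigmaI[OF T])
  fix t
  show "{w\<in>{w\<in>space M. T w < \<top> \<and> at_time T w \<in> B}. T w \<le> t} \<in> sets (G t)"
    unfolding sets_G
  proof (rule INT_I)
    fix s assume s: "s \<in> {s. t < s} \<union> {\<top>}"
    \<comment> \<open>Freezing \<open>X\<close> at time \<open>s\<close> makes it adapted to \<open>F s\<close> without changing its value at times up to \<open>t\<close>.\<close>
    define Y where "Y u = X (if s = \<top> then u else min u (enn2real s))" for u
    have T_le: "{w\<in>space M. T w \<le> c} \<in> sets (F s)" if "c \<le> t" for c
    proof -
      have "{w\<in>space M. T w \<le> c} \<in> sets (G c)"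
        using stopping_timeD[OF T, of c] by (simp add: pred_def)
      then show ?thesis
        using that s by (auto simp: sets_G)
    qed
    have min_meas: "(\<lambda>w. min (T w) t) \<in> borel_measurable (F s)"
    proof (rule borel_measurableI_le)
      fix c show "{w\<in>space (F s). min (T w) t \<le> c} \<in> sets (F s)"
        using T_le[of c] sets.top[of "F s"] by (cases "t \<le> c") (auto simp: min_le_iff_disj)
    qed
    have "(\<lambda>w. Y (enn2real (min (T w) t)) w) \<in> borel_measurable (F s)"
    proof (rule measurable_random_time[where Y=Y and \<tau>="\<lambda>w. enn2real (min (T w) t)"])
      show "Y u \<in> borel_measurable (F s)" if "0 \<le> u" for u
      proof (cases "s = \<top>")
        case False
        then have "ennreal (min u (enn2real s)) \<le> s"
          using ennreal_leI[of "min u (enn2real s)" "enn2real s"] by (simp add: less_top)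
        then show ?thesis
          using False that by (auto simp: Y_def intro!: measurable_X_F_borel)
      qed (use that in \<open>auto simp: Y_def intro!: measurable_X_F_borel\<close>)
      show "((\<lambda>u. Y u w) \<longlongrightarrow> Y r w) (at_right r)" if "w \<in> space (F s)" "0 \<le> r" for w r
      proof -
        consider "s = \<top>" | "s \<noteq> \<top>" "r < enn2real s" | "s \<noteq> \<top>" "enn2real s \<le> r"
          by linarith
        then show ?thesis
        proof cases
          case 1
          then show ?thesis
            using that X_right_cont by (simp add: Y_def)
        next
          case 2
          then have "\<forall>\<^sub>F u in at_right r. Y u w = X u w"
            unfolding eventually_at_right_field by (intro exI[of _ "enn2real s"]) (auto simp: Y_def min_def)
          moreover have "Y r w = X r w"
            using 2 by (simp add: Y_def)
          ultimately show ?thesis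
            using that X_right_cont[of r w] by (simp add: tendsto_cong)
        next
          case 3
          have "\<forall>\<^sub>F u in at_right r. Y u w = Y r w"
            unfolding eventually_at_right_field using 3 by (intro exI[of _ "r + 1"]) (auto simp: Y_def min_def)
          then show ?thesis
            by (rule tendsto_eventually)
        qed
      qed
    qed (use min_meas in auto)
    from measurable_sets[OF this B]
    have "{w\<in>space M. T w \<le> t} \<inter> {w\<in>space M. min (T w) t < \<top>} \<inter>
        {w\<in>space M. Y (enn2real (min (T w) t)) w \<in> B} \<in> sets (F s)"
      using T_le[of t] measurable_sets[OF min_meas, of "{..<\<top>}"]
      by (intro sets.Int) (simp_all add: vimage_def Int_def conj_commute)
    also have "{w\<in>space M. T w \<le> t} \<inter> {w\<in>space M. min (T w) t < \<top>} \<inter>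
        {w\<in>space M. Y (enn2real (min (T w) t)) w \<in> B} =
        {w\<in>{w\<in>space M. T w < \<top> \<and> at_time T w \<in> B}. T w \<le> t}"
    proof -
      have "Y (enn2real (min (T w) t)) w = at_time T w" if "T w \<le> t" "T w < \<top>" for w
      proof (cases "s = \<top>")
        case False
        then have "enn2real (T w) \<le> enn2real s"
          using s that by (intro enn2real_mono) (auto simp: less_top)
        then show ?thesis
          using False that by (simp add: Y_def min_absorb1)
      qed (use that in \<open>simp add: Y_def min_absorb1\<close>)
      then show ?thesis
        by (auto simp: min_absorb1)
    qed
    finally show "{w\<in>{w\<in>space M. T w < \<top> \<and> at_time T w \<in> B}. T w \<le> t} \<in> sets (F s)" .
  qed
qed

end

section \<open>Transition function and strong Markov property\<close>

lemma set_nn_integral_indicator_comp: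
  assumes "A \<in> sets N" "Y \<in> measurable N K" "B \<in> sets K"
  shows "(\<integral>\<^sup>+w\<in>A. indicator B (Y w) \<partial>N) = emeasure N (A \<inter> (Y -` B \<inter> space N))"
proof -
  have "A \<inter> (Y -` B \<inter> space N) \<in> sets N"
    using assms by (intro sets.Int measurable_sets)
  moreover have "(\<integral>\<^sup>+w\<in>A. indicator B (Y w) \<partial>N) = (\<integral>\<^sup>+w. indicator (A \<inter> (Y -` B \<inter> space N)) w \<partial>N)"
    by (intro nn_integral_cong) (auto split: split_indicator)
  ultimately show ?thesis
    by simp
qed

lemma nn_integral_indicator_comp:
  assumes "Y \<in> measurable N K" "B \<in> sets K"
  shows "(\<integral>\<^sup>+w. indicator B (Y w) \<partial>N) = emeasure N (Y -` B \<inter> space N)"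
  using nn_integral_distr[OF assms(1), of "indicator B"] assms by (simp add: emeasure_distr)

text \<open>The Markov property is stated for functions of both values because the distance between
  \<open>X s w\<close> and \<open>X (s + t) w\<close> has to be estimated. Uniformity of
  \<open>small_time\<close> in the starting point is needed because it will be applied at the random
  point \<open>X q w\<close>.\<close>

locale feller_process = right_process E M P X
  for E :: "'a::euclidean_space set" and M :: "'w measure" and P X +
  assumes kernel_measurable:
      "0 \<le> t \<Longrightarrow> B \<in> sets borel \<Longrightarrow> (\<lambda>z. emeasure (P z) (X t -` B \<inter> space M)) \<in> borel_measurable S"
    and X_start: "z \<in> E \<Longrightarrow> AE w in P z. X 0 w = z"
    and X_cadlag: "z \<in> E \<Longrightarrow> AE w in P z. cadlag E (\<lambda>t. X t w)"
    and markov: "z \<in> E \<Longrightarrow> 0 \<le> s \<Longrightarrow> 0 \<le> t \<Longrightarrow> A \<in> sets (F (ennreal s)) \<Longrightarrow> h \<in> borel_measurable borel \<Longrightarrow>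
      (\<integral>\<^sup>+w\<in>A. h (X s w, X (s + t) w) \<partial>P z) = (\<integral>\<^sup>+w\<in>A. (\<integral>\<^sup>+w'. h (X s w, X t w') \<partial>P (X s w)) \<partial>P z)"
    and feller: "f \<in> bump \<Longrightarrow> 0 \<le> t \<Longrightarrow> continuous_on E (\<lambda>z. \<integral>\<^sup>+w. f (X t w) \<partial>P z)"
    and small_time: "0 < e \<Longrightarrow> \<exists>d>0. \<forall>t\<in>{0..d}. \<forall>z\<in>E. (\<integral>\<^sup>+w. min 1 (dist z (X t w)) \<partial>P z) \<le> ennreal e"
begin

lemma emeasure_kernel:
  assumes "0 \<le> t" "z \<in> E" "B \<in> sets borel" "B \<subseteq> E"
  shows "emeasure (kernel t z) B = emeasure (P z) (X t -` B \<inter> space M)"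
  using assms
  by (simp add: kernel_def emeasure_distr measurable_P measurable_X_S space_P sets_restrict_space_iff)

lemma prob_space_kernel: "0 \<le> t \<Longrightarrow> z \<in> E \<Longrightarrow> prob_space (kernel t z)"
  unfolding kernel_def by (intro prob_space.prob_space_distr prob_space_P) (simp_all add: measurable_P measurable_X_S)

lemma sets_S_iff: "B \<in> sets S \<longleftrightarrow> B \<in> sets borel \<and> B \<subseteq> E"
  by (auto simp: sets_restrict_space_iff)

lemma kernel_prob_algebra:
  assumes t: "0 \<le> t"
  shows "kernel t \<in> measurable S (prob_algebra S)"
proof (intro measurable_prob_algebraI measurable_subprob_algebra)
  show "prob_space (kernel t z)" "subprob_space (kernel t z)" if "z \<in> space S" for z
    using that t prob_space_kernel by (auto simp: space_restrict_space intro: prob_space_imp_subprob_space)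
  show "sets (kernel t z) = sets S" for z
    by (simp add: kernel_def)
  fix B assume "B \<in> sets S"
  then show "(\<lambda>z. emeasure (kernel t z) B) \<in> borel_measurable S"
    using t kernel_measurable[OF t, of B]
    by (subst measurable_cong[OF emeasure_kernel[OF t]]) (auto simp: space_restrict_space sets_S_iff)
qed

lemma kernel_subprob_algebra: "0 \<le> t \<Longrightarrow> kernel t \<in> measurable S (subprob_algebra S)"
  by (rule measurable_prob_algebraD[OF kernel_prob_algebra])

lemma markov_snd:
  assumes "z \<in> E" "0 \<le> s" "0 \<le> t" "A \<in> sets (F (ennreal s))" "f \<in> borel_measurable borel"
  shows "(\<integral>\<^sup>+w\<in>A. f (X (s + t) w) \<partial>P z) = (\<integral>\<^sup>+w\<in>A. (\<integral>\<^sup>+w'. f (X t w') \<partial>P (X s w)) \<partial>P z)"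
proof -
  have "(\<lambda>p :: 'a \<times> 'a. f (snd p)) \<in> borel_measurable borel"
    by (intro measurable_compose[OF _ assms(5)] borel_measurable_continuous_onI continuous_intros)
  from markov[OF assms(1-4) this] show ?thesis
    by simp
qed

lemma markov_indicator:
  assumes "z \<in> E" "0 \<le> s" "0 \<le> t" "A \<in> sets (F (ennreal s))" "B \<in> sets borel"
  shows "emeasure (P z) (A \<inter> (X (s + t) -` B \<inter> space M))
    = (\<integral>\<^sup>+w\<in>A. emeasure (P (X s w)) (X t -` B \<inter> space M) \<partial>P z)"
proof -
  have A: "A \<in> sets M"
    using assms(4) sets_F_subset by blast
  have "emeasure (P z) (A \<inter> (X (s + t) -` B \<inter> space M)) = (\<integral>\<^sup>+w\<in>A. indicator B (X (s + t) w) \<partial>P z)"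
    using assms A by (subst set_nn_integral_indicator_comp[where K=borel]) (auto simp: sets_P space_P measurable_P)
  also have "\<dots> = (\<integral>\<^sup>+w\<in>A. (\<integral>\<^sup>+w'. indicator B (X t w') \<partial>P (X s w)) \<partial>P z)"
    using assms by (intro markov_snd) auto
  also have "\<dots> = (\<integral>\<^sup>+w\<in>A. emeasure (P (X s w)) (X t -` B \<inter> space M) \<partial>P z)"
  proof (intro nn_integral_cong arg_cong2[where f="(*)"] refl)
    fix w assume "w \<in> space (P z)"
    then have E: "X s w \<in> E"
      using assms X_in_E by (simp add: space_P)
    show "(\<integral>\<^sup>+w'. indicator B (X t w') \<partial>P (X s w)) = emeasure (P (X s w)) (X t -` B \<inter> space M)"
      using assms by (subst nn_integral_indicator_comp[where K=borel]) (auto simp: measurable_P[OF E] space_P[OF E])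
  qed
  finally show ?thesis .
qed

text \<open>Chapman-Kolmogorov is the Markov property on the sure event.\<close>

lemma transition_function_kernel: "transition_function E kernel"
  unfolding transition_function_def
proof (intro conjI allI impI ballI kernel_prob_algebra)
  fix z assume z: "z \<in> E"
  interpret prob_space "P z"
    using z by (rule prob_space_P)
  have "kernel 0 z = distr (P z) S (\<lambda>_. z)"
    unfolding kernel_def using X_start[OF z] z
    by (intro distr_cong_AE) (auto simp: measurable_P measurable_X_S space_restrict_space)
  also have "\<dots> = return S z"
    using z by (intro distr_const) (simp add: space_restrict_space)
  finally show "kernel 0 z = return S z" .
next
  fix s t :: real and z assume st: "0 \<le> s" "0 \<le> t" and z: "z \<in> E"
  show "kernel (s + t) z = kernel s z \<bind> kernel t"
  proof (rule measure_eqI)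
    have sets: "sets (kernel s z \<bind> kernel t) = sets S"
      using z by (intro sets_bind) (auto simp: kernel_def space_restrict_space)
    then show "sets (kernel (s + t) z) = sets (kernel s z \<bind> kernel t)"
      by (simp add: kernel_def)
    fix B assume "B \<in> sets (kernel (s + t) z)"
    then have B: "B \<in> sets S" "B \<in> sets borel" "B \<subseteq> E"
      by (auto simp: kernel_def sets_S_iff)
    have sub: "kernel t \<in> measurable (kernel s z) (subprob_algebra S)"
      using kernel_subprob_algebra[OF st(2)] by (simp add: kernel_def[of s])
    have "emeasure (kernel s z \<bind> kernel t) B = (\<integral>\<^sup>+y. emeasure (kernel t y) B \<partial>kernel s z)"
      using z by (intro emeasure_bind[OF _ sub B(1)]) (auto simp: kernel_def space_restrict_space)
    also have "\<dots> = (\<integral>\<^sup>+w. emeasure (kernel t (X s w)) B \<partial>P z)"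
      unfolding kernel_def[of s] using z st B(1) kernel_subprob_algebra[OF st(2)]
      by (intro nn_integral_distr) (auto simp: measurable_P intro: measurable_emeasure_kernel)
    also have "\<dots> = (\<integral>\<^sup>+w\<in>space M. emeasure (P (X s w)) (X t -` B \<inter> space M) \<partial>P z)"
      using z st B X_in_E by (intro nn_integral_cong) (simp add: space_P emeasure_kernel)
    also have "\<dots> = emeasure (P z) (space M \<inter> (X (s + t) -` B \<inter> space M))"
      using z st B sets.top[of "F (ennreal s)"] by (intro markov_indicator[symmetric]) auto
    also have "\<dots> = emeasure (kernel (s + t) z) B"
      using z st B by (simp add: emeasure_kernel Int_absorb1)
    finally show "emeasure (kernel (s + t) z) B = emeasure (kernel s z \<bind> kernel t) B"
      by simp
  qed
qed

lemma nn_integral_feller_le_1: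
  assumes "f \<in> bump" "z \<in> E"
  shows "(\<integral>\<^sup>+w. f (X t w) \<partial>P z) \<le> 1"
proof -
  interpret prob_space "P z"
    using assms(2) by (rule prob_space_P)
  have "(\<integral>\<^sup>+w. f (X t w) \<partial>P z) \<le> (\<integral>\<^sup>+w. 1 \<partial>P z)"
    using bump_bounds(2)[OF assms(1)] by (intro nn_integral_mono) (simp add: ennreal_le_1)
  then show ?thesis
    by (simp add: emeasure_space_1)
qed

lemma measurable_nn_integral_feller:
  assumes "f \<in> bump" "0 \<le> t"
  shows "(\<lambda>z. \<integral>\<^sup>+w. f (X t w) \<partial>P z) \<in> borel_measurable S"
  using feller[OF assms] by (rule borel_measurable_continuous_on_restrict)

lemma feller_X_right_cont:
  assumes "f \<in> bump" "0 \<le> t" "0 \<le> q" "w \<in> space M"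
  shows "((\<lambda>u. \<integral>\<^sup>+w'. f (X t w') \<partial>P (X u w)) \<longlongrightarrow> (\<integral>\<^sup>+w'. f (X t w') \<partial>P (X q w))) (at_right q)"
proof (rule continuous_on_tendsto_compose[OF feller[OF assms(1,2)] X_right_cont])
  show "\<forall>\<^sub>F u in at_right q. X u w \<in> E"
    unfolding eventually_at_right_field using assms by (intro exI[of _ "q + 1"]) (auto intro: X_in_E)
qed (use assms X_in_E in auto)

lemma bump_X_right_cont:
  assumes "f \<in> bump" "0 \<le> t" "0 \<le> q" "w \<in> space M"
  shows "((\<lambda>u. ennreal (f (X (u + t) w))) \<longlongrightarrow> ennreal (f (X (q + t) w))) (at_right q)"
  using bump_continuous[OF assms(1)] X_shift_right_cont[OF assms(3,2,4)]
  by (intro tendsto_ennrealI) (auto intro: continuous_on_tendsto_compose)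

lemma nn_integral_at_time_mono:
  assumes z: "z \<in> E" and T: "stopping_time G T" and A: "A \<in> sets (pre_sigma T)"
    and U: "\<And>q. 0 \<le> q \<Longrightarrow> U q \<in> borel_measurable M"
      "\<And>q w. 0 \<le> q \<Longrightarrow> w \<in> space M \<Longrightarrow> U q w \<le> (1::ennreal)"
      "\<And>q w. 0 \<le> q \<Longrightarrow> w \<in> space M \<Longrightarrow> ((\<lambda>u. U u w) \<longlongrightarrow> U q w) (at_right q)"
    and V: "\<And>q. 0 \<le> q \<Longrightarrow> V q \<in> borel_measurable M"
      "\<And>q w. 0 \<le> q \<Longrightarrow> w \<in> space M \<Longrightarrow> V q w \<le> (1::ennreal)"
      "\<And>q w. 0 \<le> q \<Longrightarrow> w \<in> space M \<Longrightarrow> ((\<lambda>u. V u w) \<longlongrightarrow> V q w) (at_right q)"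
    and le: "\<And>q B. 0 < q \<Longrightarrow> B \<in> sets (F (ennreal q)) \<Longrightarrow> (\<integral>\<^sup>+w\<in>B. U q w \<partial>P z) \<le> (\<integral>\<^sup>+w\<in>B. V q w \<partial>P z)"
  shows "(\<integral>\<^sup>+w\<in>{w\<in>A. T w < \<top>}. U (enn2real (T w)) w \<partial>P z)
    \<le> (\<integral>\<^sup>+w\<in>{w\<in>A. T w < \<top>}. V (enn2real (T w)) w \<partial>P z)"
proof (rule nn_integral_random_time_mono[where F="\<lambda>q. sets (F (ennreal q))"])
  show "sigma_algebra (space (P z)) (sets (F (ennreal q)))" for q
    using sets.sigma_algebra_axioms[of "F (ennreal q)"] z by (simp add: space_P)
  show "A \<subseteq> space (P z)"
    using sets.sets_into_space[OF A] z by (simp add: space_pre_sigma space_P)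
  show "{w\<in>A. T w < ennreal q} \<in> sets (F (ennreal q))" if "0 < q" for q
    using sets_before_stopping_time[OF T A that] .
qed (use z U V le sets_F_subset in \<open>auto simp: finite_measure_P measurable_P space_P sets_P intro: ennreal_leI subsetD[OF sets_F_mono]\<close>)

text \<open>At a fixed time this is the Markov property. Both integrands are right-continuous in
  time, the left one by continuity of f and the right one by the Feller property, so the identity
  passes to T; the comparison lemma is used once in each direction.\<close>

lemma strong_markov_bump:
  assumes z: "z \<in> E" and T: "stopping_time G T" and A: "A \<in> sets (pre_sigma T)" and t: "0 \<le> t"
    and f: "f \<in> bump"
  shows "(\<integral>\<^sup>+w\<in>{w\<in>A. T w < \<top>}. f (X (enn2real (T w) + t) w) \<partial>P z) =
    (\<integral>\<^sup>+w\<in>{w\<in>A. T w < \<top>}. (\<integral>\<^sup>+w'. f (X t w') \<partial>P (at_time T w)) \<partial>P z)"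
proof -
  define U where "U q w = ennreal (f (X (q + t) w))" for q w
  define V where "V q w = (\<integral>\<^sup>+w'. f (X t w') \<partial>P (X q w))" for q w
  have U: "U q \<in> borel_measurable M" "w \<in> space M \<Longrightarrow> U q w \<le> 1"
    "w \<in> space M \<Longrightarrow> ((\<lambda>u. U u w) \<longlongrightarrow> U q w) (at_right q)" if "0 \<le> q" for q w
    using that t bump_bounds(2)[OF f] bump_X_right_cont[OF f t]
      measurable_compose[OF measurable_X bump_measurable[OF f], of "q + t"]
    by (auto simp: U_def[abs_def] ennreal_le_1)
  have V: "V q \<in> borel_measurable M" "w \<in> space M \<Longrightarrow> V q w \<le> 1"
    "w \<in> space M \<Longrightarrow> ((\<lambda>u. V u w) \<longlongrightarrow> V q w) (at_right q)" if "0 \<le> q" for q w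
    using that t nn_integral_feller_le_1[OF f X_in_E] feller_X_right_cont[OF f t]
      measurable_compose[OF measurable_X_S measurable_nn_integral_feller[OF f t]]
    by (auto simp: V_def[abs_def])
  have eq: "(\<integral>\<^sup>+w\<in>B. U q w \<partial>P z) = (\<integral>\<^sup>+w\<in>B. V q w \<partial>P z)"
    if "0 < q" "B \<in> sets (F (ennreal q))" for q B
    using markov_snd[OF z _ t that(2), of "\<lambda>y. ennreal (f y)"] that(1) bump_measurable[OF f]
    by (simp add: U_def V_def)
  show ?thesis
    using nn_integral_at_time_mono[of z T A U V, OF z T A U V] nn_integral_at_time_mono[of z T A V U, OF z T A V U] eq
    by (intro antisym) (simp_all add: U_def V_def)
qed

text \<open>The two sides are the values at B of two finite Borel measures, the law of X at time T +
  t on \<open>A'\<close> and a mixture of kernels, and bumps cannot separate them.\<close>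

lemma strong_markov_emeasure:
  assumes z: "z \<in> E" and T: "stopping_time G T" and A: "A \<in> sets (pre_sigma T)" and t: "0 \<le> t"
    and B: "B \<in> sets S"
  shows "emeasure (P z) {w\<in>A. T w < \<top> \<and> X (enn2real (T w) + t) w \<in> B} =
    (\<integral>\<^sup>+w\<in>{w\<in>A. T w < \<top>}. emeasure (kernel t (at_time T w)) B \<partial>P z)"
proof -
  define A' where "A' = {w\<in>A. T w < \<top>}"
  define N where "N = density (P z) (indicator A')"
  \<comment> \<open>The kernel regarded as a measure on the whole Euclidean space, where
    \<open>measure_eqI_bump\<close> applies; on subsets of \<open>E\<close> it agrees with
    \<open>kernel t y\<close>.\<close>
  define K where "K y = distr (P y) borel (X t)" for y
  have T_meas: "T \<in> borel_measurable M"
    using T by (rule measurable_stopping_time_M)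
  have A_M: "A \<in> sets M" "A \<subseteq> space M"
    using A sets_pre_sigma_subset[OF T] sets.sets_into_space by blast+
  have A': "A' \<in> sets M" "A' \<subseteq> space M"
    using sets_finite_time[OF T_meas A_M(1)] A_M(2) by (auto simp: A'_def)
  have N: "finite_measure N" "sets N = sets M" "space N = space M"
    using finite_measure_density_indicator[OF finite_measure_P[OF z], of A'] A' z
    by (auto simp: N_def sets_P space_P)
  have meas_N: "measurable N L = measurable M L" for L :: "'b measure"
    using N(2) by (rule measurable_cong_sets) simp
  have XT: "(\<lambda>w. at_time T w) \<in> measurable M S" and XTt: "(\<lambda>w. X (enn2real (T w) + t) w) \<in> borel_measurable M"
    using measurable_at_time_plus[OF T_meas, of 0] measurable_at_time_plus[OF T_meas t]
    by (auto intro!: measurable_restrict_space2 X_in_E)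
  have K: "K \<in> measurable S (subprob_algebra borel)"
  proof (rule measurable_subprob_algebra)
    show "subprob_space (K y)" if "y \<in> space S" for y
      using that t unfolding K_def
      by (intro prob_space_imp_subprob_space prob_space.prob_space_distr prob_space_P)
        (auto simp: measurable_P space_restrict_space)
    show "(\<lambda>y. emeasure (K y) C) \<in> borel_measurable S" if "C \<in> sets borel" for C
    proof (subst measurable_cong)
      show "emeasure (K y) C = emeasure (P y) (X t -` C \<inter> space M)" if "y \<in> space S" for y
        using that t \<open>C \<in> sets borel\<close>
        by (simp add: K_def emeasure_distr measurable_P space_P space_restrict_space)
    qed (rule kernel_measurable[OF t that])
  qed (simp add: K_def)
  have KT: "(\<lambda>w. K (at_time T w)) \<in> measurable N (subprob_algebra borel)"
    unfolding meas_N by (rule measurable_compose[OF XT K])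
  have "space M \<noteq> {}"
    using prob_space.not_empty[OF prob_space_P[OF z]] z by (simp add: space_P)
  then have ne: "space N \<noteq> {}"
    by (simp add: N)
  have "distr N borel (\<lambda>w. X (enn2real (T w) + t) w) = N \<bind> (\<lambda>w. K (at_time T w))"
  proof (rule measure_eqI_bump)
    show "finite_measure (distr N borel (\<lambda>w. X (enn2real (T w) + t) w))"
      using N(1) XTt by (intro finite_measure.finite_measure_distr) (simp_all add: meas_N)
    show "sets (N \<bind> (\<lambda>w. K (at_time T w))) = sets borel"
      using KT ne by (intro sets_bind) (simp_all add: K_def)
    fix f :: "'a \<Rightarrow> real" assume f: "f \<in> bump"
    have K_f: "(\<integral>\<^sup>+y. f y \<partial>K x) = (\<integral>\<^sup>+w'. f (X t w') \<partial>P x)" if "x \<in> E" for x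
      unfolding K_def using t that bump_measurable[OF f]
      by (intro nn_integral_distr) (simp_all add: measurable_P)
    have "(\<integral>\<^sup>+x. f x \<partial>distr N borel (\<lambda>w. X (enn2real (T w) + t) w)) = (\<integral>\<^sup>+w. f (X (enn2real (T w) + t) w) \<partial>N)"
      using XTt bump_measurable[OF f] by (intro nn_integral_distr) (simp_all add: meas_N)
    also have "\<dots> = (\<integral>\<^sup>+w\<in>A'. f (X (enn2real (T w) + t) w) \<partial>P z)"
      unfolding N_def using A' z XTt bump_measurable[OF f]
      by (intro set_nn_integral_eq_density) (auto simp: sets_P measurable_P intro: measurable_compose)
    also have "\<dots> = (\<integral>\<^sup>+w\<in>A'. (\<integral>\<^sup>+w'. f (X t w') \<partial>P (at_time T w)) \<partial>P z)"
      unfolding A'_def by (rule strong_markov_bump[OF z T A t f])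
    also have "\<dots> = (\<integral>\<^sup>+w. (\<integral>\<^sup>+w'. f (X t w') \<partial>P (at_time T w)) \<partial>N)"
      unfolding N_def using A' z measurable_compose[OF XT measurable_nn_integral_feller[OF f t]]
      by (intro set_nn_integral_eq_density[symmetric]) (auto simp: sets_P measurable_P)
    also have "\<dots> = (\<integral>\<^sup>+w. (\<integral>\<^sup>+y. f y \<partial>K (at_time T w)) \<partial>N)"
      by (intro nn_integral_cong K_f[symmetric] X_in_E) (auto simp: N)
    also have "\<dots> = (\<integral>\<^sup>+x. f x \<partial>(N \<bind> (\<lambda>w. K (at_time T w))))"
      using bump_measurable[OF f] by (intro nn_integral_bind[symmetric, OF _ KT]) simp
    finally show "(\<integral>\<^sup>+x. f x \<partial>distr N borel (\<lambda>w. X (enn2real (T w) + t) w))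
        = (\<integral>\<^sup>+x. f x \<partial>(N \<bind> (\<lambda>w. K (at_time T w))))" .
  qed simp_all
  note law = this
  have B': "B \<in> sets borel" "B \<subseteq> E"
    using B by (auto simp: sets_S_iff)
  have "emeasure (P z) {w\<in>A. T w < \<top> \<and> X (enn2real (T w) + t) w \<in> B}
      = emeasure (P z) (A' \<inter> ((\<lambda>w. X (enn2real (T w) + t) w) -` B \<inter> space M))"
    using A'(2) by (intro arg_cong[where f="emeasure (P z)"]) (auto simp: A'_def)
  also have "\<dots> = emeasure (distr N borel (\<lambda>w. X (enn2real (T w) + t) w)) B"
    using A' z B' XTt measurable_sets[OF XTt B'(1)]
    by (subst emeasure_distr) (auto simp: meas_N N(3) N_def emeasure_restricted sets_P measurable_P space_P)
  also have "\<dots> = (\<integral>\<^sup>+w. emeasure (K (at_time T w)) B \<partial>N)"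
    unfolding law by (rule emeasure_bind[OF ne KT B'(1)])
  also have "\<dots> = (\<integral>\<^sup>+w\<in>A'. emeasure (K (at_time T w)) B \<partial>P z)"
    unfolding N_def using A' z measurable_emeasure_kernel[OF KT B'(1)] N(2)
    by (intro set_nn_integral_eq_density) (auto simp: sets_P measurable_P meas_N)
  also have "\<dots> = (\<integral>\<^sup>+w\<in>A'. emeasure (kernel t (at_time T w)) B \<partial>P z)"
  proof (intro nn_integral_cong arg_cong2[where f="(*)"] refl)
    fix w assume "w \<in> space (P z)"
    then have "at_time T w \<in> E"
      using z X_in_E by (simp add: space_P)
    then show "emeasure (K (at_time T w)) B = emeasure (kernel t (at_time T w)) B"
      using t B' by (simp add: K_def emeasure_distr measurable_P space_P emeasure_kernel)
  qed
  finally show ?thesis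
    unfolding A'_def .
qed

text \<open>The identity integrated over all events of \<open>pre_sigma T\<close> characterises the
  conditional expectation once its candidate is measurable for \<open>pre_sigma T\<close>.\<close>

lemma strong_markov_kernel: "strong_markov E M G P X kernel"
  unfolding strong_markov_def
proof (intro ballI allI impI)
  fix z :: 'a and T :: "'w \<Rightarrow> ennreal" and t :: real and B :: "'a set"
  assume z: "z \<in> E" and T: "stopping_time G T" and t: "0 \<le> t" and B: "B \<in> sets S"
  let ?H = "pre_sigma T"
  define Q where "Q = {w\<in>space M. T w < \<top> \<and> X (enn2real (T w) + t) w \<in> B}"
  \<comment> \<open>The value 0 where T is infinite agrees with the indicator of \<open>Q\<close>,
    which vanishes there, so the equality can be proved on the whole space.\<close>
  define g where "g w = (if T w < \<top> then measure (kernel t (at_time T w)) B else 0)" for w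
  interpret prob_space "P z"
    using z by (rule prob_space_P)
  interpret finite_measure_subalgebra "P z" ?H
    using subalgebra_pre_sigma[OF T z] by unfold_locales
  have B': "B \<in> sets borel" "B \<subseteq> E"
    using B by (auto simp: sets_S_iff)
  have T_meas: "T \<in> borel_measurable M"
    using T by (rule measurable_stopping_time_M)
  have "Q = (T -` {..<\<top>} \<inter> space M) \<inter> ((\<lambda>w. X (enn2real (T w) + t) w) -` B \<inter> space M)"
    by (auto simp: Q_def)
  then have Q: "Q \<in> sets M"
    using measurable_sets[OF T_meas, of "{..<\<top>}"] measurable_sets[OF measurable_at_time_plus[OF T_meas t] B'(1)]
    by auto
  have phi: "(\<lambda>y. measure (kernel t y) B) \<in> borel_measurable S"
    using measurable_emeasure_kernel[OF kernel_subprob_algebra[OF t] B]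
    unfolding measure_def by measurable
  have fin: "{w\<in>space M. T w < \<top> \<and> at_time T w \<in> C} \<in> sets ?H" if "C \<in> sets borel" for C
    using T that by (rule measurable_at_time_pre_sigma)
  have g: "g \<in> borel_measurable ?H"
  proof (rule measurableI)
    fix C :: "real set" assume C: "C \<in> sets borel"
    define D where "D = (\<lambda>y. measure (kernel t y) B) -` C \<inter> E"
    have "D \<in> sets S"
      using measurable_sets[OF phi C] by (simp add: D_def space_restrict_space)
    then have "D \<in> sets borel"
      by (simp add: sets_S_iff)
    have "space ?H - {w\<in>space M. T w < \<top> \<and> at_time T w \<in> UNIV} \<in> sets ?H"
      by (intro sets.compl_sets fin) simp
    \<comment> \<open>The second set is the event that T is infinite; it belongs to the preimage
      exactly when C contains the default value 0.\<close>
    then have "{w\<in>space M. T w < \<top> \<and> at_time T w \<in> D} \<union>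
        (if 0 \<in> C then space ?H - {w\<in>space M. T w < \<top> \<and> at_time T w \<in> UNIV} else {}) \<in> sets ?H"
      using fin[OF \<open>D \<in> sets borel\<close>] by auto
    also have "{w\<in>space M. T w < \<top> \<and> at_time T w \<in> D} \<union>
        (if 0 \<in> C then space ?H - {w\<in>space M. T w < \<top> \<and> at_time T w \<in> UNIV} else {}) = g -` C \<inter> space ?H"
      using X_in_E by (auto simp: g_def D_def space_pre_sigma split: if_splits)
    finally show "g -` C \<inter> space ?H \<in> sets ?H" .
  qed simp
  have g_bounds: "0 \<le> g w" "g w \<le> 1" if "w \<in> space M" for w
    using prob_space.prob_le_1[OF prob_space_kernel[OF t X_in_E]] that by (auto simp: g_def)
  have g_P: "g \<in> borel_measurable (P z)"
    using g by (rule measurable_from_subalg[OF subalg])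
  have g_int: "integrable (P z) g"
    using g_P g_bounds z by (intro integrable_const_bound[where B=1]) (auto simp: space_P)
  have "AE w in P z. real_cond_exp (P z) ?H (indicator Q) w = g w"
  proof (rule real_cond_exp_charact)
    show "integrable (P z) (indicator Q :: _ \<Rightarrow> real)"
      using Q z by (intro integrable_real_indicator) (simp_all add: sets_P emeasure_eq_measure)
    fix A assume A: "A \<in> sets ?H"
    have A_M: "A \<in> sets M" "A \<subseteq> space M"
      using A sets_pre_sigma_subset[OF T] sets.sets_into_space by blast+
    have "A \<inter> Q = {w\<in>A. T w < \<top> \<and> X (enn2real (T w) + t) w \<in> B}"
      using A_M by (auto simp: Q_def)
    then have "emeasure (P z) (A \<inter> Q) = (\<integral>\<^sup>+w\<in>{w\<in>A. T w < \<top>}. emeasure (kernel t (at_time T w)) B \<partial>P z)"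
      using strong_markov_emeasure[OF z T A t B] by simp
    also have "\<dots> = (\<integral>\<^sup>+w. ennreal (indicator A w * g w) \<partial>P z)"
    proof (intro nn_integral_cong)
      fix w assume "w \<in> space (P z)"
      then have "at_time T w \<in> E"
        using z X_in_E by (simp add: space_P)
      then interpret k: prob_space "kernel t (at_time T w)"
        by (rule prob_space_kernel[OF t])
      show "emeasure (kernel t (at_time T w)) B * indicator {w\<in>A. T w < \<top>} w = ennreal (indicator A w * g w)"
        by (auto simp: g_def k.emeasure_eq_measure split: split_indicator)
    qed
    also have "\<dots> = ennreal (\<integral>w. indicator A w * g w \<partial>P z)"
    proof (intro nn_integral_eq_integral integrable_const_bound[where B=1])
      show "(\<lambda>w. indicator A w * g w) \<in> borel_measurable (P z)"
        using A_M g_P z by (intro borel_measurable_times borel_measurable_indicator) (simp_all add: sets_P)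
    qed (use g_bounds z in \<open>auto simp: space_P split: split_indicator\<close>)
    finally have "ennreal (measure (P z) (A \<inter> Q)) = ennreal (\<integral>w. indicator A w * g w \<partial>P z)"
      by (simp add: emeasure_eq_measure)
    then have "measure (P z) (A \<inter> Q) = (\<integral>w. indicator A w * g w \<partial>P z)"
      using g_bounds z by (subst (asm) ennreal_inj) (auto intro!: integral_nonneg_AE simp: space_P)
    moreover have "(\<integral>w\<in>A. indicator Q w \<partial>P z) = measure (P z) (A \<inter> Q)"
    proof -
      have "(\<integral>w\<in>A. indicator Q w \<partial>P z) = (\<integral>w. indicator (A \<inter> Q) w \<partial>P z)"
        unfolding set_lebesgue_integral_def by (intro Bochner_Integration.integral_cong) (auto split: split_indicator)
      also have "\<dots> = measure (P z) (A \<inter> Q)"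
        using A_M Q z by (simp add: sets_P space_P Int_absorb2)
      finally show ?thesis .
    qed
    ultimately show "(\<integral>w\<in>A. indicator Q w \<partial>P z) = (\<integral>w\<in>A. g w \<partial>P z)"
      by (simp add: set_lebesgue_integral_def)
  qed (use g g_int in auto)
  then show "AE w in P z. T w < \<top> \<longrightarrow>
      real_cond_exp (P z) ?H (indicator {w\<in>space M. T w < \<top> \<and> X (enn2real (T w) + t) w \<in> B}) w
      = measure (kernel t (at_time T w)) B"
    unfolding Q_def[symmetric] by eventually_elim (simp add: g_def)
qed

section \<open>Quasi-left-continuity\<close>

lemma min_dist_X_right_cont:
  assumes "0 \<le> t" "0 \<le> q" "w \<in> space M"
  shows "((\<lambda>u. ennreal (min 1 (dist (X u w) (X (u + t) w))))
    \<longlongrightarrow> ennreal (min 1 (dist (X q w) (X (q + t) w)))) (at_right q)"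
  using X_shift_right_cont[OF assms(2,1,3)] X_right_cont[OF assms(2,3)]
  by (intro tendsto_ennrealI tendsto_min tendsto_const tendsto_dist)

text \<open>At a fixed time q the Markov property restarts the process at \<open>X q w\<close>,
  where the bound holds whatever that point is. The constant e then serves as the larger process in
  the random-time comparison.\<close>

lemma small_time_at_stopping_time:
  assumes z: "z \<in> E" and T: "stopping_time G T" and t: "0 \<le> t" and e: "0 \<le> e" "e \<le> 1"
    and small: "\<And>y. y \<in> E \<Longrightarrow> (\<integral>\<^sup>+w. min 1 (dist y (X t w)) \<partial>P y) \<le> ennreal e"
  shows "(\<integral>\<^sup>+w\<in>{w\<in>space M. T w < \<top>}. min 1 (dist (at_time T w) (X (enn2real (T w) + t) w)) \<partial>P z) \<le> ennreal e"
proof -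
  define U where "U q w = ennreal (min 1 (dist (X q w) (X (q + t) w)))" for q w
  interpret prob_space "P z"
    using z by (rule prob_space_P)
  have dist_meas: "(\<lambda>p :: 'a \<times> 'a. ennreal (min 1 (dist (fst p) (snd p)))) \<in> borel_measurable borel"
    by (intro measurable_compose[OF _ measurable_ennreal] borel_measurable_continuous_onI continuous_intros)
  have A: "space M \<in> sets (pre_sigma T)"
    using sets.top[of "pre_sigma T"] by (simp add: space_pre_sigma)
  have U: "U q \<in> borel_measurable M" "U q w \<le> 1"
    "w \<in> space M \<Longrightarrow> ((\<lambda>u. U u w) \<longlongrightarrow> U q w) (at_right q)" if "0 \<le> q" for q w
    using that t min_dist_X_right_cont[OF t] unfolding U_def[abs_def]
    by (auto intro!: measurable_compose[OF _ measurable_ennreal] borel_measurable_min borel_measurable_dist simp: ennreal_le_1)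
  have V: "(\<lambda>w. ennreal e) \<in> borel_measurable M" "ennreal e \<le> 1"
    "((\<lambda>u. ennreal e) \<longlongrightarrow> ennreal e) (at_right q)" for q :: real
    using e by (auto simp: ennreal_le_1)
  have le: "(\<integral>\<^sup>+w\<in>B. U q w \<partial>P z) \<le> (\<integral>\<^sup>+w\<in>B. ennreal e \<partial>P z)"
    if "0 < q" "B \<in> sets (F (ennreal q))" for q B
  proof -
    have "(\<integral>\<^sup>+w\<in>B. U q w \<partial>P z) = (\<integral>\<^sup>+w\<in>B. (\<integral>\<^sup>+w'. min 1 (dist (X q w) (X t w')) \<partial>P (X q w)) \<partial>P z)"
      using markov[OF z _ t that(2) dist_meas] that(1) by (simp add: U_def)
    also have "\<dots> \<le> (\<integral>\<^sup>+w\<in>B. ennreal e \<partial>P z)"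
      using that z by (intro nn_integral_mono mult_right_mono small X_in_E) (auto simp: space_P)
    finally show ?thesis .
  qed
  have "(\<integral>\<^sup>+w\<in>{w\<in>space M. T w < \<top>}. U (enn2real (T w)) w \<partial>P z) \<le> (\<integral>\<^sup>+w\<in>{w\<in>space M. T w < \<top>}. ennreal e \<partial>P z)"
    by (rule nn_integral_at_time_mono[OF z T A, where V="\<lambda>_ _. ennreal e"]) (use U V le in auto)
  also have "\<dots> \<le> (\<integral>\<^sup>+w. ennreal e \<partial>P z)"
    by (intro nn_integral_mono) (auto split: split_indicator)
  also have "\<dots> = ennreal e"
    by (simp add: emeasure_space_1)
  finally show ?thesis
    by (simp add: U_def)
qed

text \<open>Fatou's lemma is applied twice, in n for a fixed time step \<open>h j\<close> and then
  in j, to match the iterated limit of \<open>cadlag_no_jump\<close>.\<close>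

lemma quasi_left_continuous_X: "quasi_left_continuous E M G P X"
  unfolding quasi_left_continuous_def
proof (intro ballI allI impI, elim conjE)
  fix z and T :: "nat \<Rightarrow> 'w \<Rightarrow> ennreal"
  assume z: "z \<in> E" and T: "\<forall>n. stopping_time G (T n)" and inc: "\<forall>w\<in>space M. incseq (\<lambda>n. T n w)"
  define R where "R w = (SUP n. T n w)" for w
  define e where "e j = 1 / (real j + 1)" for j :: nat
  have e: "0 < e j" "e j \<le> 1" for j
    by (auto simp: e_def)
  have "\<forall>j. \<exists>d>0. \<forall>t\<in>{0..d}. \<forall>z\<in>E. (\<integral>\<^sup>+w. min 1 (dist z (X t w)) \<partial>P z) \<le> ennreal (e j)"
    using small_time e(1) by blast
  then obtain d where d: "\<And>j. 0 < d j"
    "\<And>j t y. 0 \<le> t \<Longrightarrow> t \<le> d j \<Longrightarrow> y \<in> E \<Longrightarrow> (\<integral>\<^sup>+w. min 1 (dist y (X t w)) \<partial>P y) \<le> ennreal (e j)"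
    by (metis atLeastAtMost_iff)
  have e_lim: "e \<longlonglongrightarrow> 0"
    using LIMSEQ_inverse_real_of_nat by (simp add: e_def[abs_def] inverse_eq_divide add.commute)
  \<comment> \<open>The step stays within the range where \<open>e j\<close> is a valid bound and is
    also forced to tend to 0.\<close>
  define h where "h j = min (d j) (e j)" for j
  have h: "0 < h j" "h j \<le> d j" for j
    using d(1) e(1) by (auto simp: h_def)
  have h_lim: "h \<longlonglongrightarrow> 0"
    by (rule tendsto_sandwich[OF _ _ tendsto_const e_lim]) (auto simp: h_def intro!: always_eventually less_imp_le[OF d(1)] less_imp_le[OF e(1)])
  \<comment> \<open>Localised to a finite limit \<open>R\<close>, which makes every
    \<open>T n\<close> finite and does not depend on n or j, so it passes through both
    limits.\<close>
  define c where "c j n w = ennreal (min 1 (dist (at_time (T n) w) (X (enn2real (T n w) + h j) w))) *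
    indicator {w\<in>space M. R w < \<top>} w" for j n w
  have T_meas: "T n \<in> borel_measurable M" for n
    using T by (intro measurable_stopping_time_M) simp
  then have [measurable]: "R \<in> borel_measurable M"
    unfolding R_def[abs_def] by (intro borel_measurable_SUP) auto
  have c_meas: "c j n \<in> borel_measurable (P z)" for j n
  proof -
    have "{w\<in>space M. R w < \<top>} \<in> sets M"
      by measurable
    moreover have "(\<lambda>w. dist (at_time (T n) w) (X (enn2real (T n w) + h j) w)) \<in> borel_measurable M"
      using measurable_at_time_plus[OF T_meas, of 0 n] measurable_at_time_plus[OF T_meas, of "h j" n] h(1)[of j]
      by (intro borel_measurable_dist) auto
    ultimately show ?thesis
      unfolding c_def measurable_P[OF z] by measurable
  qed
  have c_int: "(\<integral>\<^sup>+w. c j n w \<partial>P z) \<le> ennreal (e j)" for j n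
  proof -
    have "T n w < \<top>" if "R w < \<top>" for w
      using that SUP_upper[of n UNIV "\<lambda>n. T n w"] by (simp add: R_def)
    then have "(\<integral>\<^sup>+w. c j n w \<partial>P z) \<le> (\<integral>\<^sup>+w\<in>{w\<in>space M. T n w < \<top>}.
        min 1 (dist (at_time (T n) w) (X (enn2real (T n w) + h j) w)) \<partial>P z)"
      unfolding c_def by (intro nn_integral_mono) (auto split: split_indicator)
    also have "\<dots> \<le> ennreal (e j)"
      using e(1)[of j] e(2)[of j] h(1)[of j] h(2)[of j] T z
      by (intro small_time_at_stopping_time d(2)) auto
    finally show ?thesis .
  qed
  have "(\<integral>\<^sup>+w. liminf (\<lambda>j. liminf (\<lambda>n. c j n w)) \<partial>P z) \<le> liminf (\<lambda>j. \<integral>\<^sup>+w. liminf (\<lambda>n. c j n w) \<partial>P z)"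
    using c_meas by (intro nn_integral_liminf) measurable
  also have "\<dots> \<le> liminf (\<lambda>j. ennreal (e j))"
  proof (intro Liminf_mono always_eventually allI)
    fix j
    have "(\<integral>\<^sup>+w. liminf (\<lambda>n. c j n w) \<partial>P z) \<le> liminf (\<lambda>n. \<integral>\<^sup>+w. c j n w \<partial>P z)"
      using c_meas by (intro nn_integral_liminf)
    also have "\<dots> \<le> liminf (\<lambda>n. ennreal (e j))"
      by (intro Liminf_mono always_eventually allI c_int)
    finally show "(\<integral>\<^sup>+w. liminf (\<lambda>n. c j n w) \<partial>P z) \<le> ennreal (e j)"
      by (simp add: Liminf_const)
  qed
  also have "\<dots> = 0"
    using tendsto_ennrealI[OF e_lim] by (intro lim_imp_Liminf) auto
  finally have "(\<integral>\<^sup>+w. liminf (\<lambda>j. liminf (\<lambda>n. c j n w)) \<partial>P z) = 0"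
    by simp
  then have "AE w in P z. liminf (\<lambda>j. liminf (\<lambda>n. c j n w)) = 0"
    using c_meas by (subst (asm) nn_integral_0_iff_AE) measurable
  then show "AE w in P z. (SUP n. T n w) < \<top> \<longrightarrow>
      (\<lambda>n. X (enn2real (T n w)) w) \<longlonglongrightarrow> X (enn2real (SUP n. T n w)) w"
    using X_cadlag[OF z] AE_space
  proof eventually_elim
    case (elim w)
    show ?case
    proof
      assume fin: "(SUP n. T n w) < \<top>"
      have w: "w \<in> space M"
        using elim z by (simp add: space_P)
      then have incw: "incseq (\<lambda>n. T n w)"
        using inc by blast
      have Tfin: "T n w < \<top>" for n
        using fin SUP_upper[of n UNIV "\<lambda>n. T n w"] by (simp add: le_less_trans)
      show "(\<lambda>n. X (enn2real (T n w)) w) \<longlonglongrightarrow> X (enn2real (SUP n. T n w)) w"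
      proof (rule cadlag_no_jump[where f="\<lambda>t. X t w" and a="\<lambda>n. enn2real (T n w)" and h=h])
        show "cadlag E (\<lambda>t. X t w)"
          by (rule elim)
        show "incseq (\<lambda>n. enn2real (T n w))"
          using incw Tfin by (auto simp: incseq_def intro!: enn2real_mono)
        show "(\<lambda>n. enn2real (T n w)) \<longlonglongrightarrow> enn2real (SUP n. T n w)"
          using fin LIMSEQ_SUP[OF incw] by (intro tendsto_enn2real) auto
        show "liminf (\<lambda>j. liminf (\<lambda>n. ennreal (min 1 (dist (X (enn2real (T n w)) w) (X (enn2real (T n w) + h j) w))))) = 0"
          using elim(1) fin w by (simp add: c_def R_def)
      qed (use h h_lim in auto)
    qed
  qed
qed

lemma hunt_process_kernel: "hunt_process E M P X kernel"
  unfolding hunt_process_def Let_def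
  using transition_function_kernel strong_markov_kernel quasi_left_continuous_X
  by (auto simp: sets_P prob_space_P measurable_X_S X_start X_cadlag kernel_def)

end

section \<open>Paths with independent increments\<close>

abbreviation path_filtration :: "real \<Rightarrow> (real \<Rightarrow> real \<times> real) measure" where
  "path_filtration s \<equiv> natural_filtration path_space borel (\<lambda>r w. w r) (ennreal s)"

lemma space_path_space: "space path_space = {w \<in> extensional {0..}. cadlag UNIV w}"
  by (auto simp: path_space_def space_restrict_space space_PiM PiE_def)

lemma measurable_eval [measurable]: "0 \<le> t \<Longrightarrow> (\<lambda>w. w t) \<in> borel_measurable path_space"
  unfolding path_space_def by (intro measurable_restrict_space1 measurable_component_singleton) simp

lemma measurable_path_spaceI:
  assumes "\<And>t. 0 \<le> t \<Longrightarrow> (\<lambda>x. f x t) \<in> borel_measurable N"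
    and f: "\<And>x. x \<in> space N \<Longrightarrow> f x \<in> space path_space"
  shows "f \<in> measurable N path_space"
  unfolding path_space_def
proof (rule measurable_restrict_space2)
  show "f \<in> space N \<rightarrow> {w. cadlag UNIV w}"
    using f by (auto simp: space_path_space)
  have "(\<lambda>x. \<lambda>t\<in>{0..}. f x t) \<in> measurable N (\<Pi>\<^sub>M t\<in>{0..}. borel)"
    using assms(1) by (intro measurable_restrict) simp
  then show "f \<in> measurable N (\<Pi>\<^sub>M t\<in>{0..}. borel)"
  proof (subst (asm) measurable_cong)
    show "(\<lambda>t\<in>{0..}. f x t) = f x" if "x \<in> space N" for x
      using f[OF that] by (simp add: space_path_space extensional_restrict)
  qed
qed

lemma path_right_cont:
  "w \<in> space path_space \<Longrightarrow> 0 \<le> t \<Longrightarrow> (w \<longlongrightarrow> w t) (at_right t)"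
  by (auto simp: space_path_space cadlag_def)

lemma path_left_limit:
  assumes "w \<in> space path_space" "0 < t"
  obtains l where "(w \<longlongrightarrow> l) (at_left t)"
  using assms by (auto simp: space_path_space cadlag_def)

text \<open>Paths are extensional, so transformed paths have to be cut off at negative times; the
  one-sided limits that matter do not see the cut.\<close>

lemma restrict_in_path_space:
  assumes r: "\<And>t. 0 \<le> t \<Longrightarrow> (f \<longlongrightarrow> f t) (at_right t)"
    and l: "\<And>t. 0 < t \<Longrightarrow> \<exists>l. (f \<longlongrightarrow> l) (at_left t)"
  shows "restrict f {0..} \<in> space path_space"
proof -
  have "(restrict f {0..} \<longlongrightarrow> restrict f {0..} t) (at_right t)" if "0 \<le> t" for t
  proof -
    have "\<forall>\<^sub>F u in at_right t. restrict f {0..} u = f u"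
      unfolding eventually_at_right_field using that by (intro exI[of _ "t + 1"]) auto
    then show ?thesis
      using r[OF that] that by (simp add: tendsto_cong)
  qed
  moreover have "\<exists>l. (restrict f {0..} \<longlongrightarrow> l) (at_left t)" if "0 < t" for t
  proof -
    have "\<forall>\<^sub>F u in at_left t. restrict f {0..} u = f u"
      unfolding eventually_at_left_field using that by (intro exI[of _ 0]) auto
    then show ?thesis
      using l[OF that] by (simp add: tendsto_cong)
  qed
  ultimately show ?thesis
    by (simp add: space_path_space cadlag_def)
qed

section \<open>Translated, shifted and stopped paths\<close>

definition translate :: "real \<times> real \<Rightarrow> (real \<Rightarrow> real \<times> real) \<Rightarrow> real \<Rightarrow> real \<times> real" where
  "translate z w = (\<lambda>u\<in>{0..}. z + w u)"

definition increments_from :: "real \<Rightarrow> (real \<Rightarrow> real \<times> real) \<Rightarrow> real \<Rightarrow> real \<times> real" where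
  "increments_from a w = (\<lambda>u\<in>{0..}. w (a + u) - w a)"

definition stopped_path :: "real \<Rightarrow> (real \<Rightarrow> real \<times> real) \<Rightarrow> real \<Rightarrow> real \<times> real" where
  "stopped_path q w = (\<lambda>u\<in>{0..}. w (min u q))"

lemma translate_apply [simp]: "0 \<le> u \<Longrightarrow> translate z w u = z + w u"
  by (simp add: translate_def)

lemma increments_from_apply [simp]: "0 \<le> u \<Longrightarrow> increments_from a w u = w (a + u) - w a"
  by (simp add: increments_from_def)

lemma stopped_path_apply [simp]: "0 \<le> u \<Longrightarrow> stopped_path q w u = w (min u q)"
  by (simp add: stopped_path_def)

lemma translate_in_path_space:
  assumes "w \<in> space path_space"
  shows "translate z w \<in> space path_space"
  unfolding translate_def
proof (rule restrict_in_path_space)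
  show "\<exists>l. ((\<lambda>u. z + w u) \<longlongrightarrow> l) (at_left t)" if "0 < t" for t
  proof -
    obtain l where "(w \<longlongrightarrow> l) (at_left t)"
      using path_left_limit[OF assms \<open>0 < t\<close>] .
    from tendsto_add[OF tendsto_const this] show ?thesis
      by blast
  qed
qed (intro tendsto_add tendsto_const path_right_cont assms)

lemma tendsto_shift_at_right:
  fixes a t :: real
  assumes "(f \<longlongrightarrow> l) (at_right (a + t))"
  shows "((\<lambda>u. f (a + u)) \<longlongrightarrow> l) (at_right t)"
  using assms unfolding filterlim_at_right_to_0[of _ _ "a + t"] filterlim_at_right_to_0[of _ _ t]
  by (simp add: ac_simps)

lemma tendsto_shift_at_left:
  fixes a t :: real
  assumes "(f \<longlongrightarrow> l) (at_left (a + t))"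
  shows "((\<lambda>u. f (a + u)) \<longlongrightarrow> l) (at_left t)"
proof -
  have "((\<lambda>u. f (- (- a + u))) \<longlongrightarrow> l) (at_right (- t))"
    by (rule tendsto_shift_at_right[where f="\<lambda>x. f (- x)"])
      (use assms in \<open>simp add: filterlim_at_left_to_right\<close>)
  then show ?thesis
    by (simp add: filterlim_at_left_to_right)
qed

lemma increments_from_in_path_space:
  assumes "w \<in> space path_space" "0 \<le> a"
  shows "increments_from a w \<in> space path_space"
  unfolding increments_from_def
proof (rule restrict_in_path_space)
  show "((\<lambda>u. w (a + u) - w a) \<longlongrightarrow> w (a + t) - w a) (at_right t)" if "0 \<le> t" for t
    using assms that by (intro tendsto_diff tendsto_const tendsto_shift_at_right path_right_cont) auto
  show "\<exists>l. ((\<lambda>u. w (a + u) - w a) \<longlongrightarrow> l) (at_left t)" if t: "0 < t" for t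
  proof -
    obtain l where "(w \<longlongrightarrow> l) (at_left (a + t))"
      using path_left_limit[OF assms(1), of "a + t"] assms(2) t by auto
    from tendsto_diff[OF tendsto_shift_at_left[OF this] tendsto_const] show ?thesis
      by blast
  qed
qed

lemma stopped_path_in_path_space:
  assumes w: "w \<in> space path_space" and q: "0 \<le> q"
  shows "stopped_path q w \<in> space path_space"
  unfolding stopped_path_def
proof (rule restrict_in_path_space)
  show "((\<lambda>u. w (min u q)) \<longlongrightarrow> w (min t q)) (at_right t)" if t: "0 \<le> t" for t
  proof (cases "t < q")
    case True
    then have "\<forall>\<^sub>F u in at_right t. w (min u q) = w u"
      unfolding eventually_at_right_field by (intro exI[of _ q]) (auto simp: min_def)
    then show ?thesis
      using path_right_cont[OF w t] True by (simp add: tendsto_cong)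
  next
    case False
    then have "\<forall>\<^sub>F u in at_right t. w (min u q) = w (min t q)"
      unfolding eventually_at_right_field by (intro exI[of _ "t + 1"]) (auto simp: min_def)
    then show ?thesis
      by (rule tendsto_eventually)
  qed
  show "\<exists>l. ((\<lambda>u. w (min u q)) \<longlongrightarrow> l) (at_left t)" if t: "0 < t" for t
  proof (cases "t \<le> q")
    case True
    then have "\<forall>\<^sub>F u in at_left t. w (min u q) = w u"
      unfolding eventually_at_left_field by (intro exI[of _ "t - 1"]) (auto simp: min_def)
    moreover obtain l where "(w \<longlongrightarrow> l) (at_left t)"
      using path_left_limit[OF w t] .
    ultimately have "((\<lambda>u. w (min u q)) \<longlongrightarrow> l) (at_left t)"
      by (simp add: tendsto_cong)
    then show ?thesis ..
  next
    case False
    then have "\<forall>\<^sub>F u in at_left t. w (min u q) = w q"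
      unfolding eventually_at_left_field by (intro exI[of _ q]) (auto simp: min_def)
    from tendsto_eventually[OF this] show ?thesis ..
  qed
qed

lemma measurable_eval_filtration: "0 \<le> u \<Longrightarrow> u \<le> s \<Longrightarrow> (\<lambda>w. w u) \<in> borel_measurable (path_filtration s)"
  by (rule measurable_natural_filtration) (auto intro: ennreal_leI)

lemma sets_path_filtration_subset: "sets (path_filtration s) \<subseteq> sets path_space"
  by (intro sets_natural_filtration_subset) auto

lemma sets_path_filtration_mono: "s \<le> s' \<Longrightarrow> sets (path_filtration s) \<subseteq> sets (path_filtration s')"
  by (intro natural_filtration_mono) (auto intro: ennreal_leI)

lemma measurable_into_path_filtration:
  assumes s: "0 \<le> s" and f: "\<And>u. 0 \<le> u \<Longrightarrow> u \<le> s \<Longrightarrow> (\<lambda>x. f x u) \<in> borel_measurable N"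
    and sp: "\<And>x. x \<in> space N \<Longrightarrow> f x \<in> space path_space"
  shows "f \<in> measurable N (path_filtration s)"
  unfolding natural_filtration_def
proof (rule measurable_vimage_algebra2)
  show "(\<lambda>x. \<lambda>u\<in>{u. 0 \<le> u \<and> ennreal u \<le> ennreal s}. f x u)
      \<in> measurable N (\<Pi>\<^sub>M u\<in>{u. 0 \<le> u \<and> ennreal u \<le> ennreal s}. borel)"
    using s f by (intro measurable_restrict) auto
qed (use sp in auto)

lemma measurable_translate: "translate z \<in> measurable path_space path_space"
  by (rule measurable_path_spaceI) (auto simp: translate_in_path_space)

lemma measurable_translate_filtration:
  "0 \<le> s \<Longrightarrow> translate z \<in> measurable (path_filtration s) (path_filtration s)"
  by (rule measurable_into_path_filtration)
    (auto simp: translate_in_path_space intro!: borel_measurable_add measurable_eval_filtration)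

lemma measurable_translate_pair:
  "(\<lambda>(z, w). translate z w) \<in> measurable (borel \<Otimes>\<^sub>M path_space) path_space"
  by (rule measurable_path_spaceI)
    (auto simp: translate_in_path_space space_pair_measure split_beta' intro!: borel_measurable_add)

text \<open>An event that is not affected by stopping the path at \<open>q\<close> is the preimage of itself under
  \<open>stopped_path q\<close>, hence belongs to the past of \<open>q\<close>.\<close>

lemma measurable_stopped_path:
  "0 \<le> q \<Longrightarrow> stopped_path q \<in> measurable (path_filtration q) path_space"
  by (rule measurable_path_spaceI)
    (auto simp: stopped_path_in_path_space intro!: measurable_eval_filtration)

lemma measurable_path_at:
  assumes "\<tau> \<in> borel_measurable path_space" "\<And>w. w \<in> space path_space \<Longrightarrow> 0 \<le> \<tau> w"
  shows "(\<lambda>w. w (\<tau> w)) \<in> borel_measurable path_space"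
  by (rule measurable_random_time[where Y="\<lambda>t w. w t" and \<tau>=\<tau>])
    (use assms in \<open>auto intro: path_right_cont\<close>)

lemma measurable_increments_from:
  assumes "\<tau> \<in> borel_measurable path_space" "\<And>w. w \<in> space path_space \<Longrightarrow> 0 \<le> \<tau> w"
  shows "(\<lambda>w. increments_from (\<tau> w) w) \<in> measurable path_space path_space"
proof (rule measurable_path_spaceI)
  show "increments_from (\<tau> w) w \<in> space path_space" if "w \<in> space path_space" for w
    using that assms(2) by (intro increments_from_in_path_space) auto
  show "(\<lambda>w. increments_from (\<tau> w) w u) \<in> borel_measurable path_space" if "0 \<le> u" for u
    using borel_measurable_diff[OF measurable_path_at[of "\<lambda>w. \<tau> w + u"] measurable_path_at[of \<tau>]] that assms
    by (simp add: borel_measurable_add)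
qed

section \<open>Independent stationary increments determine the law of a path\<close>

lemma measurable_increment: "0 \<le> s \<Longrightarrow> 0 \<le> t \<Longrightarrow> (\<lambda>w. w (s + t) - w s) \<in> borel_measurable path_space"
  by (intro borel_measurable_diff measurable_eval) auto

lemma sets_increment:
  assumes "0 \<le> s" "0 \<le> t" "C \<in> sets borel"
  shows "{w\<in>space path_space. w (s + t) - w s \<in> C} \<in> sets path_space"
  using measurable_sets[OF measurable_increment[OF assms(1,2)] assms(3)]
  by (simp add: vimage_def Int_def conj_commute)

text \<open>Both sides scale with \<open>Q\<close>, so the notion also makes sense for laws
  restricted to an event, without normalisation.\<close>

definition independent_increments ::
    "(real \<Rightarrow> (real \<times> real) measure) \<Rightarrow> (real \<Rightarrow> real \<times> real) measure \<Rightarrow> bool" where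
  "independent_increments m Q \<longleftrightarrow>
     (\<forall>s\<ge>0. \<forall>t\<ge>0. \<forall>A\<in>sets (path_filtration s). \<forall>C\<in>sets borel.
       emeasure Q (A \<inter> {w\<in>space path_space. w (s + t) - w s \<in> C}) = emeasure Q A * emeasure (m t) C)"

lemma measurable_restrict_path: "J \<subseteq> {0..} \<Longrightarrow> (\<lambda>w. restrict w J) \<in> measurable path_space (\<Pi>\<^sub>M i\<in>J. borel)"
  by (intro measurable_restrict) auto

text \<open>s is the latest of the times in J, so the value at t is the value at s plus an increment
  independent of all coordinates in J; the joint law is the image of a product measure.\<close>

lemma finite_laws_step:
  assumes Q: "finite_measure Q" "sets Q = sets path_space" "independent_increments m Q"
    and m: "\<And>t. 0 \<le> t \<Longrightarrow> prob_space (m t)" "\<And>t. 0 \<le> t \<Longrightarrow> sets (m t) = sets borel"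
    and J: "J \<subseteq> {0..s}" "s \<in> J" and t: "s < t"
  shows "distr Q (\<Pi>\<^sub>M i\<in>insert t J. borel) (\<lambda>w. restrict w (insert t J)) =
    distr (distr Q (\<Pi>\<^sub>M i\<in>J. borel) (\<lambda>w. restrict w J) \<Otimes>\<^sub>M m (t - s)) (\<Pi>\<^sub>M i\<in>insert t J. borel)
      (\<lambda>(g, y). \<lambda>i\<in>insert t J. if i = t then g s + y else g i)"
proof -
  let ?r = "\<lambda>w. restrict w J" and ?PJ = "\<Pi>\<^sub>M i\<in>J. (borel :: (real \<times> real) measure)"
  have s: "0 \<le> s"
    using J by auto
  have spQ: "space Q = space path_space"
    by (rule sets_eq_imp_space_eq[OF Q(2)])
  have measQ: "measurable Q L = measurable path_space L" for L :: "'b measure"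
    using Q(2) by (rule measurable_cong_sets) simp
  have r: "?r \<in> measurable path_space ?PJ"
    using J by (intro measurable_restrict_path) auto
  have r': "?r \<in> measurable (path_filtration s) ?PJ"
    using J by (intro measurable_restrict measurable_eval_filtration) auto
  have incr: "(\<lambda>w. w t - w s) \<in> borel_measurable path_space"
    using s t by (intro borel_measurable_diff measurable_eval) auto
  have pair: "(\<lambda>w. (?r w, w t - w s)) \<in> measurable path_space (?PJ \<Otimes>\<^sub>M borel)"
    using r incr by (rule measurable_Pair)
  interpret mt: prob_space "m (t - s)"
    using m(1) t by simp
  interpret D: finite_measure "distr Q ?PJ ?r"
    using Q(1) r by (intro finite_measure.finite_measure_distr) (simp_all add: measQ)
  have indep: "distr Q ?PJ ?r \<Otimes>\<^sub>M m (t - s) = distr Q (?PJ \<Otimes>\<^sub>M borel) (\<lambda>w. (?r w, w t - w s))"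
  proof (rule pair_measure_eqI)
    show "sets (distr Q ?PJ ?r \<Otimes>\<^sub>M m (t - s)) = sets (distr Q (?PJ \<Otimes>\<^sub>M borel) (\<lambda>w. (?r w, w t - w s)))"
      using m(2)[of "t - s"] t by (simp cong: sets_pair_measure_cong)
    fix A C assume A: "A \<in> sets (distr Q ?PJ ?r)" and C: "C \<in> sets (m (t - s))"
    have A': "?r -` A \<inter> space path_space \<in> sets (path_filtration s)"
      using measurable_sets[OF r', of A] A by simp
    have C': "C \<in> sets borel"
      using C m(2)[of "t - s"] t by simp
    have "emeasure (distr Q (?PJ \<Otimes>\<^sub>M borel) (\<lambda>w. (?r w, w t - w s))) (A \<times> C) =
        emeasure Q ((?r -` A \<inter> space path_space) \<inter> {w\<in>space path_space. w (s + (t - s)) - w s \<in> C})"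
      using pair A C' by (subst emeasure_distr) (auto simp: measQ spQ intro!: arg_cong[where f="emeasure Q"])
    also have "\<dots> = emeasure Q (?r -` A \<inter> space path_space) * emeasure (m (t - s)) C"
      using Q(3)[unfolded independent_increments_def, rule_format, of s "t - s", OF _ _ A' C'] s t by auto
    also have "emeasure Q (?r -` A \<inter> space path_space) = emeasure (distr Q ?PJ ?r) A"
      using A r by (subst emeasure_distr) (simp_all add: measQ spQ)
    finally show "emeasure (distr Q ?PJ ?r) A * emeasure (m (t - s)) C =
      emeasure (distr Q (?PJ \<Otimes>\<^sub>M borel) (\<lambda>w. (?r w, w t - w s))) (A \<times> C)" ..
  qed unfold_locales
  have glue: "(\<lambda>(g, y). \<lambda>i\<in>insert t J. if i = t then g s + y else g i)
      \<in> measurable (?PJ \<Otimes>\<^sub>M borel) (\<Pi>\<^sub>M i\<in>insert t J. borel)"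
    unfolding split_beta'
  proof (rule measurable_restrict)
    fix i assume i: "i \<in> insert t J"
    show "(\<lambda>x. if i = t then fst x s + snd x else fst x i) \<in> borel_measurable (?PJ \<Otimes>\<^sub>M borel)"
      using i J(2) by (cases "i = t") (auto intro!: borel_measurable_add measurable_compose[OF measurable_fst] measurable_component_singleton)
  qed
  have "distr (distr Q (?PJ \<Otimes>\<^sub>M borel) (\<lambda>w. (?r w, w t - w s))) (\<Pi>\<^sub>M i\<in>insert t J. borel)
      (\<lambda>(g, y). \<lambda>i\<in>insert t J. if i = t then g s + y else g i) =
    distr Q (\<Pi>\<^sub>M i\<in>insert t J. borel)
      ((\<lambda>(g, y). \<lambda>i\<in>insert t J. if i = t then g s + y else g i) \<circ> (\<lambda>w. (?r w, w t - w s)))"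
    using glue pair by (intro distr_distr) (simp_all add: measQ)
  also have "(\<lambda>(g, y). \<lambda>i\<in>insert t J. if i = t then g s + y else g i) \<circ> (\<lambda>w :: real \<Rightarrow> real \<times> real. (?r w, w t - w s))
      = (\<lambda>w. restrict w (insert t J))"
    using J(2) by (auto simp: fun_eq_iff add_diff_eq)
  finally show ?thesis
    unfolding indep ..
qed

text \<open>Times are added in increasing order. Time 0 is always among them, so that every new time
  has a predecessor and the base case is the law of the starting point.\<close>

lemma finite_laws_unique:
  assumes Q: "finite_measure Q" "sets Q = sets path_space" "independent_increments m Q"
    and R: "finite_measure R" "sets R = sets path_space" "independent_increments m R"
    and m: "\<And>t. 0 \<le> t \<Longrightarrow> prob_space (m t)" "\<And>t. 0 \<le> t \<Longrightarrow> sets (m t) = sets borel"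
    and start: "distr Q borel (\<lambda>w. w 0) = distr R borel (\<lambda>w. w 0)"
    and J: "finite J" "J \<subseteq> {0..}"
  shows "distr Q (\<Pi>\<^sub>M i\<in>insert 0 J. borel) (\<lambda>w. restrict w (insert 0 J)) =
    distr R (\<Pi>\<^sub>M i\<in>insert 0 J. borel) (\<lambda>w. restrict w (insert 0 J))"
  using J
proof (induction J rule: finite_linorder_max_induct)
  case empty
  have law0: "distr L (\<Pi>\<^sub>M i\<in>{0}. borel) (\<lambda>w. restrict w {0}) =
      distr (distr L borel (\<lambda>w. w 0)) (\<Pi>\<^sub>M i\<in>{0}. borel) (\<lambda>y. \<lambda>i\<in>{0}. y)"
    if "sets L = sets path_space" for L :: "(real \<Rightarrow> real \<times> real) measure"
  proof -
    have "(\<lambda>w. w 0) \<in> borel_measurable L"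
      using measurable_eval[of 0] that by (simp cong: measurable_cong_sets)
    then have "distr (distr L borel (\<lambda>w. w 0)) (\<Pi>\<^sub>M i\<in>{0}. borel) (\<lambda>y. \<lambda>i\<in>{0}. y) =
        distr L (\<Pi>\<^sub>M i\<in>{0}. borel) ((\<lambda>y. \<lambda>i\<in>{0}. y) \<circ> (\<lambda>w. w 0))"
      by (intro distr_distr measurable_restrict) auto
    also have "(\<lambda>y. \<lambda>i\<in>{0}. y) \<circ> (\<lambda>w. w 0) = (\<lambda>w. restrict w {0 :: real})"
      by (auto simp: fun_eq_iff)
    finally show ?thesis ..
  qed
  show ?case
    by (simp only: law0[OF Q(2)] law0[OF R(2)] start)
next
  case (insert t A)
  show ?case
  proof (cases "t = 0")
    case True
    then have "A = {}"
      using insert.prems insert.hyps by fastforce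
    then show ?thesis
      using True insert.IH by simp
  next
    case False
    define s where "s = Max (insert 0 A)"
    have s: "s \<in> insert 0 A" "insert 0 A \<subseteq> {0..s}"
    proof -
      have fin: "finite (insert 0 A)"
        using insert.hyps(1) by simp
      then show "s \<in> insert 0 A"
        unfolding s_def by (rule Max_in) simp
      show "insert 0 A \<subseteq> {0..s}"
        using insert.prems Max_ge[OF fin] by (auto simp: s_def simp del: Max_insert)
    qed
    have st: "s < t"
      using s(1) False insert.prems insert.hyps(2) by auto
    have "distr Q (\<Pi>\<^sub>M i\<in>insert 0 A. borel) (\<lambda>w. restrict w (insert 0 A)) =
        distr R (\<Pi>\<^sub>M i\<in>insert 0 A. borel) (\<lambda>w. restrict w (insert 0 A))"
      using insert.prems by (intro insert.IH) auto
    then show ?thesis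
      by (simp only: insert_commute[of 0 t] finite_laws_step[OF Q m s(2,1) st] finite_laws_step[OF R m s(2,1) st])
  qed
qed

text \<open>Cylinder sets determine a finite measure on the full product. Cadlag paths need not form
  a measurable subset of it, so both laws are pushed forward under the inclusion; the sets of
  \<open>path_space\<close> are traces of product sets.\<close>

lemma independent_increments_unique:
  assumes Q: "finite_measure Q" "sets Q = sets path_space" "independent_increments m Q"
    and R: "finite_measure R" "sets R = sets path_space" "independent_increments m R"
    and m: "\<And>t. 0 \<le> t \<Longrightarrow> prob_space (m t)" "\<And>t. 0 \<le> t \<Longrightarrow> sets (m t) = sets borel"
    and start: "distr Q borel (\<lambda>w. w 0) = distr R borel (\<lambda>w. w 0)"
  shows "Q = R"
proof -
  let ?PI = "\<Pi>\<^sub>M i\<in>{0::real..}. (borel :: (real \<times> real) measure)"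
  have incl: "(\<lambda>w. w) \<in> measurable L ?PI" if "sets L = sets path_space" for L
    using measurable_restrict_space1[OF measurable_ident, of ?PI] that
    by (simp add: path_space_def id_def cong: measurable_cong_sets)
  have emb: "emeasure (distr L ?PI (\<lambda>w. w)) (prod_emb {0..} (\<lambda>_. borel) J (Pi\<^sub>E J A)) =
      emeasure (distr L (\<Pi>\<^sub>M i\<in>insert 0 J. borel) (\<lambda>w. restrict w (insert 0 J)))
        (prod_emb (insert 0 J) (\<lambda>_. borel) J (Pi\<^sub>E J A))"
    if L: "sets L = sets path_space" and J: "finite J" "J \<subseteq> {0..}"
      and A: "\<And>i. i \<in> J \<Longrightarrow> A i \<in> sets borel" for L J A
  proof -
    have sp: "space L = space path_space"
      by (rule sets_eq_imp_space_eq[OF L])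
    have r: "(\<lambda>w. restrict w (insert 0 J)) \<in> measurable L (\<Pi>\<^sub>M i\<in>insert 0 J. borel)"
      using measurable_restrict_path[of "insert 0 J"] J(2) L by (simp cong: measurable_cong_sets)
    have "prod_emb {0..} (\<lambda>_. borel) J (Pi\<^sub>E J A) \<in> sets ?PI"
      using J A by (intro sets_PiM_I) auto
    then have "emeasure (distr L ?PI (\<lambda>w. w)) (prod_emb {0..} (\<lambda>_. borel) J (Pi\<^sub>E J A)) =
        emeasure L (prod_emb {0..} (\<lambda>_. borel) J (Pi\<^sub>E J A) \<inter> space L)"
      using incl[OF L] by (simp add: emeasure_distr)
    also have "prod_emb {0..} (\<lambda>_. borel) J (Pi\<^sub>E J A) \<inter> space L =
        (\<lambda>w. restrict w (insert 0 J)) -` prod_emb (insert 0 J) (\<lambda>_. borel) J (Pi\<^sub>E J A) \<inter> space L"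
    proof -
      have "restrict (restrict w (insert 0 J)) J = restrict w J" for w :: "real \<Rightarrow> real \<times> real"
        by (auto simp: restrict_def fun_eq_iff)
      then show ?thesis
        by (auto simp: prod_emb_def sp space_path_space PiE_def)
    qed
    also have "emeasure L \<dots> = emeasure (distr L (\<Pi>\<^sub>M i\<in>insert 0 J. borel) (\<lambda>w. restrict w (insert 0 J)))
        (prod_emb (insert 0 J) (\<lambda>_. borel) J (Pi\<^sub>E J A))"
    proof (rule emeasure_distr[OF r, symmetric])
      show "prod_emb (insert 0 J) (\<lambda>_. borel) J (Pi\<^sub>E J A) \<in> sets (\<Pi>\<^sub>M i\<in>insert 0 J. borel)"
        using J A by (intro sets_PiM_I) auto
    qed
    finally show ?thesis .
  qed
  have "distr Q ?PI (\<lambda>w. w) = distr R ?PI (\<lambda>w. w)"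
  proof (rule measure_eqI_PiM_infinite)
    show "finite_measure (distr Q ?PI (\<lambda>w. w))"
      using Q(1) incl[OF Q(2)] by (rule finite_measure.finite_measure_distr)
    fix A :: "real \<Rightarrow> (real \<times> real) set" and J :: "real set" assume "finite J" "J \<subseteq> {0..}" "\<And>i. i \<in> J \<Longrightarrow> A i \<in> sets borel"
    then show "emeasure (distr Q ?PI (\<lambda>w. w)) (prod_emb {0..} (\<lambda>_. borel) J (Pi\<^sub>E J A)) =
        emeasure (distr R ?PI (\<lambda>w. w)) (prod_emb {0..} (\<lambda>_. borel) J (Pi\<^sub>E J A))"
      using emb[OF Q(2)] emb[OF R(2)] finite_laws_unique[OF Q R m start] by simp
  qed simp_all
  note eq = this
  show ?thesis
  proof (rule measure_eqI)
    fix B assume "B \<in> sets Q"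
    then obtain B' where B': "B' \<in> sets ?PI" "B = B' \<inter> space path_space"
    proof -
      from \<open>B \<in> sets Q\<close> obtain B' where "B' \<in> sets ?PI" "B = Collect (cadlag UNIV) \<inter> B'"
        unfolding Q(2) path_space_def sets_restrict_space by blast
      then show ?thesis
        using sets.sets_into_space[of B' ?PI]
        by (intro that[of B']) (auto simp: space_path_space space_PiM PiE_def)
    qed
    have "emeasure L B = emeasure (distr L ?PI (\<lambda>w. w)) B'" if "sets L = sets path_space" for L
      using B' incl[OF that] sets_eq_imp_space_eq[OF that] by (simp add: emeasure_distr)
    then show "emeasure Q B = emeasure R B"
      using eq Q(2) R(2) by simp
  qed (use Q R in simp)
qed

lemma measure_eqI_rectangles:
  assumes M: "finite_measure M" "sets M = sets (M1 \<Otimes>\<^sub>M M2)" and N: "sets N = sets (M1 \<Otimes>\<^sub>M M2)"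
    and eq: "\<And>A B. A \<in> sets M1 \<Longrightarrow> B \<in> sets M2 \<Longrightarrow> emeasure M (A \<times> B) = emeasure N (A \<times> B)"
  shows "M = N"
proof (rule measure_eqI_generator_eq[OF Int_stable_pair_measure_generator[of M1 M2],
      where \<Omega>="space M1 \<times> space M2" and A="\<lambda>_. space M1 \<times> space M2"])
  show "{a \<times> b |a b. a \<in> sets M1 \<and> b \<in> sets M2} \<subseteq> Pow (space M1 \<times> space M2)"
    using sets.space_closed[of M1] sets.space_closed[of M2] by auto
  show "emeasure M X = emeasure N X" if "X \<in> {a \<times> b |a b. a \<in> sets M1 \<and> b \<in> sets M2}" for X
    using that eq by auto
  show "emeasure M (space M1 \<times> space M2) \<noteq> \<infinity>"
    using finite_measure.emeasure_finite[OF M(1)] by simp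
qed (use M(2) N in \<open>auto simp: sets_pair_measure\<close>)

lemma emeasure_density_indicator_vimage:
  assumes "A \<in> sets N" "f \<in> measurable N K" "B \<in> sets K"
  shows "emeasure (distr (density N (indicator A)) K f) B = emeasure N (A \<inter> (f -` B \<inter> space N))"
  using assms measurable_sets[OF assms(2,3)] by (subst emeasure_distr) (simp_all add: emeasure_restricted)

text \<open>A form of Galmarino's test: an event of the filtration is a preimage under the
  restriction of the process to times up to t, so it cannot separate points with equal
  restrictions.\<close>

lemma natural_filtration_agree:
  assumes A: "A \<in> sets (natural_filtration M S X t)"
    and X: "\<And>u. 0 \<le> u \<Longrightarrow> ennreal u \<le> t \<Longrightarrow> X u \<in> measurable M S"
    and w: "w \<in> space M" "w' \<in> space M"
    and eq: "\<And>u. 0 \<le> u \<Longrightarrow> ennreal u \<le> t \<Longrightarrow> X u w = X u w'"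
  shows "w \<in> A \<longleftrightarrow> w' \<in> A"
proof -
  let ?I = "{u. 0 \<le> u \<and> ennreal u \<le> t}"
  have "(\<lambda>w. \<lambda>u\<in>?I. X u w) \<in> space M \<rightarrow> space (\<Pi>\<^sub>M u\<in>?I. S)"
    using measurable_space[OF X] by (auto simp: space_PiM)
  then obtain B where "A = (\<lambda>w. \<lambda>u\<in>?I. X u w) -` B \<inter> space M"
    using A unfolding natural_filtration_def by (subst (asm) sets_vimage_algebra2) auto
  moreover have "(\<lambda>u\<in>?I. X u w) = (\<lambda>u\<in>?I. X u w')"
    using eq by (auto simp: fun_eq_iff)
  ultimately show ?thesis
    using w by simp
qed

text \<open>Restricted to A, the increment has law \<open>m t\<close> scaled by the mass of A;
  integrating g against both descriptions gives the product.\<close>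

lemma set_nn_integral_increment:
  assumes Q: "sets Q = sets path_space" "independent_increments m Q"
    and m: "sets (m t) = sets borel" and st: "0 \<le> s" "0 \<le> t" and A: "A \<in> sets (path_filtration s)"
    and g: "g \<in> borel_measurable borel"
  shows "(\<integral>\<^sup>+w\<in>A. g (w (s + t) - w s) \<partial>Q) = emeasure Q A * (\<integral>\<^sup>+y. g y \<partial>m t)"
proof -
  let ?d = "\<lambda>w :: real \<Rightarrow> real \<times> real. w (s + t) - w s"
  have A': "A \<in> sets Q"
    using A sets_path_filtration_subset Q(1) by blast
  have d: "?d \<in> borel_measurable Q"
    using st Q(1) by (auto cong: measurable_cong_sets intro!: borel_measurable_diff measurable_eval)
  have "distr (density Q (indicator A)) borel ?d = scale_measure (emeasure Q A) (m t)"
  proof (rule measure_eqI)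
    fix C assume "C \<in> sets (distr (density Q (indicator A)) borel ?d)"
    then have C: "C \<in> sets borel"
      by simp
    have "A \<inter> (?d -` C \<inter> space Q) = A \<inter> {w\<in>space path_space. ?d w \<in> C}"
      using sets_eq_imp_space_eq[OF Q(1)] by auto
    then show "emeasure (distr (density Q (indicator A)) borel ?d) C = emeasure (scale_measure (emeasure Q A) (m t)) C"
      using A' d C Q(2) A st
      by (simp add: emeasure_density_indicator_vimage independent_increments_def)
  qed (use m in simp)
  from arg_cong[where f="\<lambda>L. \<integral>\<^sup>+y. g y \<partial>L", OF this] show ?thesis
    using A' d g m by (simp add: nn_integral_distr set_nn_integral_eq_density nn_integral_scale_measure cong: measurable_cong_sets)
qed

section \<open>Drift and subordinator\<close>

locale drift_subordinator =
  fixes \<phi> :: "real \<Rightarrow> real" and \<mu> :: "real \<Rightarrow> real measure"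
    and P :: "real \<times> real \<Rightarrow> (real \<Rightarrow> real \<times> real) measure"
  assumes laws: "subordinator_laws \<phi> \<mu>"
    and canonical: "canonical_process_laws (drift_subordinator_semigroup \<mu>) P"
    and exponent_at_top: "filterlim \<phi> at_top at_top"
begin

definition m :: "real \<Rightarrow> (real \<times> real) measure" where
  "m t = return borel t \<Otimes>\<^sub>M \<mu> t"

lemma prob_space_\<mu>: "0 \<le> t \<Longrightarrow> prob_space (\<mu> t)" and sets_\<mu>: "0 \<le> t \<Longrightarrow> sets (\<mu> t) = sets borel"
  and AE_\<mu>: "0 \<le> t \<Longrightarrow> AE w in \<mu> t. 0 \<le> w"
  and laplace_\<mu>: "0 \<le> t \<Longrightarrow> 0 \<le> l \<Longrightarrow> (\<integral>w. exp (- l * w) \<partial>\<mu> t) = exp (- t * \<phi> l)"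
  using laws by (auto simp: subordinator_laws_def)

lemma sets_m: "0 \<le> t \<Longrightarrow> sets (m t) = sets borel"
  unfolding m_def borel_prod[symmetric] by (intro sets_pair_measure_cong sets_return sets_\<mu>)

lemma space_m: "0 \<le> t \<Longrightarrow> space (m t) = UNIV"
  using sets_eq_imp_space_eq[OF sets_m] by simp

lemma prob_space_m:
  assumes "0 \<le> t"
  shows "prob_space (m t)"
proof -
  interpret prob_space "\<mu> t"
    using assms by (rule prob_space_\<mu>)
  interpret d: prob_space "return borel t"
    by (rule prob_space_return) simp
  interpret pair_prob_space "return borel t" "\<mu> t" ..
  show ?thesis
    unfolding m_def by unfold_locales
qed

lemma prob_space_P: "prob_space (P z)" and sets_P: "sets (P z) = sets path_space"
  and P_start: "AE w in P z. w 0 = z"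
  using canonical unfolding canonical_process_laws_def by blast+

lemma space_P: "space (P z) = space path_space"
  by (rule sets_eq_imp_space_eq[OF sets_P])

lemma measurable_P: "measurable (P z) L = measurable path_space L"
  by (rule measurable_cong_sets[OF sets_P refl])

lemma finite_measure_P: "finite_measure (P z)"
  using prob_space_P by (rule prob_space.axioms)

text \<open>The unnormalised restriction of the law to an event turns identities on A into
  equalities of finite measures, to which the uniqueness lemmas apply.\<close>

abbreviation P_on :: "real \<times> real \<Rightarrow> (real \<Rightarrow> real \<times> real) set \<Rightarrow> (real \<Rightarrow> real \<times> real) measure" where
  "P_on z A \<equiv> density (P z) (indicator A)"

lemma measurable_P_on: "measurable (P_on z A) L = measurable path_space L"
  by (intro measurable_cong_sets) (simp_all add: sets_P)

lemma finite_measure_P_on: "A \<in> sets path_space \<Longrightarrow> finite_measure (P_on z A)"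
  by (intro finite_measure_density_indicator finite_measure_P) (simp add: sets_P)

lemma finite_measure_distr_P_on:
  "A \<in> sets path_space \<Longrightarrow> f \<in> measurable path_space K \<Longrightarrow> finite_measure (distr (P_on z A) K f)"
  by (intro finite_measure.finite_measure_distr finite_measure_P_on) (simp_all add: measurable_P_on)

lemma emeasure_distr_P_on:
  assumes "A \<in> sets path_space" "f \<in> measurable path_space K" "B \<in> sets K"
  shows "emeasure (distr (P_on z A) K f) B = emeasure (P z) (A \<inter> (f -` B \<inter> space path_space))"
  using emeasure_density_indicator_vimage[of A "P z" f K B] assms by (simp add: sets_P measurable_P space_P)

lemma nn_integral_P_on:
  assumes "A \<in> sets path_space" "f \<in> borel_measurable path_space"
  shows "(\<integral>\<^sup>+w. f w \<partial>P_on z A) = (\<integral>\<^sup>+w\<in>A. f w \<partial>P z)"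
  using assms by (intro set_nn_integral_eq_density) (simp_all add: sets_P measurable_P)

section \<open>From the semigroup to independent increments\<close>

lemma measurable_add_m: "0 \<le> t \<Longrightarrow> (\<lambda>y. z + y) \<in> borel_measurable (m t)"
  by (simp add: sets_m cong: measurable_cong_sets)

text \<open>The assumed conditional expectation, integrated over A. Since bumps take values in
  [0, 1], the Bochner integrals can be rewritten as nonnegative ones.\<close>

lemma transition_bump:
  assumes st: "0 \<le> s" "0 \<le> t" and A: "A \<in> sets (path_filtration s)" and f: "f \<in> bump"
  shows "(\<integral>\<^sup>+w\<in>A. f (w (s + t)) \<partial>P z) = (\<integral>\<^sup>+w\<in>A. (\<integral>\<^sup>+y. f (w s + y) \<partial>m t) \<partial>P z)"
proof -
  define g where "g y = (\<integral>x. f (y + x) \<partial>m t)" for y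
  interpret prob_space "P z"
    by (rule prob_space_P)
  interpret mt: prob_space "m t"
    using st(2) by (rule prob_space_m)
  interpret finite_measure_subalgebra "P z" "path_filtration s"
    using sets_path_filtration_subset by unfold_locales (simp add: subalgebra_def space_P sets_P)
  have A': "A \<in> sets (P z)"
    using A sets_path_filtration_subset by (auto simp: sets_P)
  have f_meas: "f \<in> borel_measurable borel"
    using f by (rule bump_measurable)
  have f_add: "(\<lambda>x. f (y + x)) \<in> borel_measurable (m t)" for y
    using measurable_add_m[OF st(2)] f_meas by (rule measurable_compose)
  have f_int: "integrable (m t) (\<lambda>x. f (y + x))" for y
    using f_add bump_bounds[OF f] by (intro mt.integrable_const_bound[where B=1]) auto
  have g_bounds: "0 \<le> g y" "g y \<le> 1" for y
    unfolding g_def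
    by (intro integral_nonneg_AE mt.integral_le_const f_int AE_I2 bump_bounds[OF f])+
  have g_nn: "(\<integral>\<^sup>+x. f (y + x) \<partial>m t) = ennreal (g y)" for y
    unfolding g_def using bump_bounds(1)[OF f] f_int by (intro nn_integral_eq_integral) auto
  have g_meas: "g \<in> borel_measurable borel"
    unfolding g_def
  proof (rule mt.borel_measurable_lebesgue_integral)
    have "(\<lambda>p. fst p + snd p) \<in> borel_measurable (borel \<Otimes>\<^sub>M m t)"
      using sets_m[OF st(2)] by (auto cong: measurable_cong_sets sets_pair_measure_cong intro!: borel_measurable_add)
    then show "(\<lambda>(y, x). f (y + x)) \<in> borel_measurable (borel \<Otimes>\<^sub>M m t)"
      unfolding split_beta' by (rule measurable_compose[OF _ f_meas])
  qed
  have semigroup: "drift_subordinator_semigroup \<mu> t f y = g y" for y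
    unfolding drift_subordinator_semigroup_def g_def m_def
    by (cases y) (auto intro!: Bochner_Integration.integral_cong)
  have ev: "(\<lambda>w. w u) \<in> borel_measurable (P z)" if "0 \<le> u" for u
    using that by (simp add: measurable_P)
  have int_f: "integrable (P z) (\<lambda>w. f (w (s + t)))"
    using measurable_compose[OF ev f_meas] st bump_bounds[OF f] by (intro integrable_const_bound[where B=1]) auto
  have "AE w in P z. real_cond_exp (P z) (path_filtration s) (\<lambda>w. f (w (s + t))) w = g (w s)"
    using canonical st f bump_C_0 unfolding canonical_process_laws_def semigroup[symmetric] by blast
  then have "(\<integral>w\<in>A. real_cond_exp (P z) (path_filtration s) (\<lambda>w. f (w (s + t))) w \<partial>P z) = (\<integral>w\<in>A. g (w s) \<partial>P z)"
    unfolding set_lebesgue_integral_def using A' measurable_compose[OF ev g_meas] st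
    by (intro integral_cong_AE) (auto intro!: borel_measurable_times elim!: eventually_mono)
  then have eq: "(\<integral>w\<in>A. f (w (s + t)) \<partial>P z) = (\<integral>w\<in>A. g (w s) \<partial>P z)"
    using real_cond_exp_intA[OF int_f A] by simp
  have nn: "(\<integral>\<^sup>+w\<in>A. ennreal (k (w u)) \<partial>P z) = ennreal (\<integral>w\<in>A. k (w u) \<partial>P z)"
    if k: "k \<in> borel_measurable borel" "\<And>y. 0 \<le> k y" "\<And>y. k y \<le> 1" and u: "0 \<le> u" for k :: "real \<times> real \<Rightarrow> real" and u
  proof -
    have "(\<integral>\<^sup>+w\<in>A. ennreal (k (w u)) \<partial>P z) = (\<integral>\<^sup>+w. ennreal (indicator A w *\<^sub>R k (w u)) \<partial>P z)"
      by (intro nn_integral_cong) (auto split: split_indicator)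
    also have "\<dots> = ennreal (\<integral>w. indicator A w *\<^sub>R k (w u) \<partial>P z)"
    proof (intro nn_integral_eq_integral integrable_const_bound[where B=1])
      show "(\<lambda>w. indicator A w *\<^sub>R k (w u)) \<in> borel_measurable (P z)"
        using A' measurable_compose[OF ev[OF u] k(1)] by (intro borel_measurable_scaleR) auto
    qed (use k in \<open>auto split: split_indicator\<close>)
    finally show ?thesis
      by (simp add: set_lebesgue_integral_def)
  qed
  show ?thesis
    unfolding g_nn using eq nn[OF f_meas bump_bounds[OF f], of "s + t"] nn[OF g_meas g_bounds st(1)] st by simp
qed

text \<open>On A, \<open>w (s + t)\<close> has the law of \<open>w s\<close> plus an independent
  increment with law \<open>m t\<close>: by \<open>transition_bump\<close> no bump separates the
  two.\<close>

lemma transition_emeasure: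
  assumes st: "0 \<le> s" "0 \<le> t" and A: "A \<in> sets (path_filtration s)" and B: "B \<in> sets borel"
  shows "emeasure (P z) (A \<inter> {w\<in>space path_space. w (s + t) \<in> B}) =
    (\<integral>\<^sup>+w\<in>A. emeasure (m t) {y. w s + y \<in> B} \<partial>P z)"
proof -
  let ?N = "P_on z A" and ?f = "\<lambda>(w, y). w s + y" and ?e = "\<lambda>w :: real \<Rightarrow> real \<times> real. w (s + t)"
  interpret mt: prob_space "m t"
    using st(2) by (rule prob_space_m)
  have A': "A \<in> sets path_space"
    using A sets_path_filtration_subset by blast
  have e: "?e \<in> borel_measurable path_space"
    using st by simp
  have add: "?f \<in> borel_measurable (?N \<Otimes>\<^sub>M m t)"
  proof -
    have "(\<lambda>p. fst p s + snd p) \<in> borel_measurable (path_space \<Otimes>\<^sub>M borel)"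
      using st by (intro borel_measurable_add measurable_compose[OF measurable_fst] measurable_eval measurable_snd)
    then show ?thesis
      using sets_m[OF st(2)] by (simp add: split_beta' sets_P cong: measurable_cong_sets sets_pair_measure_cong)
  qed
  have "distr ?N borel ?e = distr (?N \<Otimes>\<^sub>M m t) borel ?f"
  proof (rule measure_eqI_bump)
    show "finite_measure (distr ?N borel ?e)"
      by (rule finite_measure_distr_P_on[OF A' e])
    fix f :: "real \<times> real \<Rightarrow> real" assume f: "f \<in> bump"
    have f_meas: "(\<lambda>x. ennreal (f x)) \<in> borel_measurable borel"
      using bump_measurable[OF f] by simp
    have "(\<integral>\<^sup>+x. f x \<partial>distr ?N borel ?e) = (\<integral>\<^sup>+w\<in>A. f (w (s + t)) \<partial>P z)"
      using e f_meas measurable_compose[OF e f_meas]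
      by (simp add: nn_integral_distr measurable_P_on nn_integral_P_on[OF A'])
    also have "\<dots> = (\<integral>\<^sup>+w\<in>A. (\<integral>\<^sup>+y. f (w s + y) \<partial>m t) \<partial>P z)"
      by (rule transition_bump[OF st A f])
    also have "\<dots> = (\<integral>\<^sup>+w. (\<integral>\<^sup>+y. f (w s + y) \<partial>m t) \<partial>?N)"
      using mt.borel_measurable_nn_integral_fst[OF measurable_compose[OF add f_meas]]
      by (intro nn_integral_P_on[symmetric] A') (simp add: measurable_P_on)
    also have "\<dots> = (\<integral>\<^sup>+p. f (case p of (w, y) \<Rightarrow> w s + y) \<partial>(?N \<Otimes>\<^sub>M m t))"
      using mt.nn_integral_fst[OF measurable_compose[OF add f_meas]] by simp
    also have "\<dots> = (\<integral>\<^sup>+x. f x \<partial>distr (?N \<Otimes>\<^sub>M m t) borel ?f)"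
      by (rule nn_integral_distr[OF add, symmetric]) (use f_meas in simp)
    finally show "(\<integral>\<^sup>+x. f x \<partial>distr ?N borel ?e) =
      (\<integral>\<^sup>+x. f x \<partial>distr (?N \<Otimes>\<^sub>M m t) borel ?f)" .
  qed simp_all
  note law = this
  have vimage: "?f -` B \<inter> space (?N \<Otimes>\<^sub>M m t) \<in> sets (?N \<Otimes>\<^sub>M m t)"
    using add B by (rule measurable_sets)
  have sect: "Pair w -` (?f -` B \<inter> space (?N \<Otimes>\<^sub>M m t)) = {y. w s + y \<in> B}" if "w \<in> space path_space" for w
    using that by (auto simp: space_pair_measure space_m[OF st(2)] space_P)
  have "emeasure (P z) (A \<inter> {w\<in>space path_space. w (s + t) \<in> B}) =
      emeasure (P z) (A \<inter> (?e -` B \<inter> space path_space))"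
    by (intro arg_cong[where f="emeasure (P z)"]) auto
  also have "\<dots> = emeasure (distr ?N borel ?e) B"
    by (rule emeasure_distr_P_on[OF A' e B, symmetric])
  also have "\<dots> = emeasure (?N \<Otimes>\<^sub>M m t) (?f -` B \<inter> space (?N \<Otimes>\<^sub>M m t))"
    unfolding law using add B by (rule emeasure_distr)
  also have "\<dots> = (\<integral>\<^sup>+w. emeasure (m t) (Pair w -` (?f -` B \<inter> space (?N \<Otimes>\<^sub>M m t))) \<partial>?N)"
    using vimage by (rule mt.emeasure_pair_measure_alt)
  also have "\<dots> = (\<integral>\<^sup>+w\<in>A. emeasure (m t) (Pair w -` (?f -` B \<inter> space (?N \<Otimes>\<^sub>M m t))) \<partial>P z)"
    using mt.measurable_emeasure_Pair[OF vimage] by (intro nn_integral_P_on A') (simp add: measurable_P_on)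
  also have "\<dots> = (\<integral>\<^sup>+w\<in>A. emeasure (m t) {y. w s + y \<in> B} \<partial>P z)"
    by (intro nn_integral_cong arg_cong2[where f="(*)"] arg_cong[where f="emeasure (m t)"] sect refl)
      (simp add: space_P)
  finally show ?thesis .
qed

text \<open>Shrinking A by the event \<open>w s \<in> D\<close> upgrades the law of
  \<open>w (s + t)\<close> to the joint law of \<open>(w s, w (s + t))\<close>. There the increment
  is the difference of the coordinates, which is the independent second factor of a product.\<close>

lemma independent_increments_P: "independent_increments m (P z)"
  unfolding independent_increments_def
proof (intro allI impI ballI)
  fix s t :: real and A and C :: "(real \<times> real) set"
  assume st: "0 \<le> s" "0 \<le> t" and A: "A \<in> sets (path_filtration s)" and C: "C \<in> sets borel"
  let ?N = "P_on z A" and ?B = "borel :: (real \<times> real) measure"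
  let ?e = "\<lambda>w :: real \<Rightarrow> real \<times> real. (w s, w (s + t))" and ?f = "\<lambda>p. (fst p s, fst p s + snd p)"
  interpret mt: prob_space "m t"
    using st(2) by (rule prob_space_m)
  have A': "A \<in> sets path_space"
    using A sets_path_filtration_subset by blast
  have pair: "?e \<in> measurable path_space (?B \<Otimes>\<^sub>M ?B)"
    using st by (intro measurable_Pair measurable_eval) auto
  have fstN: "(\<lambda>p. fst p s) \<in> borel_measurable (?N \<Otimes>\<^sub>M m t)"
  proof (rule measurable_compose[OF measurable_fst])
    show "(\<lambda>w. w s) \<in> borel_measurable ?N"
      using st(1) by (simp add: measurable_P_on)
  qed
  have sndN: "snd \<in> borel_measurable (?N \<Otimes>\<^sub>M m t)"
    using measurable_snd[of ?N "m t"] sets_m[OF st(2)] by (simp cong: measurable_cong_sets)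
  have pair_N: "?f \<in> measurable (?N \<Otimes>\<^sub>M m t) (?B \<Otimes>\<^sub>M ?B)"
    using fstN sndN by (intro measurable_Pair borel_measurable_add)
  have "distr ?N (?B \<Otimes>\<^sub>M ?B) ?e =
      distr (?N \<Otimes>\<^sub>M m t) (?B \<Otimes>\<^sub>M ?B) ?f"
  proof (rule measure_eqI_rectangles)
    show "finite_measure (distr ?N (?B \<Otimes>\<^sub>M ?B) ?e)"
      by (rule finite_measure_distr_P_on[OF A' pair])
    fix D B :: "(real \<times> real) set" assume D: "D \<in> sets ?B" and B: "B \<in> sets ?B"
    let ?A = "A \<inter> {w\<in>space path_space. w s \<in> D}"
    have A_D: "?A \<in> sets (path_filtration s)"
      using A measurable_sets[OF measurable_eval_filtration[OF st(1) order_refl] D]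
      by (intro sets.Int) (simp_all add: vimage_def Int_def conj_commute)
    have "emeasure (distr ?N (?B \<Otimes>\<^sub>M ?B) ?e) (D \<times> B) =
        emeasure (P z) (A \<inter> (?e -` (D \<times> B) \<inter> space path_space))"
      using B D by (intro emeasure_distr_P_on A' pair) simp
    also have "\<dots> = emeasure (P z) (?A \<inter> {w\<in>space path_space. w (s + t) \<in> B})"
      by (intro arg_cong[where f="emeasure (P z)"]) auto
    also have "\<dots> = (\<integral>\<^sup>+w\<in>?A. emeasure (m t) {y. w s + y \<in> B} \<partial>P z)"
      by (rule transition_emeasure[OF st A_D B])
    also have "\<dots> = (\<integral>\<^sup>+w\<in>A. emeasure (m t) (Pair w -` (?f -` (D \<times> B) \<inter> space (?N \<Otimes>\<^sub>M m t))) \<partial>P z)"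
      by (intro nn_integral_cong)
        (auto simp: space_P space_pair_measure space_m[OF st(2)] vimage_def split: split_indicator)
    also have "\<dots> = (\<integral>\<^sup>+w. emeasure (m t) (Pair w -` (?f -` (D \<times> B) \<inter> space (?N \<Otimes>\<^sub>M m t))) \<partial>?N)"
      using mt.measurable_emeasure_Pair[OF measurable_sets[OF pair_N, of "D \<times> B"]] B D
      by (intro nn_integral_P_on[symmetric] A') (simp add: measurable_P_on)
    also have "\<dots> = emeasure (?N \<Otimes>\<^sub>M m t) (?f -` (D \<times> B) \<inter> space (?N \<Otimes>\<^sub>M m t))"
      using measurable_sets[OF pair_N, of "D \<times> B"] B D by (intro mt.emeasure_pair_measure_alt[symmetric]) simp
    also have "\<dots> = emeasure (distr (?N \<Otimes>\<^sub>M m t) (?B \<Otimes>\<^sub>M ?B) ?f) (D \<times> B)"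
      using pair_N B D by (intro emeasure_distr[symmetric]) auto
    finally show "emeasure (distr ?N (?B \<Otimes>\<^sub>M ?B) ?e) (D \<times> B) =
      emeasure (distr (?N \<Otimes>\<^sub>M m t) (?B \<Otimes>\<^sub>M ?B) ?f) (D \<times> B)" .
  qed simp_all
  note law = this
  let ?D = "{p :: (real \<times> real) \<times> (real \<times> real). snd p - fst p \<in> C}"
  have D: "?D \<in> sets (?B \<Otimes>\<^sub>M ?B)"
  proof -
    have "(\<lambda>p. snd p - fst p) \<in> borel_measurable (?B \<Otimes>\<^sub>M ?B)"
      by (intro borel_measurable_diff measurable_fst measurable_snd)
    from measurable_sets[OF this C] show ?thesis
      by (simp add: vimage_def space_pair_measure)
  qed
  have "emeasure (P z) (A \<inter> {w\<in>space path_space. w (s + t) - w s \<in> C}) =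
      emeasure (P z) (A \<inter> (?e -` ?D \<inter> space path_space))"
    by (intro arg_cong[where f="emeasure (P z)"]) auto
  also have "\<dots> = emeasure (distr ?N (?B \<Otimes>\<^sub>M ?B) ?e) ?D"
    by (rule emeasure_distr_P_on[OF A' pair D, symmetric])
  also have "\<dots> = emeasure (?N \<Otimes>\<^sub>M m t) (?f -` ?D \<inter> space (?N \<Otimes>\<^sub>M m t))"
    unfolding law using pair_N D by (rule emeasure_distr)
  also have "?f -` ?D \<inter> space (?N \<Otimes>\<^sub>M m t) = space ?N \<times> C"
    by (auto simp: space_pair_measure space_m[OF st(2)])
  also have "emeasure (?N \<Otimes>\<^sub>M m t) (space ?N \<times> C) = emeasure ?N (space ?N) * emeasure (m t) C"
    using C sets_m[OF st(2)] by (intro mt.emeasure_pair_measure_Times) auto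
  also have "emeasure ?N (space ?N) = emeasure (P z) A"
    using A' sets.sets_into_space[OF A'] by (simp add: emeasure_restricted Int_absorb2 sets_P space_P)
  finally show "emeasure (P z) (A \<inter> {w\<in>space path_space. w (s + t) - w s \<in> C}) = emeasure (P z) A * emeasure (m t) C" .
qed

text \<open>Translation changes neither the increments nor the past sigma-algebras, and it moves the
  starting point to z + z'; uniqueness of the law does the rest.\<close>

lemma P_translate: "P (z + z') = distr (P z') path_space (translate z)"
proof (rule independent_increments_unique[where m=m, OF finite_measure_P sets_P independent_increments_P])
  have tr: "translate z \<in> measurable (P z') path_space"
    using measurable_translate by (simp add: measurable_P)
  show "finite_measure (distr (P z') path_space (translate z))"
    using tr by (rule finite_measure.finite_measure_distr[OF finite_measure_P])
  show "independent_increments m (distr (P z') path_space (translate z))"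
    unfolding independent_increments_def
  proof (intro allI impI ballI)
    fix s t :: real and A and C :: "(real \<times> real) set"
    assume st: "0 \<le> s" "0 \<le> t" and A: "A \<in> sets (path_filtration s)" and C: "C \<in> sets borel"
    have A': "translate z -` A \<inter> space path_space \<in> sets (path_filtration s)"
      using measurable_sets[OF measurable_translate_filtration[OF st(1)] A] by simp
    have A2: "A \<in> sets path_space"
      using A sets_path_filtration_subset by blast
    have "emeasure (distr (P z') path_space (translate z)) (A \<inter> {w\<in>space path_space. w (s + t) - w s \<in> C}) =
        emeasure (P z') (translate z -` (A \<inter> {w\<in>space path_space. w (s + t) - w s \<in> C}) \<inter> space (P z'))"
      using tr A2 sets_increment[OF st C] by (intro emeasure_distr) auto
    also have "translate z -` (A \<inter> {w\<in>space path_space. w (s + t) - w s \<in> C}) \<inter> space (P z') =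
        (translate z -` A \<inter> space path_space) \<inter> {w\<in>space path_space. w (s + t) - w s \<in> C}"
      using st by (auto simp: space_P translate_in_path_space)
    also have "emeasure (P z') \<dots> = emeasure (P z') (translate z -` A \<inter> space path_space) * emeasure (m t) C"
      using independent_increments_P[of z'] st A' C unfolding independent_increments_def by blast
    also have "emeasure (P z') (translate z -` A \<inter> space path_space) = emeasure (distr (P z') path_space (translate z)) A"
      using tr A2 by (simp add: emeasure_distr space_P)
    finally show "emeasure (distr (P z') path_space (translate z)) (A \<inter> {w\<in>space path_space. w (s + t) - w s \<in> C}) =
      emeasure (distr (P z') path_space (translate z)) A * emeasure (m t) C" .
  qed
  have start: "distr (P y) borel (\<lambda>w. w 0) = return borel y" for y
  proof -
    interpret prob_space "P y"
      by (rule prob_space_P)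
    have "distr (P y) borel (\<lambda>w. w 0) = distr (P y) borel (\<lambda>_. y)"
      using P_start by (intro distr_cong_AE) (simp_all add: measurable_P)
    then show ?thesis
      by (simp add: distr_const)
  qed
  have "distr (distr (P z') path_space (translate z)) borel (\<lambda>w. w 0) = distr (P z') borel ((\<lambda>w. w 0) \<circ> translate z)"
    using tr by (intro distr_distr) simp_all
  also have "(\<lambda>w. w 0) \<circ> translate z = (\<lambda>y. z + y) \<circ> (\<lambda>w. w 0)"
    by (auto simp: fun_eq_iff)
  also have "distr (P z') borel ((\<lambda>y. z + y) \<circ> (\<lambda>w. w 0)) = distr (distr (P z') borel (\<lambda>w. w 0)) borel (\<lambda>y. z + y)"
    by (intro distr_distr[symmetric]) (simp_all add: measurable_P)
  also have "\<dots> = return borel (z + z')"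
    by (simp add: start distr_return)
  finally show "distr (P (z + z')) borel (\<lambda>w. w 0) = distr (distr (P z') path_space (translate z)) borel (\<lambda>w. w 0)"
    by (simp add: start)
qed (simp_all add: prob_space_m sets_m)

section \<open>Regeneration at random times\<close>

text \<open>At a fixed time this is independence of the increment from the past, and
  right-continuity of the path transfers it to T. The hypothesis \<open>before\<close> says jointly
  that, within A, the time T and the event A are known immediately after T.\<close>

lemma increment_at_random_time:
  fixes T :: "(real \<Rightarrow> real \<times> real) \<Rightarrow> ennreal"
  assumes T: "T \<in> borel_measurable path_space" and A: "A \<in> sets path_space"
    and before: "\<And>q. 0 < q \<Longrightarrow> {w\<in>A. T w < ennreal q} \<in> sets (path_filtration q)"
    and t: "0 \<le> t" and C: "C \<in> sets borel"
  shows "emeasure (P z) {w\<in>A. T w < \<top> \<and> w (enn2real (T w) + t) - w (enn2real (T w)) \<in> C} =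
    emeasure (P z) {w\<in>A. T w < \<top>} * emeasure (m t) C"
proof -
  define A1 where "A1 = {w\<in>A. T w < \<top>}"
  define d where "d w = w (enn2real (T w) + t) - w (enn2real (T w))" for w :: "real \<Rightarrow> real \<times> real"
  let ?N = "P_on z A1"
  interpret mt: prob_space "m t"
    using t by (rule prob_space_m)
  have A_sub: "A \<subseteq> space path_space"
    using A by (rule sets.sets_into_space)
  have A1: "A1 \<in> sets path_space"
    unfolding A1_def by (rule sets_finite_time[OF T A])
  have d: "d \<in> borel_measurable path_space"
    using borel_measurable_diff[OF measurable_path_at[of "\<lambda>w. enn2real (T w) + t"]
        measurable_path_at[of "\<lambda>w. enn2real (T w)"]] T t
    by (simp add: d_def[abs_def])
  have "distr ?N borel d = scale_measure (emeasure (P z) A1) (m t)"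
  proof (rule measure_eqI_bump)
    show "finite_measure (distr ?N borel d)"
      by (rule finite_measure_distr_P_on[OF A1 d])
    show "sets (scale_measure (emeasure (P z) A1) (m t)) = sets borel"
      using t by (simp add: sets_m)
    fix f :: "real \<times> real \<Rightarrow> real" assume f: "f \<in> bump"
    have f_meas: "(\<lambda>x. ennreal (f x)) \<in> borel_measurable borel"
      using bump_measurable[OF f] by simp
    define c where "c = (\<integral>\<^sup>+y. f y \<partial>m t)"
    have "c \<le> (\<integral>\<^sup>+y. 1 \<partial>m t)"
      unfolding c_def by (intro nn_integral_mono) (simp add: bump_bounds(2)[OF f] ennreal_le_1)
    then have c: "c \<le> 1"
      by (simp add: mt.emeasure_space_1)
    define U where "U q w = ennreal (f (w (q + t) - w q))" for q and w :: "real \<Rightarrow> real \<times> real"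
    have U_meas: "U q \<in> borel_measurable (P z)" if "0 \<le> q" for q
      unfolding U_def measurable_P using that t
      by (intro measurable_compose[OF _ f_meas] borel_measurable_diff measurable_eval) auto
    have U_le: "U q w \<le> 1" for q w
      by (simp add: U_def bump_bounds(2)[OF f] ennreal_le_1)
    have U_rc: "((\<lambda>u. U u w) \<longlongrightarrow> U q w) (at_right q)" if "0 \<le> q" "w \<in> space (P z)" for q w
    proof -
      have w: "w \<in> space path_space"
        using that(2) by (simp add: space_P)
      have "((\<lambda>u. w (t + u)) \<longlongrightarrow> w (t + q)) (at_right q)"
        using that t by (intro tendsto_shift_at_right path_right_cont[OF w]) simp
      then have "((\<lambda>u. w (u + t) - w u) \<longlongrightarrow> w (q + t) - w q) (at_right q)"
        using that path_right_cont[OF w] by (intro tendsto_diff) (simp_all add: add.commute)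
      then show ?thesis
        unfolding U_def using bump_continuous[OF f]
        by (intro tendsto_ennrealI) (auto intro: continuous_on_tendsto_compose)
    qed
    have F: "sigma_algebra (space (P z)) (sets (path_filtration q))" "sets (path_filtration q) \<subseteq> sets (P z)" for q
      using sets.sigma_algebra_axioms[of "path_filtration q"] sets_path_filtration_subset
      by (simp_all add: space_P sets_P)
    have eq: "(\<integral>\<^sup>+w\<in>B. U q w \<partial>P z) = (\<integral>\<^sup>+w\<in>B. c \<partial>P z)" if "0 < q" "B \<in> sets (path_filtration q)" for q B
    proof -
      have "B \<in> sets (P z)"
        using that F by blast
      then have "(\<integral>\<^sup>+w\<in>B. c \<partial>P z) = emeasure (P z) B * c"
        by (subst nn_integral_cmult_indicator) (simp_all add: mult.commute)
      then show ?thesis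
        using set_nn_integral_increment[OF sets_P independent_increments_P sets_m[OF t] _ t that(2) f_meas] that(1)
        by (simp add: U_def c_def)
    qed
    have "(\<integral>\<^sup>+w\<in>A1. U (enn2real (T w)) w \<partial>P z) \<le> (\<integral>\<^sup>+w\<in>A1. c \<partial>P z)"
      unfolding A1_def
      by (rule nn_integral_random_time_mono[where F="\<lambda>q. sets (path_filtration q)" and H="\<lambda>_ _. c", OF finite_measure_P F])
        (use A_sub before U_meas U_le U_rc c eq in \<open>auto simp: space_P intro: subsetD[OF sets_path_filtration_mono]\<close>)
    moreover have "(\<integral>\<^sup>+w\<in>A1. c \<partial>P z) \<le> (\<integral>\<^sup>+w\<in>A1. U (enn2real (T w)) w \<partial>P z)"
      unfolding A1_def
      by (rule nn_integral_random_time_mono[where F="\<lambda>q. sets (path_filtration q)" and G="\<lambda>_ _. c", OF finite_measure_P F])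
        (use A_sub before U_meas U_le U_rc c eq in \<open>auto simp: space_P intro: subsetD[OF sets_path_filtration_mono]\<close>)
    ultimately have main: "(\<integral>\<^sup>+w\<in>A1. U (enn2real (T w)) w \<partial>P z) = c * emeasure (P z) A1"
      using A1 by (simp add: nn_integral_cmult_indicator sets_P)
    have "(\<integral>\<^sup>+x. f x \<partial>distr ?N borel d) = (\<integral>\<^sup>+w. f (d w) \<partial>?N)"
      using d f_meas by (intro nn_integral_distr) (simp_all add: measurable_P_on)
    also have "\<dots> = (\<integral>\<^sup>+w\<in>A1. f (d w) \<partial>P z)"
      by (rule nn_integral_P_on[OF A1 measurable_compose[OF d f_meas]])
    also have "\<dots> = (\<integral>\<^sup>+x. f x \<partial>scale_measure (emeasure (P z) A1) (m t))"
      using main f_meas sets_m[OF t]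
      by (simp add: U_def d_def c_def nn_integral_scale_measure mult.commute cong: measurable_cong_sets)
    finally show "(\<integral>\<^sup>+x. f x \<partial>distr ?N borel d) = (\<integral>\<^sup>+x. f x \<partial>scale_measure (emeasure (P z) A1) (m t))" .
  qed simp
  from arg_cong[where f="\<lambda>L. emeasure L C", OF this]
  have "emeasure (P z) (A1 \<inter> (d -` C \<inter> space path_space)) = emeasure (P z) A1 * emeasure (m t) C"
    using emeasure_distr_P_on[OF A1 d C] by simp
  moreover have "A1 \<inter> (d -` C \<inter> space path_space) = {w\<in>A. T w < \<top> \<and> d w \<in> C}"
    using A_sub by (auto simp: A1_def)
  ultimately show ?thesis
    by (simp add: A1_def d_def)
qed

text \<open>An increment of the shifted path over [s, s + t] is an increment of w after the random
  time T + s. Adding an event of the shifted past to A and applying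
  \<open>increment_at_random_time\<close> shows that the shifted path has independent increments
  with laws m; it starts at 0, so it follows a multiple of \<open>P 0\<close>.\<close>

lemma regeneration:
  fixes T :: "(real \<Rightarrow> real \<times> real) \<Rightarrow> ennreal"
  assumes T: "T \<in> borel_measurable path_space"
    and local_time: "\<And>q w. 0 < q \<Longrightarrow> w \<in> space path_space \<Longrightarrow> T w < ennreal q \<Longrightarrow> T (stopped_path q w) = T w"
    and A: "A \<in> sets path_space"
    and before: "\<And>q. 0 < q \<Longrightarrow> {w\<in>A. T w < ennreal q} \<in> sets (path_filtration q)"
    and B: "B \<in> sets path_space"
  shows "emeasure (P z) {w\<in>A. T w < \<top> \<and> increments_from (enn2real (T w)) w \<in> B} =
    emeasure (P z) {w\<in>A. T w < \<top>} * emeasure (P 0) B"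
proof -
  define A1 where "A1 = {w\<in>A. T w < \<top>}"
  define W where "W w = increments_from (enn2real (T w)) w" for w
  let ?L = "distr (P_on z A1) path_space W" and ?R = "scale_measure (emeasure (P z) A1) (P 0)"
  have A_sub: "A \<subseteq> space path_space"
    using A by (rule sets.sets_into_space)
  have A1: "A1 \<in> sets path_space"
    unfolding A1_def by (rule sets_finite_time[OF T A])
  have W_space: "W w \<in> space path_space" if "w \<in> space path_space" for w
    unfolding W_def using that by (intro increments_from_in_path_space) simp_all
  have W: "W \<in> measurable path_space path_space"
    using measurable_increments_from[of "\<lambda>w. enn2real (T w)"] T by (simp add: W_def[abs_def])
  have "?L = ?R"
  proof (rule independent_increments_unique[where m=m])
    show "finite_measure ?L"
      by (rule finite_measure_distr_P_on[OF A1 W])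
    interpret P0: prob_space "P 0"
      by (rule prob_space_P)
    interpret Pz: prob_space "P z"
      by (rule prob_space_P)
    show "finite_measure ?R"
      by (intro finite_measureI) (simp add: space_scale_measure P0.emeasure_space_1)
    show "independent_increments m ?R"
      using independent_increments_P[of 0] by (auto simp: independent_increments_def mult.assoc)
    show "independent_increments m ?L"
      unfolding independent_increments_def
    proof (intro allI impI ballI)
      fix s t :: real and A' and C :: "(real \<times> real) set"
      assume st: "0 \<le> s" "0 \<le> t" and A': "A' \<in> sets (path_filtration s)" and C: "C \<in> sets borel"
      define A2 where "A2 = A \<inter> (W -` A' \<inter> space path_space)"
      have A'_path: "A' \<in> sets path_space"
        using A' sets_path_filtration_subset by blast
      have A2: "A2 \<in> sets path_space"
        unfolding A2_def using A measurable_sets[OF W A'_path] by blast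
      \<comment> \<open>Stopping the path at q alters neither T nor the shifted path up to s when T
        + s < q, so this part of the event can be tested on the stopped path.\<close>
      have before2: "{w\<in>A2. T w + ennreal s < ennreal q} \<in> sets (path_filtration q)" if q: "0 < q" for q
      proof -
        \<comment> \<open>A is left out: it is not assumed to be compatible with stopping and enters
          through \<open>before\<close> instead.\<close>
        define D where "D = {w\<in>space path_space. T w + ennreal s < ennreal q} \<inter> (W -` A' \<inter> space path_space)"
        have D: "D \<in> sets path_space"
          unfolding D_def using T measurable_sets[OF W A'_path] by measurable
        have "{w\<in>A2. T w + ennreal s < ennreal q} =
            {w\<in>A. T w < ennreal q} \<inter> (stopped_path q -` D \<inter> space (path_filtration q))"
        proof (intro set_eqI)
          fix w
          show "w \<in> {w\<in>A2. T w + ennreal s < ennreal q} \<longleftrightarrow>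
            w \<in> {w\<in>A. T w < ennreal q} \<inter> (stopped_path q -` D \<inter> space (path_filtration q))"
          proof (cases "w \<in> A \<and> T w + ennreal s < ennreal q")
            case True
            have w: "w \<in> space path_space"
              using True A_sub by blast
            have Tq: "T w < ennreal q"
              using True by (auto intro: le_less_trans[rotated])
            then have stop: "T (stopped_path q w) = T w"
              using q w by (rule local_time[rotated 2])
            have stop_space: "stopped_path q w \<in> space path_space"
              by (rule stopped_path_in_path_space[OF w less_imp_le[OF q]])
            obtain \<tau> where \<tau>: "T w = ennreal \<tau>" "0 \<le> \<tau>"
              using Tq by (cases "T w") auto
            then have \<tau>_q: "\<tau> + s < q"
              using True st by (simp add: ennreal_less_iff flip: ennreal_plus)
            \<comment> \<open>\<open>A'\<close> looks at the shifted path up to s only, that is at w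
              up to \<tau> + s, which lies below q.\<close>
            have "W w \<in> A' \<longleftrightarrow> W (stopped_path q w) \<in> A'"
              by (rule natural_filtration_agree[OF A' _ W_space[OF w] W_space[OF stop_space]])
                (use st \<tau> \<tau>_q in \<open>auto simp: W_def stop min_def\<close>)
            then show ?thesis
              using True Tq stop stop_space w by (auto simp: A2_def D_def)
          next
            case False
            then show ?thesis
              using q A_sub local_time[of q w] by (auto simp: A2_def D_def)
          qed
        qed
        then show ?thesis
          using before[OF q] measurable_sets[OF measurable_stopped_path D] q by auto
      qed
      have Ts: "(\<lambda>w. T w + ennreal s) \<in> borel_measurable path_space"
        using T by simp
      have fin: "T w + ennreal s < \<top> \<longleftrightarrow> T w < \<top>" for w
        by simp
      have plus: "enn2real (T w + ennreal s) = enn2real (T w) + s" if "T w < \<top>" for w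
        using that st by (simp add: enn2real_plus)
      note D' = sets_increment[OF st C]
      let ?I = "{w\<in>space path_space. w (s + t) - w s \<in> C}"
      have "emeasure ?L (A' \<inter> ?I) = emeasure (P z) (A1 \<inter> (W -` (A' \<inter> ?I) \<inter> space path_space))"
        using A'_path D' by (intro emeasure_distr_P_on A1 W) auto
      also have "A1 \<inter> (W -` (A' \<inter> ?I) \<inter> space path_space) =
          {w\<in>A2. T w + ennreal s < \<top> \<and>
            w (enn2real (T w + ennreal s) + t) - w (enn2real (T w + ennreal s)) \<in> C}"
        using W_space st A_sub unfolding fin
        by (auto simp: A1_def A2_def plus W_def add.assoc)
      also have "emeasure (P z) \<dots> = emeasure (P z) {w\<in>A2. T w + ennreal s < \<top>} * emeasure (m t) C"
        by (rule increment_at_random_time[OF Ts A2 before2 st(2) C])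
      also have "{w\<in>A2. T w + ennreal s < \<top>} = A1 \<inter> (W -` A' \<inter> space path_space)"
        by (auto simp: A1_def A2_def)
      also have "emeasure (P z) \<dots> = emeasure ?L A'"
        by (rule emeasure_distr_P_on[OF A1 W A'_path, symmetric])
      finally show "emeasure ?L (A' \<inter> ?I) = emeasure ?L A' * emeasure (m t) C" .
    qed
    show "distr ?L borel (\<lambda>w. w 0) =
      distr ?R borel (\<lambda>w. w 0)"
    proof (rule measure_eqI)
      fix D assume "D \<in> sets (distr ?L borel (\<lambda>w. w 0))"
      then have D: "D \<in> sets borel"
        by simp
      have "emeasure (distr ?L borel (\<lambda>w. w 0)) D =
          emeasure (distr (P_on z A1) borel (\<lambda>_. 0)) D"
        using W by (subst distr_distr) (auto simp: measurable_P_on W_def comp_def)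
      also have "\<dots> = emeasure (P z) A1 * indicator D 0"
        using D A1 sets.sets_into_space[OF A1]
        by (auto simp: emeasure_distr emeasure_restricted sets_P space_P Int_absorb2 split: split_indicator)
      also have "\<dots> = emeasure (P z) A1 * emeasure (P 0) ((\<lambda>w. w 0) -` D \<inter> space (P 0))"
      proof -
        have "emeasure (P 0) ((\<lambda>w. w 0) -` D \<inter> space (P 0)) = (\<integral>\<^sup>+w. indicator D (w 0) \<partial>P 0)"
          using D by (intro nn_integral_indicator_comp[symmetric]) (simp_all add: measurable_P)
        also have "\<dots> = (\<integral>\<^sup>+w. indicator D 0 \<partial>P 0)"
          using P_start[of 0] by (intro nn_integral_cong_AE) auto
        finally show ?thesis
          by (simp add: P0.emeasure_space_1)
      qed
      also have "\<dots> = emeasure (distr ?R borel (\<lambda>w. w 0)) D"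
        using D by (subst emeasure_distr) (simp_all add: measurable_P space_scale_measure cong: measurable_cong_sets)
      finally show "emeasure (distr ?L borel (\<lambda>w. w 0)) D =
        emeasure (distr ?R borel (\<lambda>w. w 0)) D" .
    qed simp
  qed (simp_all add: sets_P prob_space_m sets_m)
  from arg_cong[where f="\<lambda>L. emeasure L B", OF this]
  have "emeasure (P z) (A1 \<inter> (W -` B \<inter> space path_space)) = emeasure (P z) A1 * emeasure (P 0) B"
    using emeasure_distr_P_on[OF A1 W B] by simp
  moreover have "A1 \<inter> (W -` B \<inter> space path_space) = {w\<in>A. T w < \<top> \<and> W w \<in> B}"
    using A_sub by (auto simp: A1_def)
  ultimately show ?thesis
    by (simp add: A1_def W_def)
qed

end

section \<open>The first passage functional\<close>

definition crossing_times :: "real \<Rightarrow> (real \<Rightarrow> real \<times> real) \<Rightarrow> real set" where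
  "crossing_times t w = {u. 0 < u \<and> t < snd (w u)}"

text \<open>A real-valued first passage time, meaningful only when the level is crossed; hence the
  nonemptiness conditions in what follows.\<close>

definition passage :: "real \<Rightarrow> (real \<Rightarrow> real \<times> real) \<Rightarrow> real" where
  "passage t w = Inf (crossing_times t w)"

lemma first_passage_eq:
  "first_passage t w = (if crossing_times t w = {} then \<infinity> else ereal (passage t w))"
proof -
  have "bdd_below (crossing_times t w)"
    by (rule bdd_belowI[of _ 0]) (auto simp: crossing_times_def)
  then show ?thesis
    unfolding first_passage_def subordinator_def crossing_times_def[symmetric] passage_def
    by (auto simp: ereal_Inf' top_ereal_def)
qed

abbreviation X :: "real \<Rightarrow> (real \<Rightarrow> real \<times> real) \<Rightarrow> real \<times> real" where
  "X \<equiv> time_changed_process"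

lemma time_changed_process_eq:
  "X t w =
    (if crossing_times t w = {} then 0 else w (passage t w) - (0, t))"
  by (auto simp: time_changed_process_def first_passage_eq drift_part_def remaining_lifetime_def
      overshooting_def subordinator_def prod_eq_iff zero_prod_def)

lemma crossing_times_antimono: "s \<le> t \<Longrightarrow> crossing_times t w \<subseteq> crossing_times s w"
  by (auto simp: crossing_times_def)

lemma crossing_times_bdd_below: "bdd_below (crossing_times t w)"
  by (rule bdd_belowI[of _ 0]) (auto simp: crossing_times_def)

lemma passage_le: "u \<in> crossing_times t w \<Longrightarrow> passage t w \<le> u"
  unfolding passage_def by (rule cInf_lower[OF _ crossing_times_bdd_below])

lemma passage_less_iff:
  "crossing_times t w \<noteq> {} \<Longrightarrow> passage t w < q \<longleftrightarrow> (\<exists>u\<in>crossing_times t w. u < q)"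
  unfolding passage_def by (rule cInf_less_iff[OF _ crossing_times_bdd_below])

lemma passage_nonneg: "crossing_times t w \<noteq> {} \<Longrightarrow> 0 \<le> passage t w"
  unfolding passage_def by (rule cInf_greatest) (auto simp: crossing_times_def)

lemma passage_mono: "crossing_times t w \<noteq> {} \<Longrightarrow> s \<le> t \<Longrightarrow> passage s w \<le> passage t w"
  unfolding passage_def by (rule cInf_superset_mono[OF _ crossing_times_bdd_below crossing_times_antimono])

lemma passage_eqI:
  assumes "\<And>u. u \<in> crossing_times t w \<Longrightarrow> a \<le> u"
    and "\<And>e. 0 < e \<Longrightarrow> \<exists>u\<in>crossing_times t w. u < a + e"
  shows "passage t w = a"
proof (rule antisym)
  have ne: "crossing_times t w \<noteq> {}"
    using assms(2)[of 1] by auto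
  show "passage t w \<le> a"
  proof (rule field_le_epsilon)
    fix e :: real assume "0 < e"
    from assms(2)[OF this] show "passage t w \<le> a + e"
      using passage_le by (meson less_imp_le order_trans)
  qed
  show "a \<le> passage t w"
    unfolding passage_def using ne assms(1) by (rule cInf_greatest)
qed

lemma path_snd_right_cont:
  "w \<in> space path_space \<Longrightarrow> 0 \<le> t \<Longrightarrow> ((\<lambda>u. snd (w u)) \<longlongrightarrow> snd (w t)) (at_right t)"
  by (intro tendsto_snd path_right_cont)

lemma path_above_right:
  assumes "w \<in> space path_space" "0 \<le> a" "t < snd (w a)"
  obtains b where "a < b" "\<And>u. a < u \<Longrightarrow> u < b \<Longrightarrow> t < snd (w u)"
  using order_tendstoD(1)[OF path_snd_right_cont[OF assms(1,2)] assms(3)]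
  unfolding eventually_at_right_field by blast

text \<open>The passage time is a crossing time or a limit of crossing times from the right, so
  right-continuity keeps the path from being below the level there. This makes the remaining
  lifetime nonnegative.\<close>

lemma passage_above:
  assumes w: "w \<in> space path_space" and ne: "crossing_times t w \<noteq> {}"
  shows "t \<le> snd (w (passage t w))"
proof (rule ccontr)
  assume neg: "\<not> t \<le> snd (w (passage t w))"
  have "\<forall>\<^sub>F u in at_right (passage t w). snd (w u) < t"
    using neg by (intro order_tendstoD(2)[OF path_snd_right_cont[OF w passage_nonneg[OF ne]]]) simp
  then obtain b where b: "passage t w < b" "\<And>u. passage t w < u \<Longrightarrow> u < b \<Longrightarrow> snd (w u) < t"
    unfolding eventually_at_right_field by blast
  then obtain u where u: "u \<in> crossing_times t w" "u < b"
    using passage_less_iff[OF ne] by blast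
  then have "passage t w \<le> u" "t < snd (w u)"
    using passage_le by (auto simp: crossing_times_def)
  then show False
    using b(2)[of u] u(2) neg by (cases "passage t w = u") auto
qed

text \<open>Time 0 is excluded from the crossing times, but right-continuity provides positive ones
  arbitrarily close to it. This is the phase in which the remaining lifetime decreases
  deterministically.\<close>

lemma passage_eq_0:
  assumes "w \<in> space path_space" "t < snd (w 0)"
  shows "crossing_times t w \<noteq> {}" "passage t w = 0"
proof -
  obtain b where b: "0 < b" "\<And>u. 0 < u \<Longrightarrow> u < b \<Longrightarrow> t < snd (w u)"
    using path_above_right[OF assms(1) _ assms(2)] by auto
  have mem: "min (b / 2) (e / 2) \<in> crossing_times t w" if "0 < e" for e
    unfolding crossing_times_def using b(1) that by (auto intro!: b(2) simp: min_less_iff_disj)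
  from mem[of 1] show "crossing_times t w \<noteq> {}"
    by auto
  show "passage t w = 0"
  proof (rule passage_eqI)
    show "\<exists>u\<in>crossing_times t w. u < 0 + e" if "0 < e" for e
      using mem[OF that] that by (intro bexI[of _ "min (b / 2) (e / 2)"]) (auto simp: min_less_iff_disj)
  qed (auto simp: crossing_times_def)
qed

text \<open>An infimum strictly below q is determined by the crossing times below q, and there the
  paths agree. With passage at q itself the conclusion could fail, which is why strict events are
  used.\<close>

lemma passage_cong_before:
  assumes eq: "\<And>u. 0 < u \<Longrightarrow> u < q \<Longrightarrow> w u = w' u"
    and ne: "crossing_times t w \<noteq> {}" and lt: "passage t w < q"
  shows "crossing_times t w' \<noteq> {}" "passage t w' = passage t w"
proof -
  have iff: "u \<in> crossing_times t w \<longleftrightarrow> u \<in> crossing_times t w'" if "u < q" for u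
    using eq[of u] that by (auto simp: crossing_times_def)
  obtain v where v: "v \<in> crossing_times t w" "v < q"
    using passage_less_iff[OF ne] lt by blast
  then show "crossing_times t w' \<noteq> {}"
    using iff by blast
  show "passage t w' = passage t w"
  proof (rule passage_eqI)
    show "passage t w \<le> u" if "u \<in> crossing_times t w'" for u
      using that iff[of u] passage_le[of u t w] lt by (cases "u < q") auto
    show "\<exists>u\<in>crossing_times t w'. u < passage t w + e" if "0 < e" for e
    proof -
      have "passage t w < min q (passage t w + e)"
        using lt that by simp
      from iffD1[OF passage_less_iff[OF ne] this]
      obtain u where "u \<in> crossing_times t w" "u < q" "u < passage t w + e"
        by auto
      then show ?thesis
        using iff by blast
    qed
  qed
qed

text \<open>\<open>first_passage\<close> in the type of random times required by
  \<open>regeneration\<close>.\<close>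

definition passage_time :: "real \<Rightarrow> (real \<Rightarrow> real \<times> real) \<Rightarrow> ennreal" where
  "passage_time t w = (if crossing_times t w = {} then \<top> else ennreal (passage t w))"

lemma passage_time_less_iff:
  assumes "0 < q"
  shows "passage_time t w < ennreal q \<longleftrightarrow> (\<exists>u\<in>crossing_times t w. u < q)"
  using passage_nonneg[of t w] passage_less_iff[of t w q]
  by (auto simp: passage_time_def ennreal_less_iff)

lemma passage_time_less_top: "passage_time t w < \<top> \<longleftrightarrow> crossing_times t w \<noteq> {}"
  by (simp add: passage_time_def)

lemma enn2real_passage_time: "crossing_times t w \<noteq> {} \<Longrightarrow> enn2real (passage_time t w) = passage t w"
  by (simp add: passage_time_def passage_nonneg)

text \<open>By right-continuity a crossing persists for a short while and hence at some rational
  time; this reduces passage events to countable unions.\<close>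

lemma crossing_before_rational:
  assumes w: "w \<in> space path_space"
  shows "(\<exists>u\<in>crossing_times t w. u < q) \<longleftrightarrow> (\<exists>r\<in>\<rat>. 0 < r \<and> r < q \<and> t < snd (w r))"
proof
  assume "\<exists>u\<in>crossing_times t w. u < q"
  then obtain u where u: "0 < u" "t < snd (w u)" "u < q"
    by (auto simp: crossing_times_def)
  obtain b where b: "u < b" "\<And>v. u < v \<Longrightarrow> v < b \<Longrightarrow> t < snd (w v)"
    using path_above_right[OF w _ u(2)] u(1) by auto
  obtain r where "r \<in> \<rat>" "u < r" "r < min b q"
    using Rats_dense_in_real[of u "min b q"] b(1) u(3) by auto
  then show "\<exists>r\<in>\<rat>. 0 < r \<and> r < q \<and> t < snd (w r)"
    using b(2)[of r] u(1) by (intro bexI[of _ r]) auto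
qed (auto simp: crossing_times_def)

lemma measurable_passage_time: "passage_time t \<in> borel_measurable path_space"
proof (rule borel_measurableI_less)
  have sets: "{w\<in>space path_space. \<exists>u\<in>crossing_times t w. u < q} \<in> sets path_space" for q
  proof -
    have "{w\<in>space path_space. \<exists>u\<in>crossing_times t w. u < q} =
        (\<Union>r\<in>{r\<in>\<rat>. 0 < r \<and> r < q}. (\<lambda>w. snd (w r)) -` {t<..} \<inter> space path_space)"
    proof (intro set_eqI)
      fix w
      show "w \<in> {w\<in>space path_space. \<exists>u\<in>crossing_times t w. u < q} \<longleftrightarrow>
          w \<in> (\<Union>r\<in>{r\<in>\<rat>. 0 < r \<and> r < q}. (\<lambda>w. snd (w r)) -` {t<..} \<inter> space path_space)"
        by (cases "w \<in> space path_space") (auto simp: crossing_before_rational)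
    qed
    moreover have "(\<lambda>w. snd (w r)) -` {t<..} \<inter> space path_space \<in> sets path_space" if "0 < r" for r
    proof (rule measurable_sets)
      show "(\<lambda>w. snd (w r)) \<in> borel_measurable path_space"
        using that by (intro measurable_compose[OF measurable_eval] borel_measurable_continuous_onI continuous_intros) simp
    qed simp
    moreover have "countable {r\<in>\<rat>. 0 < r \<and> r < q}"
      by (rule countable_subset[OF _ countable_rat]) auto
    ultimately show ?thesis
      by (simp only:) (intro sets.countable_UN', auto)
  qed
  fix y
  show "{w\<in>space path_space. passage_time t w < y} \<in> sets path_space"
  proof (cases y)
    case (real q)
    then show ?thesis
      using sets[of q] by (cases "q = 0") (auto simp: passage_time_less_iff)
  next
    case top
    have "{w\<in>space path_space. passage_time t w < \<top>} = (\<Union>n. {w\<in>space path_space. \<exists>u\<in>crossing_times t w. u < real n})"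
      using reals_Archimedean2 by (auto simp: passage_time_less_top)
    then show ?thesis
      using sets top by auto
  qed
qed

section \<open>Measurability and path regularity of the time-changed process\<close>

lemma time_changed_process_eq_passage_time:
  "X t w =
    (if passage_time t w < \<top> then w (enn2real (passage_time t w)) - (0, t) else 0)"
  by (auto simp: time_changed_process_eq passage_time_less_top enn2real_passage_time)

lemma measurable_time_changed_process: "X t \<in> borel_measurable path_space"
proof -
  have "(\<lambda>w. w (enn2real (passage_time t w))) \<in> borel_measurable path_space"
    using measurable_path_at[of "\<lambda>w. enn2real (passage_time t w)"] measurable_passage_time by simp
  moreover have "{w\<in>space path_space. passage_time t w < \<top>} \<in> sets path_space"
    using measurable_passage_time by measurable
  ultimately show ?thesis
    unfolding time_changed_process_eq_passage_time[abs_def]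
    by (intro measurable_If borel_measurable_diff) auto
qed

lemma time_changed_process_nonneg:
  "w \<in> space path_space \<Longrightarrow> X t w \<in> UNIV \<times> {0..}"
  using passage_above[of w t] by (auto simp: time_changed_process_eq mem_Times_iff)

text \<open>A time at which level t is crossed also crosses all slightly higher levels, so the
  passage times decrease to that of t as the level decreases to t, and right-continuity of w
  applies. If t is never crossed, neither is any higher level, and the default value
  persists.\<close>

lemma time_changed_process_right_cont:
  assumes w: "w \<in> space path_space"
  shows "((\<lambda>u. X u w) \<longlongrightarrow> X t w) (at_right t)"
proof (cases "crossing_times t w = {}")
  case True
  have "\<forall>\<^sub>F u in at_right t. X u w = X t w"
    unfolding eventually_at_right_field
  proof (intro exI[of _ "t + 1"] conjI allI impI)
    fix u assume "t < u"
    then have "crossing_times u w = {}"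
      using crossing_times_antimono[of t u w] True by auto
    then show "X u w = X t w"
      using True by (simp add: time_changed_process_eq)
  qed simp
  then show ?thesis
    by (rule tendsto_eventually)
next
  case ne: False
  have close: "\<forall>\<^sub>F u in at_right t. crossing_times u w \<noteq> {} \<and> passage t w \<le> passage u w \<and> passage u w < b"
    if b: "passage t w < b" for b
  proof -
    obtain v where v: "v \<in> crossing_times t w" "v < b"
      using passage_less_iff[OF ne] b by blast
    then have "t < snd (w v)"
      by (simp add: crossing_times_def)
    then show ?thesis
      unfolding eventually_at_right_field
    proof (intro exI[of _ "snd (w v)"] conjI allI impI)
      fix u assume u: "t < u" "u < snd (w v)"
      then have vu: "v \<in> crossing_times u w"
        using v by (simp add: crossing_times_def)
      then show "crossing_times u w \<noteq> {}"
        by auto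
      then show "passage t w \<le> passage u w"
        using u by (intro passage_mono) auto
      show "passage u w < b"
        using passage_le[OF vu] v(2) by simp
    qed
  qed
  have "((\<lambda>u. w (passage u w)) \<longlongrightarrow> w (passage t w)) (at_right t)"
  proof (rule tendstoI)
    fix e :: real assume e: "0 < e"
    have "\<forall>\<^sub>F u in at_right (passage t w). dist (w u) (w (passage t w)) < e"
      using path_right_cont[OF w passage_nonneg[OF ne]] e by (rule tendstoD)
    then obtain b where b: "passage t w < b"
      "\<And>u. passage t w < u \<Longrightarrow> u < b \<Longrightarrow> dist (w u) (w (passage t w)) < e"
      unfolding eventually_at_right_field by blast
    show "\<forall>\<^sub>F u in at_right t. dist (w (passage u w)) (w (passage t w)) < e"
      using close[OF b(1)]
    proof eventually_elim
      case (elim u)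
      then show ?case
        using b(2)[of "passage u w"] e by (cases "passage u w = passage t w") auto
    qed
  qed
  then have "((\<lambda>u. w (passage u w) - (0, u)) \<longlongrightarrow> w (passage t w) - (0, t)) (at_right t)"
    by (intro tendsto_diff tendsto_Pair tendsto_const tendsto_ident_at)
  moreover have "\<forall>\<^sub>F u in at_right t. X u w = w (passage u w) - (0, u)"
    using close[OF less_add_one] by eventually_elim (simp add: time_changed_process_eq)
  ultimately show ?thesis
    using ne by (simp add: tendsto_cong time_changed_process_eq)
qed

text \<open>Let L be the supremum of the passage times of levels below t. If L is attained, passage
  is constant for levels just below t, as happens inside a jump; otherwise the passage times
  approach L strictly from below and w has a left limit at L.\<close>

lemma time_changed_process_left_limit:
  assumes w: "w \<in> space path_space" and ne: "crossing_times t w \<noteq> {}"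
  shows "\<exists>l\<in>UNIV \<times> {0..}. ((\<lambda>u. X u w) \<longlongrightarrow> l) (at_left t)"
proof -
  have neu: "crossing_times u w \<noteq> {}" if "u \<le> t" for u
    using crossing_times_antimono[OF that, of w] ne by auto
  have mono: "passage u w \<le> passage v w" if "u \<le> v" "v \<le> t" for u v
    using neu[OF that(2)] that(1) by (rule passage_mono)
  define L where "L = (SUP u\<in>{..<t}. passage u w)"
  have bdd: "bdd_above ((\<lambda>u. passage u w) ` {..<t})"
    by (rule bdd_aboveI2[of _ _ "passage t w"]) (auto intro: mono)
  have le_L: "passage u w \<le> L" if "u < t" for u
    unfolding L_def using that bdd by (intro cSUP_upper) auto
  have "\<exists>y. ((\<lambda>u. w (passage u w)) \<longlongrightarrow> y) (at_left t)"
  proof (cases "\<exists>u<t. passage u w = L")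
    case True
    then obtain u where u: "u < t" "passage u w = L"
      by blast
    have "\<forall>\<^sub>F v in at_left t. w (passage v w) = w L"
      unfolding eventually_at_left_field
    proof (intro exI[of _ u] conjI allI impI u(1))
      fix v assume "u < v" "v < t"
      then have "passage v w = L"
        using mono[of u v] le_L[of v] u(2) by simp
      then show "w (passage v w) = w L"
        by simp
    qed
    from tendsto_eventually[OF this] show ?thesis ..
  next
    case False
    then have lt: "passage u w < L" if "u < t" for u
      using le_L[OF that] that by (auto simp: less_le)
    have "((\<lambda>u. passage u w) \<longlongrightarrow> L) (at_left t)"
    proof (rule order_tendstoI)
      fix a assume "a < L"
      then obtain u where u: "u < t" "a < passage u w"
        unfolding L_def using bdd by (subst (asm) less_cSUP_iff) auto
      show "\<forall>\<^sub>F v in at_left t. a < passage v w"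
        unfolding eventually_at_left_field
      proof (intro exI[of _ u] conjI allI impI u(1))
        fix v assume "u < v" "v < t"
        then show "a < passage v w"
          using mono[of u v] u(2) by simp
      qed
    next
      fix a assume "L < a"
      then show "\<forall>\<^sub>F v in at_left t. passage v w < a"
        unfolding eventually_at_left_field using lt by (intro exI[of _ "t - 1"]) (auto intro: less_trans)
    qed
    moreover have "\<forall>\<^sub>F v in at_left t. passage v w \<in> {..<L} \<and> passage v w \<noteq> L"
      unfolding eventually_at_left_field using lt by (intro exI[of _ "t - 1"]) (auto dest: less_imp_neq)
    ultimately have "filterlim (\<lambda>u. passage u w) (at_left L) (at_left t)"
      by (simp add: filterlim_at)
    moreover have "0 < L"
      using passage_nonneg[OF neu, of "t - 1"] lt[of "t - 1"] by simp
    then obtain y where "(w \<longlongrightarrow> y) (at_left L)"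
      using path_left_limit[OF w] by blast
    ultimately show ?thesis
      using filterlim_compose by blast
  qed
  then obtain y where "((\<lambda>u. w (passage u w)) \<longlongrightarrow> y) (at_left t)" ..
  then have "((\<lambda>u. w (passage u w) - (0, u)) \<longlongrightarrow> y - (0, t)) (at_left t)"
    by (intro tendsto_diff tendsto_Pair tendsto_const tendsto_ident_at)
  moreover have "\<forall>\<^sub>F u in at_left t. X u w = w (passage u w) - (0, u)"
    unfolding eventually_at_left_field using neu by (intro exI[of _ "t - 1"]) (auto simp: time_changed_process_eq)
  ultimately have lim: "((\<lambda>u. X u w) \<longlongrightarrow> y - (0, t)) (at_left t)"
    by (simp add: tendsto_cong)
  have "y - (0, t) \<in> UNIV \<times> {0..}"
  proof (rule Lim_in_closed_set[OF _ _ _ lim])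
    show "closed (UNIV \<times> {0::real..} :: (real \<times> real) set)"
      by (intro closed_Times closed_UNIV closed_atLeast)
  qed (use time_changed_process_nonneg[OF w] in \<open>auto intro: always_eventually\<close>)
  with lim show ?thesis ..
qed

lemma time_changed_process_cadlag:
  assumes "w \<in> space path_space" "\<And>t. crossing_times t w \<noteq> {}"
  shows "cadlag (UNIV \<times> {0..}) (\<lambda>t. X t w)"
  unfolding cadlag_def
  using assms time_changed_process_nonneg time_changed_process_right_cont time_changed_process_left_limit by blast

section \<open>Translation, shift and stopping of the time-changed process\<close>

lemma crossing_times_translate: "crossing_times t (translate (x, r) w) = crossing_times (t - r) w"
  by (auto simp: crossing_times_def)

text \<open>The level t - r may be negative; a path started at 0 crosses such a level at once, so
  the deterministic phase is covered without a case distinction.\<close>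

lemma time_changed_process_translate:
  assumes "crossing_times (t - r) w \<noteq> {}"
  shows "X t (translate (x, r) w) = (x, 0) + X (t - r) w"
  using assms passage_nonneg[OF assms]
  by (auto simp: time_changed_process_eq passage_def crossing_times_translate prod_eq_iff)

text \<open>The restarted path is u \<mapsto> \<open>w (\<tau> + u) - (0, s)\<close>, so it crosses
  t exactly when w crosses s + t, with times shifted by \<tau>. Its process X therefore continues
  that of w.\<close>

lemma time_changed_process_shift:
  assumes w: "w \<in> space path_space" and ne: "crossing_times s w \<noteq> {}" "crossing_times (s + t) w \<noteq> {}"
    and t: "0 \<le> t"
  shows "X (s + t) w =
    X t (translate (X s w) (increments_from (passage s w) w))"
proof -
  define \<tau> where "\<tau> = passage s w"
  define W where "W = translate (X s w) (increments_from \<tau> w)"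
  have \<tau>: "0 \<le> \<tau>"
    unfolding \<tau>_def using ne(1) by (rule passage_nonneg)
  have W: "W u = w (\<tau> + u) - (0, s)" if "0 \<le> u" for u
    using that ne(1) by (simp add: W_def time_changed_process_eq \<tau>_def)
  have mem: "u \<in> crossing_times t W \<longleftrightarrow> 0 < u \<and> \<tau> + u \<in> crossing_times (s + t) w" for u
  proof (cases "0 < u")
    case True
    then have "snd (W u) = snd (w (\<tau> + u)) - s"
      by (simp add: W)
    then show ?thesis
      using True \<tau> by (auto simp: crossing_times_def)
  qed (simp add: crossing_times_def)
  have ge: "\<tau> \<le> passage (s + t) w"
    unfolding \<tau>_def using ne(2) t by (intro passage_mono) auto
  have ex: "\<exists>u\<in>crossing_times t W. u < passage (s + t) w - \<tau> + e" if e: "0 < e" for e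
  proof -
    obtain v where v: "v \<in> crossing_times (s + t) w" "v < passage (s + t) w + e"
      using passage_less_iff[OF ne(2), of "passage (s + t) w + e"] e by auto
    show ?thesis
    proof (cases "\<tau> < v")
      case True
      then have "v - \<tau> \<in> crossing_times t W"
        using v(1) by (simp add: mem)
      then show ?thesis
        using v(2) by (intro bexI[of _ "v - \<tau>"]) auto
    next
      \<comment> \<open>The jump at \<tau> already overshoots s + t. The corresponding time 0 does
        not count as a crossing time of the restarted path, so positive times just after it are
        used.\<close>
      case False
      then have "v = \<tau>"
        using passage_le[OF v(1)] ge by simp
      then have "s + t < snd (w \<tau>)"
        using v(1) by (simp add: crossing_times_def)
      then obtain b where b: "\<tau> < b" "\<And>u. \<tau> < u \<Longrightarrow> u < b \<Longrightarrow> s + t < snd (w u)"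
        using path_above_right[OF w \<tau>] by blast
      define u where "u = min ((b - \<tau>) / 2) (e / 2)"
      have u: "0 < u" "\<tau> + u < b" "u < e"
        using b(1) e by (auto simp: u_def min_def field_simps)
      then have "u \<in> crossing_times t W"
        using b(2)[of "\<tau> + u"] \<tau> by (auto simp: mem) (auto simp: crossing_times_def)
      then show ?thesis
        using u ge by (intro bexI[of _ u]) auto
    qed
  qed
  have pass: "passage t W = passage (s + t) w - \<tau>"
  proof (rule passage_eqI[OF _ ex])
    show "passage (s + t) w - \<tau> \<le> u" if "u \<in> crossing_times t W" for u
      using that passage_le[of "\<tau> + u" "s + t" w] by (simp add: mem)
  qed
  have "crossing_times t W \<noteq> {}"
    using ex[of 1] by auto
  then have "X t W = W (passage (s + t) w - \<tau>) - (0, t)"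
    by (simp add: time_changed_process_eq pass)
  also have "\<dots> = X (s + t) w"
    using W[of "passage (s + t) w - \<tau>"] ge ne(2) by (simp add: time_changed_process_eq prod_eq_iff)
  finally show ?thesis
    by (simp add: W_def \<tau>_def)
qed

text \<open>The first equation is the locality hypothesis of \<open>regeneration\<close>; the second
  shows that X up to a level is not affected by stopping after the passage.\<close>

lemma passage_time_stopped:
  assumes "0 < q" "passage_time t w < ennreal q"
  shows "passage_time t (stopped_path q w) = passage_time t w"
    "X t (stopped_path q w) = X t w"
proof -
  have ne: "crossing_times t w \<noteq> {}"
    using assms by (auto simp: passage_time_less_iff)
  then have lt: "passage t w < q" "0 \<le> passage t w"
    using assms passage_nonneg[OF ne] by (simp_all add: passage_time_def ennreal_less_iff)
  have eq: "w u = stopped_path q w u" if "0 < u" "u < q" for u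
    using that by (simp add: min_def)
  note * = passage_cong_before[of q w "stopped_path q w", OF eq ne lt(1)]
  show "passage_time t (stopped_path q w) = passage_time t w"
    using * ne by (simp add: passage_time_def)
  show "X t (stopped_path q w) = X t w"
    using * ne lt by (simp add: time_changed_process_eq)
qed

lemma passage_time_stopped_less:
  assumes "0 < q" "passage_time t (stopped_path q w) < ennreal q"
  shows "passage_time t w < ennreal q"
proof -
  obtain u where "u \<in> crossing_times t (stopped_path q w)" "u < q"
    using assms by (auto simp: passage_time_less_iff)
  then have "u \<in> crossing_times t w"
    by (auto simp: crossing_times_def min_absorb1)
  then show ?thesis
    using assms(1) \<open>u < q\<close> by (auto simp: passage_time_less_iff)
qed

lemma passage_time_mono: "s \<le> t \<Longrightarrow> passage_time s w \<le> passage_time t w"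
  using crossing_times_antimono[of s t w] passage_mono[of t w s]
  by (auto simp: passage_time_def intro: ennreal_leI)

context drift_subordinator
begin

section \<open>Growth of the subordinator\<close>

lemma increment_law:
  assumes "0 \<le> s" "0 \<le> t" "C \<in> sets borel"
  shows "emeasure (P z) {w\<in>space path_space. w (s + t) - w s \<in> C} = emeasure (m t) C"
proof -
  interpret prob_space "P z"
    by (rule prob_space_P)
  have "emeasure (P z) (space path_space \<inter> {w\<in>space path_space. w (s + t) - w s \<in> C}) =
      emeasure (P z) (space path_space) * emeasure (m t) C"
    using independent_increments_P[of z, unfolded independent_increments_def, rule_format, of s t "space path_space" C]
      assms sets.top[of "path_filtration s"] by simp
  then show ?thesis
    using emeasure_space_1 by (simp add: space_P Int_absorb1 Collect_restrict)
qed

text \<open>The indicator of w \<le> c is at most \<open>exp (l * (c - w))\<close>, whose mean is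
  given by the Laplace transform.\<close>

lemma chernoff:
  assumes t: "0 \<le> t" and l: "0 \<le> l"
  shows "measure (\<mu> t) {..c} \<le> exp (l * c - t * \<phi> l)"
proof -
  interpret prob_space "\<mu> t"
    using t by (rule prob_space_\<mu>)
  have sets: "{..c} \<in> sets (\<mu> t)"
    using t by (simp add: sets_\<mu>)
  have int: "integrable (\<mu> t) (\<lambda>w. exp (- l * w))"
  proof (rule integrable_const_bound[where B=1])
    show "(\<lambda>w. exp (- l * w)) \<in> borel_measurable (\<mu> t)"
      using t by (simp add: sets_\<mu> cong: measurable_cong_sets)
    show "AE w in \<mu> t. norm (exp (- l * w)) \<le> 1"
      using AE_\<mu>[OF t] by eventually_elim (use l in simp)
  qed
  have "measure (\<mu> t) {..c} = (\<integral>w. indicat_real {..c} w \<partial>\<mu> t)"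
    using sets by (simp add: measure_def sets_eq_imp_space_eq[OF sets_\<mu>[OF t]])
  also have "\<dots> \<le> (\<integral>w. exp (l * c) * exp (- l * w) \<partial>\<mu> t)"
  proof (rule integral_mono)
    show "integrable (\<mu> t) (indicat_real {..c})"
      using sets by (intro integrable_real_indicator) (simp_all add: emeasure_eq_measure)
    show "indicat_real {..c} w \<le> exp (l * c) * exp (- l * w)" for w
      using l by (auto simp: mult_left_mono split: split_indicator simp flip: exp_add)
  qed (use int in simp)
  also have "\<dots> = exp (l * c) * exp (- t * \<phi> l)"
    using laplace_\<mu>[OF t l] by simp
  finally show ?thesis
    by (simp flip: exp_add)
qed

lemma emeasure_m_snd:
  assumes t: "0 \<le> t"
  shows "emeasure (m t) {y. snd y \<le> c} = ennreal (measure (\<mu> t) {..c})"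
proof -
  interpret prob_space "\<mu> t"
    using t by (rule prob_space_\<mu>)
  have "{y :: real \<times> real. snd y \<le> c} = UNIV \<times> {..c}"
    by auto
  then have "emeasure (m t) {y. snd y \<le> c} = emeasure (return borel t) UNIV * emeasure (\<mu> t) {..c}"
    unfolding m_def using t by (simp add: emeasure_pair_measure_Times sets_\<mu>)
  then show ?thesis
    by (simp add: emeasure_eq_measure)
qed

lemma emeasure_small_increment:
  assumes "0 \<le> s" "0 \<le> t" "0 \<le> l"
  shows "emeasure (P z) {w\<in>space path_space. snd (w (s + t) - w s) \<le> c} \<le> ennreal (exp (l * c - t * \<phi> l))"
proof -
  have "closed {y :: real \<times> real. snd y \<le> c}"
    by (intro closed_Collect_le continuous_intros)
  then have "emeasure (P z) {w\<in>space path_space. w (s + t) - w s \<in> {y. snd y \<le> c}} = ennreal (measure (\<mu> t) {..c})"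
    using assms by (subst increment_law) (simp_all add: emeasure_m_snd)
  then show ?thesis
    using chernoff[OF assms(2,3), of c] by (simp add: ennreal_leI)
qed

lemma sets_small_increment:
  assumes "0 \<le> s" "0 \<le> t"
  shows "{w\<in>space path_space. snd (w (s + t) - w s) \<le> c} \<in> sets path_space"
proof -
  have "closed {y :: real \<times> real. snd y \<le> c}"
    by (intro closed_Collect_le continuous_intros)
  then show ?thesis
    using sets_increment[OF assms, of "{y. snd y \<le> c}"] by simp
qed

text \<open>With one fixed l such that \<phi> l \<ge> 1, the Chernoff bound for staying below a
  level up to time n + 1 decays geometrically in n. The levels are integers, so that one null set
  serves all t.\<close>

lemma AE_crossing: "AE w in P z. \<forall>t. crossing_times t w \<noteq> {}"
proof -
  have "\<forall>\<^sub>F l in at_top. 1 \<le> \<phi> l \<and> 0 \<le> l"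
    using exponent_at_top eventually_ge_at_top[of 0] by (auto simp: filterlim_at_top eventually_conj)
  from eventually_happens'[OF trivial_limit_at_top_linorder this]
  obtain l where l: "1 \<le> \<phi> l" "0 \<le> l"
    by (elim exE conjE)
  have "AE w in P z. \<exists>n. K < snd (w (0 + (real n + 1)) - w 0)" for K :: real
  proof -
    define N where "N = (\<Inter>n. {w\<in>space path_space. snd (w (0 + (real n + 1)) - w 0) \<le> K})"
    have N: "N \<in> sets path_space"
      unfolding N_def by (rule sets.countable_INT') (auto simp only: countableI_type intro!: sets_small_increment)
    have bound: "emeasure (P z) N \<le> ennreal (exp (l * K - real n))" for n
    proof -
      have "emeasure (P z) N \<le> emeasure (P z) {w\<in>space path_space. snd (w (0 + (real n + 1)) - w 0) \<le> K}"
        unfolding N_def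
        by (rule emeasure_mono[OF INF_lower[OF UNIV_I]]) (unfold sets_P, intro sets_small_increment; simp)
      also have "\<dots> \<le> ennreal (exp (l * K - (real n + 1) * \<phi> l))"
        using l(2) by (intro emeasure_small_increment) auto
      also have "\<dots> \<le> ennreal (exp (l * K - real n))"
      proof -
        have "real n * 1 \<le> (real n + 1) * \<phi> l"
          using l(1) by (intro mult_mono) auto
        then show ?thesis
          by (intro ennreal_leI) simp
      qed
      finally show ?thesis .
    qed
    have "filterlim (\<lambda>n. l * K - real n) at_bot sequentially"
      using filterlim_tendsto_add_at_top[OF tendsto_const[of "- (l * K)"] filterlim_real_sequentially]
      by (simp add: filterlim_uminus_at_bot)
    then have "(\<lambda>n. exp (l * K - real n)) \<longlonglongrightarrow> 0"
      by (rule filterlim_compose[OF exp_at_bot])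
    then have "(\<lambda>n. ennreal (exp (l * K - real n))) \<longlonglongrightarrow> 0"
      using tendsto_ennrealI by fastforce
    then have "emeasure (P z) N \<le> 0"
      by (rule LIMSEQ_le_const) (use bound in blast)
    then have "N \<in> null_sets (P z)"
      using N by (simp add: null_sets_def sets_P)
    then have "AE w in P z. w \<notin> N"
      by (rule AE_not_in)
    then show ?thesis
      using AE_space by eventually_elim (auto simp: N_def space_P not_le)
  qed
  then have "AE w in P z. \<forall>K. \<exists>n. real K - snd z < snd (w (0 + (real n + 1)) - w 0)"
    by (simp add: AE_all_countable)
  then show ?thesis
    using P_start[of z]
  proof eventually_elim
    case (elim w)
    show ?case
    proof
      fix t
      obtain K where "t < real K"
        using reals_Archimedean2 by blast
      moreover obtain n where "real K - snd z < snd (w (0 + (real n + 1)) - w 0)"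
        using elim(1) by blast
      ultimately have "real n + 1 \<in> crossing_times t w"
        using elim(2) by (simp add: crossing_times_def)
      then show "crossing_times t w \<noteq> {}"
        by blast
    qed
  qed
qed

text \<open>Here the time h is fixed and l tends to infinity: the probability of no growth is at
  most \<open>exp (- h * \<phi> l)\<close>. Growth at the times 1/(n + 1) makes the passage time of
  the starting level 0.\<close>

lemma AE_increasing_at_0: "AE w in P z. \<forall>n. 0 < snd (w (1 / (real n + 1)) - w 0)"
proof -
  have "AE w in P z. 0 < snd (w (0 + h) - w 0)" if h: "0 < h" for h
  proof -
    let ?N = "{w\<in>space path_space. snd (w (0 + h) - w 0) \<le> 0}"
    have "filterlim (\<lambda>l. h * \<phi> l) at_top at_top"
      using exponent_at_top h by (rule filterlim_tendsto_pos_mult_at_top[OF tendsto_const, rotated])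
    then have "filterlim (\<lambda>l. l * 0 - h * \<phi> l) at_bot at_top"
      by (simp add: filterlim_uminus_at_bot)
    then have "((\<lambda>l. exp (l * 0 - h * \<phi> l)) \<longlongrightarrow> 0) at_top"
      by (rule filterlim_compose[OF exp_at_bot])
    then have "((\<lambda>l. ennreal (exp (l * 0 - h * \<phi> l))) \<longlongrightarrow> 0) at_top"
      using tendsto_ennrealI by fastforce
    moreover have "\<forall>\<^sub>F l in at_top. emeasure (P z) ?N \<le> ennreal (exp (l * 0 - h * \<phi> l))"
      using eventually_ge_at_top[of 0] by eventually_elim (use h in \<open>intro emeasure_small_increment; simp\<close>)
    ultimately have "emeasure (P z) ?N \<le> 0"
      by (rule tendsto_lowerbound) simp
    then have "?N \<in> null_sets (P z)"
      using h sets_small_increment[of 0 h 0] by (simp add: null_sets_def sets_P)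
    then have "AE w in P z. w \<notin> ?N"
      by (rule AE_not_in)
    then show ?thesis
      using AE_space by eventually_elim (auto simp: space_P not_le)
  qed
  from this[of "1 / (real n + 1)" for n] show ?thesis
    by (simp add: AE_all_countable)
qed

section \<open>Starting points and the Markov property\<close>

sublocale X: right_process "UNIV \<times> {0..}" path_space P X
proof (rule right_process.intro)
  show "UNIV \<times> {0::real..} \<in> sets (borel :: (real \<times> real) measure)"
    by (intro borel_closed closed_Times closed_UNIV closed_atLeast)
qed (simp_all only: prob_space_P sets_P measurable_time_changed_process time_changed_process_nonneg
    time_changed_process_right_cont)

lemma AE_start:
  assumes "0 \<le> snd z"
  shows "AE w in P z. X 0 w = z"
  using AE_increasing_at_0 P_start[of z]
proof eventually_elim
  case (elim w)
  have mem: "1 / (real n + 1) \<in> crossing_times 0 w" for n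
    using elim(1)[rule_format, of n] elim(2) assms by (simp add: crossing_times_def)
  have "passage 0 w = 0"
  proof (rule passage_eqI)
    fix e :: real assume "0 < e"
    then obtain n where "1 / (real n + 1) < e"
      using reals_Archimedean[of e] by (auto simp: inverse_eq_divide add.commute)
    then show "\<exists>u\<in>crossing_times 0 w. u < 0 + e"
      using mem by auto
  qed (auto simp: crossing_times_def)
  then show ?case
    using mem elim(2) by (auto simp: time_changed_process_eq simp flip: zero_prod_def)
qed

lemma AE_before_jump:
  assumes "t < snd z"
  shows "AE w in P z. X t w = z - (0, t)"
  using P_start[of z] AE_space
proof eventually_elim
  case (elim w)
  then show ?case
    using passage_eq_0[of w t] assms by (simp add: time_changed_process_eq space_P)
qed

lemma P_eq_translate: "P z = distr (P 0) path_space (translate z)"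
  using P_translate[of z 0] by simp

lemma nn_integral_P:
  assumes "f \<in> borel_measurable path_space"
  shows "(\<integral>\<^sup>+w. f w \<partial>P z) = (\<integral>\<^sup>+w. f (translate z w) \<partial>P 0)"
  unfolding P_eq_translate[of z] using assms measurable_translate
  by (intro nn_integral_distr) (simp_all add: measurable_P)

lemma AE_translate:
  "AE w in P 0. X t (translate (x, r) w) = (x, 0) + X (t - r) w"
  using AE_crossing[of 0] by eventually_elim (simp add: time_changed_process_translate)

lemma measurable_process_translate:
  "(\<lambda>(z, w). X t (translate z w)) \<in> borel_measurable (borel \<Otimes>\<^sub>M path_space)"
  using measurable_compose[OF measurable_translate_pair measurable_time_changed_process]
  by (simp add: split_beta')

text \<open>The past of X up to level s is contained in the past of the passage time of s. If s is
  passed before q, stopping the path at q changes no \<open>X u\<close> with u \<le> s, so the event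
  is its own preimage under stopping.\<close>

lemma sets_before_passage:
  assumes s: "0 \<le> s" and A: "A \<in> sets (X.F (ennreal s))" and q: "0 < q"
  shows "{w\<in>A. passage_time s w < ennreal q} \<in> sets (path_filtration q)"
proof -
  define D where "D = {w\<in>A. passage_time s w < ennreal q}"
  have A': "A \<in> sets path_space"
    using A X.sets_F_subset by blast
  have A_sub: "A \<subseteq> space path_space"
    using A' by (rule sets.sets_into_space)
  have "D = A \<inter> (passage_time s -` {..<ennreal q} \<inter> space path_space)"
    using A_sub by (auto simp: D_def)
  then have D: "D \<in> sets path_space"
    using A' measurable_sets[OF measurable_passage_time, of "{..<ennreal q}" s] by auto
  have "w \<in> D \<longleftrightarrow> w \<in> stopped_path q -` D \<inter> space path_space" for w
  proof (cases "w \<in> space path_space \<and> passage_time s w < ennreal q")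
    case True
    have "w \<in> A \<longleftrightarrow> stopped_path q w \<in> A"
    proof (rule natural_filtration_agree[OF A])
      fix u :: real assume u: "0 \<le> u" "ennreal u \<le> ennreal s"
      then show "X u \<in> measurable path_space X.S"
        by (intro X.measurable_X_S)
      have "passage_time u w \<le> passage_time s w"
        using u s by (intro passage_time_mono) simp
      then show "X u w = X u (stopped_path q w)"
        using True by (intro passage_time_stopped(2)[OF q, symmetric]) auto
    qed (use True q stopped_path_in_path_space[of w q] in auto)
    then show ?thesis
      using True passage_time_stopped[OF q, of s w] by (auto simp: D_def)
  next
    case False
    then show ?thesis
      using passage_time_stopped_less[OF q, of s w] A_sub by (auto simp: D_def)
  qed
  then have "D = stopped_path q -` D \<inter> space path_space"
    by blast
  also have "\<dots> \<in> sets (path_filtration q)"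
    using measurable_sets[OF measurable_stopped_path D] q by simp
  finally show ?thesis
    by (simp add: D_def)
qed

text \<open>Regeneration at the passage time, applied to A intersected with
  \<open>X s w \<in> D\<close>, gives the product on rectangles; the passage time is almost surely
  finite, so restricting to finite times changes nothing.\<close>

lemma law_at_level:
  assumes s: "0 \<le> s" and A: "A \<in> sets (X.F (ennreal s))"
  shows "distr (density (P z) (indicator A)) (borel \<Otimes>\<^sub>M path_space)
      (\<lambda>w. (X s w, increments_from (enn2real (passage_time s w)) w)) =
    distr (density (P z) (indicator A)) borel (X s) \<Otimes>\<^sub>M P 0"
proof -
  let ?N = "P_on z A"
  define W where "W w = increments_from (enn2real (passage_time s w)) w" for w
  have A': "A \<in> sets path_space"
    using A X.sets_F_subset by blast
  have W: "W \<in> measurable path_space path_space"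
    using measurable_increments_from[of "\<lambda>w. enn2real (passage_time s w)"] measurable_passage_time
    by (simp add: W_def[abs_def])
  have pair: "(\<lambda>w. (X s w, W w)) \<in> measurable path_space (borel \<Otimes>\<^sub>M path_space)"
    by (intro measurable_Pair measurable_time_changed_process W)
  interpret P0: prob_space "P 0"
    by (rule prob_space_P)
  interpret law: finite_measure "distr ?N borel (X s)"
    by (rule finite_measure_distr_P_on[OF A' measurable_time_changed_process])
  have "distr ?N borel (X s) \<Otimes>\<^sub>M P 0 =
      distr ?N (borel \<Otimes>\<^sub>M path_space) (\<lambda>w. (X s w, W w))"
  proof (rule pair_measure_eqI)
    show "sets (distr ?N borel (X s) \<Otimes>\<^sub>M P 0) =
        sets (distr ?N (borel \<Otimes>\<^sub>M path_space) (\<lambda>w. (X s w, W w)))"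
      using sets_pair_measure_cong[of "distr ?N borel (X s)" borel "P 0" path_space]
      by (simp add: sets_P)
    fix D B assume "D \<in> sets (distr ?N borel (X s))" "B \<in> sets (P 0)"
    then have D: "D \<in> sets borel" and B: "B \<in> sets path_space"
      by (simp_all add: sets_P)
    define A2 where "A2 = A \<inter> (X s -` D \<inter> space path_space)"
    have A2: "A2 \<in> sets (X.F (ennreal s))"
      unfolding A2_def using A measurable_sets[OF X.measurable_X_F_borel[OF s order_refl] D] by auto
    have A2': "A2 \<in> sets path_space"
      using A2 X.sets_F_subset by blast
    have ae: "AE w in P z. passage_time s w < \<top>"
      using AE_crossing by eventually_elim (simp add: passage_time_less_top)
    have meas1: "{w\<in>A2. passage_time s w < \<top>} \<in> sets path_space"
      by (rule sets_finite_time[OF measurable_passage_time A2'])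
    have meas2: "A2 \<inter> (W -` B \<inter> space path_space) \<in> sets path_space"
      using A2' measurable_sets[OF W B] by blast
    have "emeasure (distr ?N borel (X s)) D = emeasure (P z) A2"
      unfolding A2_def by (rule emeasure_distr_P_on[OF A' measurable_time_changed_process D])
    also have "\<dots> = emeasure (P z) {w\<in>A2. passage_time s w < \<top>}"
      using ae A2' meas1 by (intro emeasure_eq_AE) (auto simp: sets_P)
    finally have eq: "emeasure (distr ?N borel (X s)) D = emeasure (P z) {w\<in>A2. passage_time s w < \<top>}" .
    have "emeasure (distr ?N (borel \<Otimes>\<^sub>M path_space) (\<lambda>w. (X s w, W w))) (D \<times> B) =
        emeasure (P z) (A \<inter> ((\<lambda>w. (X s w, W w)) -` (D \<times> B) \<inter> space path_space))"
      using D B by (intro emeasure_distr_P_on A' pair) simp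
    also have "\<dots> = emeasure (P z) (A2 \<inter> (W -` B \<inter> space path_space))"
      by (intro arg_cong[where f="emeasure (P z)"]) (auto simp: A2_def)
    also have "\<dots> = emeasure (P z) ({w\<in>A2. passage_time s w < \<top>} \<inter> (W -` B \<inter> space path_space))"
      using ae meas2 meas1 measurable_sets[OF W B] by (intro emeasure_eq_AE) (auto simp: sets_P)
    also have "{w\<in>A2. passage_time s w < \<top>} \<inter> (W -` B \<inter> space path_space) =
        {w\<in>A2. passage_time s w < \<top> \<and> increments_from (enn2real (passage_time s w)) w \<in> B}"
      using sets.sets_into_space[OF A2'] by (auto simp: W_def)
    also have "emeasure (P z) \<dots> = emeasure (P z) {w\<in>A2. passage_time s w < \<top>} * emeasure (P 0) B"
      by (rule regeneration[OF measurable_passage_time passage_time_stopped(1) A2' sets_before_passage[OF s A2] B])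
    finally show "emeasure (distr ?N borel (X s)) D * emeasure (P 0) B =
      emeasure (distr ?N (borel \<Otimes>\<^sub>M path_space) (\<lambda>w. (X s w, W w))) (D \<times> B)"
      by (simp add: eq)
  qed unfold_locales
  then show ?thesis
    by (simp add: W_def[abs_def])
qed

text \<open>By \<open>time_changed_process_shift\<close> the later value is a function of
  \<open>X s w\<close> and of the path of increments after passage. These are independent;
  integrating out the increments under \<open>P 0\<close> and undoing the translation yields the law
  \<open>P (X s w)\<close>.\<close>

lemma markov_property:
  assumes st: "0 \<le> s" "0 \<le> t" and A: "A \<in> sets (X.F (ennreal s))" and h: "h \<in> borel_measurable borel"
  shows "(\<integral>\<^sup>+w\<in>A. h (X s w, X (s + t) w) \<partial>P z) =
    (\<integral>\<^sup>+w\<in>A. (\<integral>\<^sup>+w'. h (X s w, X t w') \<partial>P (X s w)) \<partial>P z)"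
proof -
  let ?N = "P_on z A"
  define W where "W w = increments_from (enn2real (passage_time s w)) w" for w
  define k where "k p = h (fst p, X t (translate (fst p) (snd p)))" for p
  interpret P0: prob_space "P 0"
    by (rule prob_space_P)
  have A': "A \<in> sets path_space"
    using A X.sets_F_subset by blast
  have h': "h \<in> borel_measurable (borel \<Otimes>\<^sub>M borel)"
    using h by (simp add: borel_prod)
  have k: "k \<in> borel_measurable (borel \<Otimes>\<^sub>M path_space)"
    unfolding k_def using measurable_process_translate
    by (intro measurable_compose[OF _ h'] measurable_Pair measurable_fst) (simp add: split_beta')
  have W: "(\<lambda>w. (X s w, W w)) \<in> measurable path_space (borel \<Otimes>\<^sub>M path_space)"
    using measurable_increments_from[of "\<lambda>w. enn2real (passage_time s w)"] measurable_passage_time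
    by (intro measurable_Pair measurable_time_changed_process) (simp add: W_def[abs_def])
  have k0: "k \<in> borel_measurable (distr ?N borel (X s) \<Otimes>\<^sub>M P 0)"
  proof -
    have "sets (distr ?N borel (X s) \<Otimes>\<^sub>M P 0) = sets (borel \<Otimes>\<^sub>M path_space)"
      by (intro sets_pair_measure_cong) (simp_all add: sets_P)
    then show ?thesis
      using k by (simp cong: measurable_cong_sets)
  qed
  have inner: "(\<integral>\<^sup>+w'. k (y, w') \<partial>P 0) = (\<integral>\<^sup>+w'. h (y, X t w') \<partial>P y)" for y
  proof -
    have "(\<lambda>w'. h (y, X t w')) \<in> borel_measurable path_space"
      by (intro measurable_compose[OF _ h'] measurable_Pair measurable_const measurable_time_changed_process) simp
    from nn_integral_P[OF this, of y] show ?thesis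
      by (simp add: k_def)
  qed
  have "(\<integral>\<^sup>+w\<in>A. h (X s w, X (s + t) w) \<partial>P z) =
      (\<integral>\<^sup>+w\<in>A. k (X s w, W w) \<partial>P z)"
  proof (rule nn_integral_cong_AE)
    show "AE w in P z. h (X s w, X (s + t) w) * indicator A w =
        k (X s w, W w) * indicator A w"
      using AE_crossing AE_space
    proof eventually_elim
      case (elim w)
      then show ?case
        using time_changed_process_shift[of w s t] st(2)
        by (simp add: k_def W_def space_P enn2real_passage_time)
    qed
  qed
  also have "\<dots> = (\<integral>\<^sup>+w. k (X s w, W w) \<partial>?N)"
    by (rule nn_integral_P_on[OF A' measurable_compose[OF W k], symmetric])
  also have "\<dots> = (\<integral>\<^sup>+p. k p \<partial>distr ?N (borel \<Otimes>\<^sub>M path_space) (\<lambda>w. (X s w, W w)))"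
    using W k by (intro nn_integral_distr[symmetric]) (simp_all add: measurable_P_on)
  also have "\<dots> = (\<integral>\<^sup>+p. k p \<partial>(distr ?N borel (X s) \<Otimes>\<^sub>M P 0))"
    using law_at_level[OF st(1) A, of z] by (simp add: W_def[abs_def])
  also have "\<dots> = (\<integral>\<^sup>+y. (\<integral>\<^sup>+w'. k (y, w') \<partial>P 0) \<partial>distr ?N borel (X s))"
    by (rule P0.nn_integral_fst[symmetric, OF k0])
  also have "\<dots> = (\<integral>\<^sup>+w. (\<integral>\<^sup>+w'. k (X s w, w') \<partial>P 0) \<partial>?N)"
    using measurable_time_changed_process P0.borel_measurable_nn_integral_fst[OF k0]
    by (intro nn_integral_distr) (simp_all add: measurable_P_on)
  also have "\<dots> = (\<integral>\<^sup>+w\<in>A. (\<integral>\<^sup>+w'. k (X s w, w') \<partial>P 0) \<partial>P z)"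
    using measurable_compose[OF measurable_time_changed_process, OF P0.borel_measurable_nn_integral_fst[OF k0, simplified]]
    by (intro nn_integral_P_on A')
  finally show ?thesis
    unfolding inner .
qed

text \<open>The starting point enters only through \<open>translate z\<close> under the fixed law
  \<open>P 0\<close>, so measurability is that of sections of a jointly measurable set.\<close>

lemma kernel_measurable:
  assumes "B \<in> sets borel"
  shows "(\<lambda>z. emeasure (P z) (X t -` B \<inter> space path_space)) \<in> borel_measurable borel"
proof -
  interpret P0: prob_space "P 0"
    by (rule prob_space_P)
  let ?f = "\<lambda>(z, w). X t (translate z w)"
  have cong: "sets (borel \<Otimes>\<^sub>M P 0) = sets (borel \<Otimes>\<^sub>M path_space)"
    by (intro sets_pair_measure_cong) (simp_all add: sets_P)
  have "?f -` B \<inter> space (borel \<Otimes>\<^sub>M path_space) \<in> sets (borel \<Otimes>\<^sub>M P 0)"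
    unfolding cong using measurable_process_translate assms by (rule measurable_sets)
  then have "(\<lambda>z. emeasure (P 0) (Pair z -` (?f -` B \<inter> space (borel \<Otimes>\<^sub>M path_space)))) \<in> borel_measurable borel"
    by (rule P0.measurable_emeasure_Pair)
  moreover have "emeasure (P 0) (Pair z -` (?f -` B \<inter> space (borel \<Otimes>\<^sub>M path_space))) =
      emeasure (P z) (X t -` B \<inter> space path_space)" for z
  proof -
    have "emeasure (P z) (X t -` B \<inter> space path_space) =
        emeasure (P 0) (translate z -` (X t -` B \<inter> space path_space) \<inter> space (P 0))"
      unfolding P_eq_translate[of z] using measurable_translate measurable_sets[OF measurable_time_changed_process assms]
      by (intro emeasure_distr) (simp_all add: measurable_P)
    also have "translate z -` (X t -` B \<inter> space path_space) \<inter> space (P 0) =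
        Pair z -` (?f -` B \<inter> space (borel \<Otimes>\<^sub>M path_space))"
      by (auto simp: space_P space_pair_measure translate_in_path_space)
    finally show ?thesis ..
  qed
  ultimately show ?thesis
    by simp
qed

section \<open>Small displacements and the Feller property\<close>

text \<open>Dominated convergence along a sequence of times tending to 0 refutes a lower bound,
  since X is right-continuous and starts at 0 almost surely under \<open>P 0\<close>.\<close>

lemma displacement_at_0:
  assumes e: "0 < e"
  shows "\<exists>d>0. \<forall>u\<in>{0..d}. (\<integral>\<^sup>+w. min 1 (norm (X u w)) \<partial>P 0) \<le> ennreal e"
proof (rule ccontr)
  let ?I = "\<lambda>u. \<integral>\<^sup>+w. min 1 (norm (X u w)) \<partial>P 0"
  interpret P0: prob_space "P 0"
    by (rule prob_space_P)
  assume "\<not> ?thesis"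
  then have "\<forall>n. \<exists>u\<in>{0..1 / (real n + 1)}. ennreal e < ?I u"
    by (auto simp: not_le)
  then obtain u where u: "\<And>n. u n \<in> {0..1 / (real n + 1)}" "\<And>n. ennreal e < ?I (u n)"
    by metis
  have u_lim: "u \<longlonglongrightarrow> 0"
  proof (rule tendsto_sandwich[OF _ _ tendsto_const])
    show "(\<lambda>n. 1 / (real n + 1)) \<longlonglongrightarrow> 0"
      using LIMSEQ_inverse_real_of_nat by (simp add: inverse_eq_divide add.commute)
  qed (use u(1) in \<open>auto intro: always_eventually\<close>)
  have "(\<lambda>n. ?I (u n)) \<longlonglongrightarrow> (\<integral>\<^sup>+w. 0 \<partial>P 0)"
  proof (rule nn_integral_dominated_convergence[where w="\<lambda>_. 1"])
    show "(\<lambda>w. ennreal (min 1 (norm (X (u n) w)))) \<in> borel_measurable (P 0)" for n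
      using measurable_time_changed_process[of "u n"] unfolding measurable_P
      by (intro measurable_compose[OF _ measurable_ennreal] borel_measurable_min borel_measurable_norm) auto
    show "AE w in P 0. (\<lambda>n. ennreal (min 1 (norm (X (u n) w)))) \<longlonglongrightarrow> 0"
      using AE_start[of 0, simplified] AE_space
    proof eventually_elim
      case (elim w)
      \<comment> \<open>The times \<open>u n\<close> may equal 0, which a limit along
        \<open>at_right\<close> would not cover.\<close>
      have "continuous (at 0 within {0..}) (\<lambda>t. X t w)"
        using time_changed_process_right_cont[of w 0] elim
        by (simp add: continuous_within at_within_Ici_at_right space_P)
      then have "(\<lambda>n. X (u n) w) \<longlonglongrightarrow> X 0 w"
      proof (rule continuous_within_tendsto_compose[where x=u, OF _ _ u_lim])
        show "\<forall>\<^sub>F n in sequentially. u n \<in> {0..}"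
          by (rule always_eventually) (use u(1) in auto)
      qed
      then have "(\<lambda>n. min 1 (norm (X (u n) w))) \<longlonglongrightarrow> min 1 (norm (0 :: real \<times> real))"
        using elim by (intro tendsto_min tendsto_const tendsto_norm) simp
      from tendsto_ennrealI[OF this] show ?case
        by simp
    qed
  qed (auto simp: ennreal_le_1 P0.emeasure_space_1)
  then have "ennreal e \<le> (\<integral>\<^sup>+w. 0 \<partial>P 0)"
    by (rule LIMSEQ_le_const) (use u(2) in \<open>auto intro: less_imp_le\<close>)
  then show False
    using e by simp
qed

lemma measurable_min_dist_process:
  "(\<lambda>w. ennreal (min 1 (dist z (X t w)))) \<in> borel_measurable path_space"
  using measurable_time_changed_process[of t]
  by (intro measurable_compose[OF _ measurable_ennreal] borel_measurable_min borel_measurable_dist) auto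

text \<open>If t < r, the process has merely descended by t. Otherwise the descent by r \<le> t
  \<le> e/2 costs at most e/2, and what remains is the displacement from the origin during t - r,
  which does not depend on the starting point.\<close>

lemma small_displacement:
  assumes e: "0 < e"
  shows "\<exists>d>0. \<forall>t\<in>{0..d}. \<forall>z\<in>UNIV \<times> {0..}. (\<integral>\<^sup>+w. min 1 (dist z (X t w)) \<partial>P z) \<le> ennreal e"
proof -
  obtain d where d: "0 < d"
    "\<And>u. u \<in> {0..d} \<Longrightarrow> (\<integral>\<^sup>+w. min 1 (norm (X u w)) \<partial>P 0) \<le> ennreal (e / 2)"
    using displacement_at_0[of "e / 2"] e by auto
  have "(\<integral>\<^sup>+w. min 1 (dist (x, r) (X t w)) \<partial>P (x, r)) \<le> ennreal e"
    if t: "0 \<le> t" "t \<le> min d (e / 2)" and r: "0 \<le> r" for t x r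
  proof (cases "t < r")
    case True
    interpret prob_space "P (x, r)"
      by (rule prob_space_P)
    have "(\<integral>\<^sup>+w. min 1 (dist (x, r) (X t w)) \<partial>P (x, r)) \<le> (\<integral>\<^sup>+w. ennreal e \<partial>P (x, r))"
    proof (rule nn_integral_mono_AE)
      show "AE w in P (x, r). ennreal (min 1 (dist (x, r) (X t w))) \<le> ennreal e"
        using AE_before_jump[of t "(x, r)", simplified, OF True]
      proof eventually_elim
        case (elim w)
        then show ?case
          using t e by (intro ennreal_leI min.coboundedI2) (simp add: dist_Pair_Pair dist_real_def)
      qed
    qed
    then show ?thesis
      by (simp add: emeasure_space_1)
  next
    case False
    interpret P0: prob_space "P 0"
      by (rule prob_space_P)
    have "(\<integral>\<^sup>+w. min 1 (dist (x, r) (X t w)) \<partial>P (x, r)) =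
        (\<integral>\<^sup>+w. min 1 (dist (x, r) (X t (translate (x, r) w))) \<partial>P 0)"
      by (rule nn_integral_P) (rule measurable_min_dist_process)
    also have "\<dots> \<le> (\<integral>\<^sup>+w. ennreal (e / 2) + ennreal (min 1 (norm (X (t - r) w))) \<partial>P 0)"
    proof (rule nn_integral_mono_AE)
      show "AE w in P 0. ennreal (min 1 (dist (x, r) (X t (translate (x, r) w))))
          \<le> ennreal (e / 2) + ennreal (min 1 (norm (X (t - r) w)))"
        using AE_translate[of t x r]
      proof eventually_elim
        case (elim w)
        let ?v = "X (t - r) w"
        have "dist (x, r) ((x, 0) + ?v) = norm ((0, r) - ?v)"
          by (cases ?v) (simp add: dist_norm)
        also have "\<dots> \<le> r + norm ?v"
          using norm_triangle_ineq4[of "(0 :: real, r)" ?v] r by (simp add: norm_Pair)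
        finally have "min 1 (dist (x, r) ((x, 0) + ?v)) \<le> e / 2 + min 1 (norm ?v)"
          using False t r by linarith
        from ennreal_leI[OF this] show ?case
          unfolding elim using e ennreal_plus[of "e / 2" "min 1 (norm ?v)"] by simp
      qed
    qed
    also have "\<dots> = ennreal (e / 2) + (\<integral>\<^sup>+w. min 1 (norm (X (t - r) w)) \<partial>P 0)"
      using measurable_min_dist_process[of 0 "t - r"]
      by (subst nn_integral_add) (simp_all add: measurable_P P0.emeasure_space_1)
    also have "\<dots> \<le> ennreal (e / 2) + ennreal (e / 2)"
      using False t r by (intro add_left_mono d(2)) auto
    also have "\<dots> = ennreal e"
      using e by (simp flip: ennreal_plus)
    finally show ?thesis .
  qed
  then show ?thesis
    using d(1) e by (intro exI[of _ "min d (e / 2)"]) auto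
qed

end

lemma bump_dist_bound:
  assumes "f \<in> bump"
  obtains K where "1 \<le> K" "\<And>x y. \<bar>f x - f y\<bar> \<le> K * min 1 (dist x y)"
proof -
  from assms obtain L where L: "L-lipschitz_on UNIV f"
    by (auto simp: bump_def)
  show ?thesis
  proof
    fix x y
    have "\<bar>f x - f y\<bar> \<le> max 1 L * dist x y"
      using lipschitz_onD[OF L, of x y] mult_right_mono[of L "max 1 L" "dist x y"]
      by (auto simp: dist_real_def)
    moreover have "\<bar>f x - f y\<bar> \<le> max 1 L * 1"
      using bump_bounds[OF assms, of x] bump_bounds[OF assms, of y] by linarith
    ultimately show "\<bar>f x - f y\<bar> \<le> max 1 L * min 1 (dist x y)"
      by (simp add: min_def)
  qed simp
qed

context drift_subordinator
begin

text \<open>From \<open>(x', r')\<close> the process reaches \<open>(x', r)\<close> after time \<open>r' - r\<close>, so replacing \<open>r'\<close> by \<open>r\<close> amounts to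
  lengthening the time from \<open>t\<close> to \<open>t + (r' - r)\<close>.\<close>

lemma semigroup_close:
  assumes f: "\<And>x y. \<bar>f x - f y\<bar> \<le> K * min 1 (dist x y)" "f \<in> bump" "1 \<le> K"
    and e: "0 < e"
    and d: "\<And>t z. t \<in> {0..d} \<Longrightarrow> z \<in> UNIV \<times> {0..} \<Longrightarrow>
      (\<integral>\<^sup>+w. min 1 (dist z (X t w)) \<partial>P z) \<le> ennreal e"
    and t: "0 \<le> t" and r: "0 \<le> r" "r \<le> r'" "r' \<le> r + d"
  shows "\<bar>(\<integral>w. f (X t w) \<partial>P (x, r)) - (\<integral>w. f (X t w) \<partial>P (x', r'))\<bar>
    \<le> K * (\<bar>x - x'\<bar> + e)"
proof -
  interpret P0: prob_space "P 0"
    by (rule prob_space_P)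
  have X_meas: "X u \<in> borel_measurable (P y)" for u y
    using measurable_time_changed_process by (simp add: measurable_P)
  have f_meas: "f \<in> borel_measurable borel"
    using f(2) by (rule bump_measurable)
  have shift: "(\<integral>w. f (X t w) \<partial>P (y, v)) = (\<integral>w. f ((y, 0) + X (t - v) w) \<partial>P 0)" for y v
  proof -
    have tr: "translate (y, v) \<in> measurable (P 0) path_space"
      using measurable_translate by (simp add: measurable_P)
    have "(\<integral>w. f (X t w) \<partial>P (y, v)) = (\<integral>w. f (X t (translate (y, v) w)) \<partial>P 0)"
      unfolding P_eq_translate[of "(y, v)"] using measurable_time_changed_process f_meas
      by (intro integral_distr[OF tr]) simp
    also have "\<dots> = (\<integral>w. f ((y, 0) + X (t - v) w) \<partial>P 0)"
    proof (rule integral_cong_AE)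
      show "(\<lambda>w. f (X t (translate (y, v) w))) \<in> borel_measurable (P 0)"
        using measurable_compose[OF tr measurable_time_changed_process] f_meas
        by (rule measurable_compose)
      show "(\<lambda>w. f ((y, 0) + X (t - v) w)) \<in> borel_measurable (P 0)"
        by (intro measurable_compose[OF _ f_meas] borel_measurable_add X_meas) simp
      show "AE w in P 0. f (X t (translate (y, v) w)) = f ((y, 0) + X (t - v) w)"
        using AE_translate[of t y v] by eventually_elim simp
    qed
    finally show ?thesis .
  qed
  have int: "integrable (P 0) (\<lambda>w. f ((y, 0) + X u w))" for y u
  proof (rule P0.integrable_const_bound[where B=1])
    show "(\<lambda>w. f ((y, 0) + X u w)) \<in> borel_measurable (P 0)"
      by (intro measurable_compose[OF _ f_meas] borel_measurable_add X_meas) simp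
  qed (use bump_bounds[OF f(2)] in auto)
  define D where "D w = min 1 (dist (X (t - r') w) (X (t - r) w))" for w
  have D_meas: "D \<in> borel_measurable (P 0)"
    unfolding D_def by (intro borel_measurable_min borel_measurable_const borel_measurable_dist X_meas)
  have D_int: "integrable (P 0) D"
    using D_meas by (rule P0.integrable_const_bound[where B=1, rotated]) (simp add: D_def)
  \<comment> \<open>Under translation by \<open>(x', r')\<close> the levels t - r' and t - r become
    the times t and t + (r' - r). The Markov property at t then reduces the estimate to a
    displacement during r' - r \<le> d from the point \<open>X t w\<close>.\<close>
  have D_le: "(\<integral>w. D w \<partial>P 0) \<le> e"
  proof -
    define h where "h p = ennreal (min 1 (dist (fst p) (snd p)))" for p :: "(real \<times> real) \<times> (real \<times> real)"
    have h: "h \<in> borel_measurable borel"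
      unfolding h_def by (intro measurable_compose[OF _ measurable_ennreal] borel_measurable_continuous_onI continuous_intros)
    have h': "h \<in> borel_measurable (borel \<Otimes>\<^sub>M borel)"
      using h by (simp add: borel_prod)
    interpret Pz: prob_space "P (x', r')"
      by (rule prob_space_P)
    have "(\<integral>\<^sup>+w. D w \<partial>P 0) = (\<integral>\<^sup>+w. h (X t (translate (x', r') w), X (t + (r' - r)) (translate (x', r') w)) \<partial>P 0)"
    proof (rule nn_integral_cong_AE)
      show "AE w in P 0. ennreal (D w) = h (X t (translate (x', r') w), X (t + (r' - r)) (translate (x', r') w))"
        using AE_translate[of t x' r'] AE_translate[of "t + (r' - r)" x' r'] 
        by eventually_elim (simp add: h_def D_def)
    qed
    also have "\<dots> = (\<integral>\<^sup>+w. h (X t w, X (t + (r' - r)) w) \<partial>P (x', r'))"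
      by (intro nn_integral_P[symmetric] measurable_compose[OF _ h'] measurable_Pair)
        (simp_all add: measurable_time_changed_process)
    also have "\<dots> = (\<integral>\<^sup>+w\<in>space path_space. h (X t w, X (t + (r' - r)) w) \<partial>P (x', r'))"
      by (intro nn_integral_cong) (simp add: space_P)
    also have "\<dots> = (\<integral>\<^sup>+w\<in>space path_space. (\<integral>\<^sup>+w'. h (X t w, X (r' - r) w') \<partial>P (X t w)) \<partial>P (x', r'))"
      using t r(2) h sets.top[of "X.F (ennreal t)"] by (intro markov_property) auto
    also have "\<dots> \<le> (\<integral>\<^sup>+w. ennreal e \<partial>P (x', r'))"
    proof (rule nn_integral_mono)
      fix w assume "w \<in> space (P (x', r'))"
      then have "w \<in> space path_space" "X t w \<in> UNIV \<times> {0..}"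
        using time_changed_process_nonneg by (simp_all add: space_P)
      then show "(\<integral>\<^sup>+w'. h (X t w, X (r' - r) w') \<partial>P (X t w)) * indicator (space path_space) w \<le> ennreal e"
        using d[of "r' - r" "X t w"] r by (simp add: h_def)
    qed
    also have "\<dots> = ennreal e"
      by (simp add: Pz.emeasure_space_1)
    finally have "(\<integral>\<^sup>+w. D w \<partial>P 0) \<le> ennreal e" .
    moreover have "(\<integral>\<^sup>+w. D w \<partial>P 0) = ennreal (\<integral>w. D w \<partial>P 0)"
      using D_int by (rule nn_integral_eq_integral) (simp add: D_def)
    ultimately show ?thesis
      using e by (simp add: ennreal_le_iff)
  qed
  have "\<bar>(\<integral>w. f (X t w) \<partial>P (x, r)) - (\<integral>w. f (X t w) \<partial>P (x', r'))\<bar> =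
      \<bar>\<integral>w. f ((x, 0) + X (t - r) w) - f ((x', 0) + X (t - r') w) \<partial>P 0\<bar>"
    unfolding shift by (subst Bochner_Integration.integral_diff) (simp_all add: int)
  also have "\<dots> \<le> (\<integral>w. \<bar>f ((x, 0) + X (t - r) w) - f ((x', 0) + X (t - r') w)\<bar> \<partial>P 0)"
    by (rule integral_abs_bound)
  also have "\<dots> \<le> (\<integral>w. K * \<bar>x - x'\<bar> + K * D w \<partial>P 0)"
  proof (rule integral_mono)
    show "integrable (P 0) (\<lambda>w. \<bar>f ((x, 0) + X (t - r) w) - f ((x', 0) + X (t - r') w)\<bar>)"
      by (intro integrable_abs Bochner_Integration.integrable_diff int)
    show "integrable (P 0) (\<lambda>w. K * \<bar>x - x'\<bar> + K * D w)"
      using D_int by simp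
    fix w
    let ?a = "(x, 0 :: real) + X (t - r) w" and ?b = "(x', 0) + X (t - r') w"
    have "dist ?a ?b = norm ((x - x', 0) + (X (t - r) w - X (t - r') w))"
      by (cases "X (t - r) w"; cases "X (t - r') w") (simp add: dist_norm algebra_simps)
    also have "\<dots> \<le> \<bar>x - x'\<bar> + dist (X (t - r') w) (X (t - r) w)"
      using norm_triangle_ineq[of "(x - x', 0 :: real)" "X (t - r) w - X (t - r') w"]
      by (simp add: norm_Pair dist_norm norm_minus_commute)
    finally have "min 1 (dist ?a ?b) \<le> \<bar>x - x'\<bar> + D w"
      unfolding D_def by linarith
    then have "K * min 1 (dist ?a ?b) \<le> K * (\<bar>x - x'\<bar> + D w)"
      using f(3) by (intro mult_left_mono) auto
    then show "\<bar>f ?a - f ?b\<bar> \<le> K * \<bar>x - x'\<bar> + K * D w"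
      using f(1)[of ?a ?b] by (simp add: distrib_left)
  qed
  also have "\<dots> = K * \<bar>x - x'\<bar> + K * (\<integral>w. D w \<partial>P 0)"
    using D_int by (simp add: P0.prob_space)
  also have "\<dots> \<le> K * (\<bar>x - x'\<bar> + e)"
    using D_le f(3) by (simp add: distrib_left)
  finally show ?thesis
    by simp
qed

text \<open>\<open>semigroup_close\<close> orders the two lifetimes, and exchanging the points
  covers the other order.\<close>

lemma semigroup_continuous:
  assumes f: "f \<in> bump" and t: "0 \<le> t"
  shows "continuous_on (UNIV \<times> {0..}) (\<lambda>z. \<integral>w. f (X t w) \<partial>P z)"
  unfolding continuous_on_iff
proof (intro ballI allI impI)
  let ?g = "\<lambda>z. \<integral>w. f (X t w) \<partial>P z"
  fix z :: "real \<times> real" and e :: real assume z: "z \<in> UNIV \<times> {0..}" and e: "0 < e"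
  obtain K where K: "1 \<le> K" "\<And>x y. \<bar>f x - f y\<bar> \<le> K * min 1 (dist x y)"
    using f by (rule bump_dist_bound) blast
  \<comment> \<open>c bounds both the horizontal distance and the small-time displacement, for a
    total of K * (c + c) = 2e/3.\<close>
  define c where "c = e / (3 * K)"
  have c: "0 < c" "K * (c + c) < e"
    using e K(1) by (auto simp: c_def field_simps)
  obtain d where d: "0 < d" "\<And>t z. t \<in> {0..d} \<Longrightarrow> z \<in> UNIV \<times> {0..} \<Longrightarrow>
      (\<integral>\<^sup>+w. min 1 (dist z (X t w)) \<partial>P z) \<le> ennreal c"
    using small_displacement[OF c(1)] by blast
  have close: "\<bar>?g (x, r) - ?g (x', r')\<bar> < e" if "\<bar>x - x'\<bar> \<le> c" "\<bar>r - r'\<bar> \<le> d" "0 \<le> r" "0 \<le> r'" for x r x' r'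
  proof -
    have "\<bar>?g (x, r) - ?g (x', r')\<bar> \<le> K * (\<bar>x - x'\<bar> + c)"
    proof (cases "r \<le> r'")
      case True
      then show ?thesis
        using that by (intro semigroup_close[OF K(2) f K(1) c(1) d(2) t]) auto
    next
      case False
      then have "\<bar>?g (x', r') - ?g (x, r)\<bar> \<le> K * (\<bar>x' - x\<bar> + c)"
        using that by (intro semigroup_close[OF K(2) f K(1) c(1) d(2) t]) auto
      then show ?thesis
        by (simp add: abs_minus_commute)
    qed
    also have "\<dots> \<le> K * (c + c)"
      using that K(1) by (intro mult_left_mono) auto
    finally show ?thesis
      using c(2) by simp
  qed
  show "\<exists>d>0. \<forall>z'\<in>UNIV \<times> {0..}. dist z' z < d \<longrightarrow> dist (?g z') (?g z) < e"
  proof (intro exI[of _ "min c d"] conjI ballI impI)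
    fix z' :: "real \<times> real" assume z': "z' \<in> UNIV \<times> {0..}" "dist z' z < min c d"
    then have "\<bar>fst z' - fst z\<bar> \<le> c" "\<bar>snd z' - snd z\<bar> \<le> d"
      using dist_fst_le[of z' z] dist_snd_le[of z' z] by (auto simp: dist_real_def)
    then show "dist (?g z') (?g z) < e"
      using close[of "fst z'" "fst z" "snd z'" "snd z"] z z' by (simp add: dist_real_def mem_Times_iff)
  qed (use c d in simp)
qed

sublocale X: feller_process "UNIV \<times> {0..}" path_space P X
proof (intro feller_process.intro feller_process_axioms.intro X.right_process_axioms)
  fix t :: real and B :: "(real \<times> real) set" assume "B \<in> sets borel"
  then show "(\<lambda>z. emeasure (P z) (X t -` B \<inter> space path_space)) \<in> borel_measurable X.S"
    by (intro measurable_restrict_space1 kernel_measurable)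
next
  fix z :: "real \<times> real" assume "z \<in> UNIV \<times> {0..}"
  then show "AE w in P z. X 0 w = z"
    by (intro AE_start) (simp add: mem_Times_iff)
next
  fix z
  show "AE w in P z. cadlag (UNIV \<times> {0..}) (\<lambda>t. X t w)"
    using AE_crossing AE_space by eventually_elim (intro time_changed_process_cadlag; simp add: space_P)
next
  fix z A and h :: "(real \<times> real) \<times> (real \<times> real) \<Rightarrow> ennreal" and s t :: real
  assume "0 \<le> s" "0 \<le> t" "A \<in> sets (X.F (ennreal s))" "h \<in> borel_measurable borel"
  then show "(\<integral>\<^sup>+w\<in>A. h (X s w, X (s + t) w) \<partial>P z) =
    (\<integral>\<^sup>+w\<in>A. (\<integral>\<^sup>+w'. h (X s w, X t w') \<partial>P (X s w)) \<partial>P z)"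
    by (rule markov_property)
next
  fix f :: "real \<times> real \<Rightarrow> real" and t :: real assume f: "f \<in> bump" and t: "0 \<le> t"
  have "(\<integral>\<^sup>+w. f (X t w) \<partial>P z) = ennreal (\<integral>w. f (X t w) \<partial>P z)" for z
  proof (intro nn_integral_eq_integral finite_measure.integrable_const_bound[OF finite_measure_P, where B=1])
    show "(\<lambda>w. f (X t w)) \<in> borel_measurable (P z)"
      unfolding measurable_P using measurable_time_changed_process bump_measurable[OF f] by (rule measurable_compose)
  qed (use bump_bounds[OF f] in auto)
  then show "continuous_on (UNIV \<times> {0..}) (\<lambda>z. \<integral>\<^sup>+w. f (X t w) \<partial>P z)"
    using semigroup_continuous[OF f t] by (simp add: continuous_on_ennreal)
next
  fix e :: real assume "0 < e"
  then show "\<exists>d>0. \<forall>t\<in>{0..d}. \<forall>z\<in>UNIV \<times> {0..}.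
      (\<integral>\<^sup>+w. min 1 (dist z (X t w)) \<partial>P z) \<le> ennreal e"
    by (rule small_displacement)
qed

section \<open>Formulas for the transition probabilities\<close>

lemma kernel_at_zero:
  assumes "0 \<le> t" "B \<in> sets X.S"
  shows "emeasure (X.kernel t (x, 0)) B =
    emeasure (P (x, 0)) {w\<in>space path_space. X t w \<in> B}"
  using assms X.sets_S_iff[of B]
  by (subst X.emeasure_kernel) (auto intro!: arg_cong[where f="emeasure (P (x, 0))"])

lemma emeasure_return_pair:
  fixes x y :: real
  assumes "B \<in> sets borel"
  shows "emeasure (return borel x \<Otimes>\<^sub>M return borel y) B = indicator B (x, y)"
proof -
  interpret prob_space "return borel y :: real measure"
    by (rule prob_space_return) simp
  have "sets (return borel x \<Otimes>\<^sub>M return borel y) = sets (borel :: (real \<times> real) measure)"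
    unfolding borel_prod[symmetric] by (intro sets_pair_measure_cong sets_return)
  then have B: "B \<in> sets (return borel x \<Otimes>\<^sub>M return borel y)"
    using assms by simp
  have "emeasure (return borel x \<Otimes>\<^sub>M return borel y) B =
      (\<integral>\<^sup>+u. emeasure (return borel y) (Pair u -` B) \<partial>return borel x)"
    using B by (rule emeasure_pair_measure_alt)
  also have "\<dots> = emeasure (return borel y) (Pair x -` B)"
    using measurable_emeasure_Pair[OF B] by (intro nn_integral_return) simp_all
  also have "\<dots> = indicator B (x, y)"
    using sets_Pair1[OF B, of x] by (simp add: indicator_def)
  finally show ?thesis .
qed

text \<open>For t < r the process is almost surely at (x, r - t). For r \<le> t both kernels are the
  law of (x, 0) + X at time t - r under \<open>P 0\<close>.\<close>

lemma kernel_positive: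
  assumes t: "0 \<le> t" and r: "0 < r" and B: "B \<in> sets X.S"
  shows "emeasure (X.kernel t (x, r)) B =
    of_bool (t < r) * emeasure (return borel x \<Otimes>\<^sub>M return borel (r - t)) B +
    of_bool (r \<le> t) * emeasure (X.kernel (t - r) (x, 0)) B"
proof (cases "t < r")
  case True
  interpret prob_space "P (x, r)"
    by (rule prob_space_P)
  have B': "B \<in> sets borel" "B \<subseteq> UNIV \<times> {0..}"
    using B by (auto simp: X.sets_S_iff)
  have "emeasure (X.kernel t (x, r)) B = (\<integral>\<^sup>+w. indicator B (X t w) \<partial>P (x, r))"
    using t r B' X.emeasure_kernel[of t "(x, r)" B] nn_integral_indicator_comp[of "X t" "P (x, r)" borel B]
    by (simp add: measurable_P measurable_time_changed_process space_P)
  also have "\<dots> = (\<integral>\<^sup>+w. indicator B (x, r - t) \<partial>P (x, r))"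
    using AE_before_jump[of t "(x, r)", simplified, OF True] by (intro nn_integral_cong_AE) auto
  also have "\<dots> = emeasure (return borel x \<Otimes>\<^sub>M return borel (r - t)) B"
    using B' by (simp add: emeasure_space_1 emeasure_return_pair)
  finally show ?thesis
    using True by simp
next
  case False
  have B': "B \<in> sets borel" "B \<subseteq> UNIV \<times> {0..}"
    using B by (auto simp: X.sets_S_iff)
  have kernel: "emeasure (X.kernel u (x, v)) B = (\<integral>\<^sup>+w. indicator B ((x, 0) + X (u - v) w) \<partial>P 0)"
    if "0 \<le> u" "0 \<le> v" for u v
  proof -
    have "emeasure (X.kernel u (x, v)) B = (\<integral>\<^sup>+w. indicator B (X u w) \<partial>P (x, v))"
      using that B' X.emeasure_kernel[of u "(x, v)" B] nn_integral_indicator_comp[of "X u" "P (x, v)" borel B]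
      by (simp add: measurable_P measurable_time_changed_process space_P)
    also have "\<dots> = (\<integral>\<^sup>+w. indicator B (X u (translate (x, v) w)) \<partial>P 0)"
      by (intro nn_integral_P measurable_compose[OF measurable_time_changed_process]) (use B' in simp)
    also have "\<dots> = (\<integral>\<^sup>+w. indicator B ((x, 0) + X (u - v) w) \<partial>P 0)"
      using AE_translate[of u x v] by (intro nn_integral_cong_AE) auto
    finally show ?thesis .
  qed
  show ?thesis
    using False t r kernel[of t r] kernel[of "t - r" 0] by simp
qed

end

section \<open>The Laplace exponent tends to infinity\<close>

text \<open>The integrand is at most \<open>max 1 l * min 1 s\<close>. Integrability ensures that
  the integral in \<open>laplace_exponent\<close> is a genuine value and not the default 0.\<close>

lemma laplace_exponent_integrable:
  assumes \<nu>: "levy_measure \<nu>" and l: "0 \<le> l"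
  shows "integrable \<nu> (\<lambda>s. 1 - exp (- l * s))"
proof (rule integrableI_bounded)
  have sets: "sets \<nu> = sets (restrict_space borel {0<..})"
    using \<nu> by (simp add: levy_measure_def)
  have sp: "space \<nu> = {0<..}"
    using sets_eq_imp_space_eq[OF sets] by (simp add: space_restrict_space)
  have meas: "f \<in> borel_measurable \<nu>" if "f \<in> borel_measurable borel" for f :: "real \<Rightarrow> real"
    using measurable_restrict_space1[OF that, of "{0<..}"] sets by (simp cong: measurable_cong_sets)
  show "(\<lambda>s. 1 - exp (- l * s)) \<in> borel_measurable \<nu>"
    by (intro meas) simp
  have "(\<integral>\<^sup>+s. ennreal (norm (1 - exp (- l * s))) \<partial>\<nu>) \<le> (\<integral>\<^sup>+s. ennreal (max 1 l) * ennreal (min 1 s) \<partial>\<nu>)"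
  proof (rule nn_integral_mono)
    fix s assume "s \<in> space \<nu>"
    then have s: "0 < s"
      by (simp add: sp)
    have "1 - exp (- l * s) \<le> l * s"
      using exp_ge_add_one_self[of "- l * s"] by linarith
    also have "l * s \<le> max 1 l * s"
      using s by (intro mult_right_mono) auto
    finally have "1 - exp (- l * s) \<le> max 1 l * s" .
    moreover have "1 - exp (- l * s) \<le> max 1 l * 1"
      using exp_gt_zero[of "- l * s"] by linarith
    ultimately have "norm (1 - exp (- l * s)) \<le> max 1 l * min 1 s"
      using l s by (simp add: min_def)
    then show "ennreal (norm (1 - exp (- l * s))) \<le> ennreal (max 1 l) * ennreal (min 1 s)"
      using s by (subst ennreal_mult[symmetric]) (auto intro: ennreal_leI)
  qed
  also have "\<dots> = ennreal (max 1 l) * (\<integral>\<^sup>+s. ennreal (min 1 s) \<partial>\<nu>)"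
    by (intro nn_integral_cmult measurable_compose[OF meas measurable_ennreal]) simp
  also have "\<dots> < \<infinity>"
    using \<nu> by (simp add: levy_measure_def ennreal_mult_less_top)
  finally show "(\<integral>\<^sup>+s. ennreal (norm (1 - exp (- l * s))) \<partial>\<nu>) < \<infinity>" .
qed

lemma laplace_exponent_at_top:
  assumes b: "0 \<le> b" and \<nu>: "levy_measure \<nu>" and unbounded: "0 < b \<or> emeasure \<nu> {0<..} = \<infinity>"
  shows "filterlim (laplace_exponent b \<nu>) at_top at_top"
proof -
  have sets: "sets \<nu> = sets (restrict_space borel {0<..})"
    using \<nu> by (simp add: levy_measure_def)
  have sp: "space \<nu> = {0<..}"
    using sets_eq_imp_space_eq[OF sets] by (simp add: space_restrict_space)
  have nonneg: "0 \<le> (\<integral>s. (1 - exp (- l * s)) \<partial>\<nu>)" if "0 \<le> l" for l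
    using that by (intro integral_nonneg_AE AE_I2) (simp add: sp)
  show ?thesis
    using unbounded
  proof
    assume "0 < b"
    show ?thesis
    proof (rule filterlim_at_top_mono)
      show "filterlim (\<lambda>l. b * l) at_top at_top"
        using \<open>0 < b\<close> by (intro filterlim_tendsto_pos_mult_at_top[OF tendsto_const] filterlim_ident)
      show "\<forall>\<^sub>F l in at_top. b * l \<le> laplace_exponent b \<nu> l"
        using eventually_ge_at_top[of 0] by eventually_elim (use nonneg in \<open>simp add: laplace_exponent_def\<close>)
    qed
  next
    assume inf: "emeasure \<nu> {0<..} = \<infinity>"
    show ?thesis
      unfolding filterlim_at_top
    proof
      fix Z :: real
      define C where "C = max 0 Z"
      define A where "A n = {1 / (real n + 1)<..}" for n :: nat
      have A_sets: "A n \<in> sets \<nu>" for n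
        unfolding sets A_def by (subst sets_restrict_space_iff) (auto intro: less_trans)
      have "(\<Union>n. A n) = {0<..}"
      proof (intro set_eqI iffI)
        fix s assume "s \<in> {0::real<..}"
        then obtain n where "1 / (real n + 1) < s"
          using reals_Archimedean[of s] by (auto simp: inverse_eq_divide add.commute)
        then show "s \<in> (\<Union>n. A n)"
          by (auto simp: A_def)
      qed (auto simp: A_def intro: less_trans[rotated])
      moreover have "incseq A"
        by (rule incseq_SucI) (auto simp: A_def field_simps intro: le_less_trans[rotated])
      ultimately have "(SUP n. emeasure \<nu> (A n)) = \<infinity>"
        using SUP_emeasure_incseq[of A \<nu>] A_sets inf by auto
      then have "ennreal (2 * C) < (SUP n. emeasure \<nu> (A n))"
        by (simp only: infinity_ennreal_def ennreal_less_top)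
      \<comment> \<open>The factor 2 compensates the lower bound 1/2 for the integrand: on
        \<open>A n\<close> and for l \<ge> n + 1 the product l * s is at least 1, so exp (l * s)
        \<ge> 1 + l * s \<ge> 2.\<close>
      then obtain n where n: "ennreal (2 * C) < emeasure \<nu> (A n)"
        by (auto simp: less_SUP_iff)
      have "Z \<le> laplace_exponent b \<nu> l" if l: "real n + 1 \<le> l" for l
      proof -
        have l0: "0 \<le> l"
          using l by simp
        have "ennreal C = ennreal (1 / 2) * ennreal (2 * C)"
          by (subst ennreal_mult[symmetric]) (auto simp: C_def)
        also have "\<dots> \<le> ennreal (1 / 2) * emeasure \<nu> (A n)"
          using n by (intro mult_left_mono) auto
        also have "\<dots> = (\<integral>\<^sup>+s. ennreal (1 / 2) * indicator (A n) s \<partial>\<nu>)"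
          using A_sets by (simp add: nn_integral_cmult_indicator)
        also have "\<dots> \<le> (\<integral>\<^sup>+s. ennreal (1 - exp (- l * s)) \<partial>\<nu>)"
        proof (rule nn_integral_mono)
          fix s assume "s \<in> space \<nu>"
          show "ennreal (1 / 2) * indicator (A n) s \<le> ennreal (1 - exp (- l * s))"
          proof (cases "s \<in> A n")
            case True
            then have "1 / (real n + 1) < s"
              by (simp add: A_def)
            then have "1 \<le> (real n + 1) * s"
              by (simp add: field_simps)
            also have "(real n + 1) * s \<le> l * s"
              using l \<open>s \<in> space \<nu>\<close> by (intro mult_right_mono) (auto simp: sp)
            finally have "2 \<le> exp (l * s)"
              using exp_ge_add_one_self[of "l * s"] by linarith
            then have "exp (- l * s) \<le> 1 / 2"
              using le_imp_inverse_le[of 2 "exp (l * s)"] by (simp add: exp_minus inverse_eq_divide)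
            then have "1 / 2 \<le> 1 - exp (- l * s)"
              by linarith
            from ennreal_leI[OF this] show ?thesis
              using True by (simp only: indicator_simps mult_1_right)
          qed simp
        qed
        also have "\<dots> = ennreal (\<integral>s. (1 - exp (- l * s)) \<partial>\<nu>)"
          using laplace_exponent_integrable[OF \<nu> l0] l0
          by (intro nn_integral_eq_integral AE_I2) (simp_all add: sp)
        finally have "C \<le> (\<integral>s. (1 - exp (- l * s)) \<partial>\<nu>)"
          using nonneg[OF l0] by (simp add: ennreal_le_iff)
        moreover have "0 \<le> b * l"
          using b l0 by simp
        ultimately show ?thesis
          by (simp add: laplace_exponent_def C_def)
      qed
      then show "\<forall>\<^sub>F l in at_top. Z \<le> laplace_exponent b \<nu> l"
        using eventually_ge_at_top[of "real n + 1"] by (rule eventually_mono[rotated])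
    qed
  qed
qed

theorem theorem2p2:
  fixes b :: real and \<nu> :: "real measure" and \<mu> :: "real \<Rightarrow> real measure"
    and P :: "real \<times> real \<Rightarrow> (real \<Rightarrow> real \<times> real) measure"
  assumes "0 \<le> b" and "levy_measure \<nu>"
    and "0 < b \<or> emeasure \<nu> {0<..} = \<infinity>"
    and "subordinator_laws (laplace_exponent b \<nu>) \<mu>"
    and "canonical_process_laws (drift_subordinator_semigroup \<mu>) P"
  shows "\<exists>p :: real \<Rightarrow> real \<times> real \<Rightarrow> (real \<times> real) measure.
    hunt_process (UNIV \<times> {0..}) path_space P time_changed_process p \<and>
    (\<forall>t\<ge>0. \<forall>x. \<forall>B\<in>sets (restrict_space borel (UNIV \<times> {0..})).
       emeasure (p t (x, 0)) B =
         emeasure (P (x, 0)) {\<omega> \<in> space path_space. time_changed_process t \<omega> \<in> B}) \<and>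
    (\<forall>t\<ge>0. \<forall>x. \<forall>r>0. \<forall>B\<in>sets (restrict_space borel (UNIV \<times> {0..})).
       emeasure (p t (x, r)) B =
         of_bool (t < r) * emeasure (return borel x \<Otimes>\<^sub>M return borel (r - t)) B +
         of_bool (r \<le> t) * emeasure (p (t - r) (x, 0)) B)"
proof -
  interpret drift_subordinator "laplace_exponent b \<nu>" \<mu> P
    using assms by (intro drift_subordinator.intro laplace_exponent_at_top)
  show ?thesis
    using X.hunt_process_kernel kernel_at_zero kernel_positive by (intro exI[of _ X.kernel] conjI allI impI ballI)
qed

end
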